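(* Graphs of twin-width at most $1$ can be recognized in polynomial time. Moreover, for a graph of twin-width at most $1$, a $1$-sequence in which every trigraph has at most one red edge can be constructed in polynomial time.
   Context: Twin-width: a trigraph has disjoint black and red edge sets; a graph is a trigraph with no red edges. Contracting distinct $u,v$ into a new vertex $z$ makes vertices adjacent (by any edge) to exactly one of $u,v$ red neighbours of $z$, a common neighbour $x$ a black neighbour if $ux,vx$ are both black and a red neighbour otherwise, other edges unchanged. A $d$-sequence of an $n$-vertex graph $G$ is a sequence $G=G_n,\dots,G_1$ of trigraphs of red degree at most $d$, each obtained from the previous by one contraction; the twin-width is the least $d$ for which one exists. *)

theory Defs
  imports "HOL-Computational_Algebra.Polynomial"
begin

section \<open>Trigraphs and twin-width\<close>

text \<open>Vertices are natural numbers, so that a new vertex always exists and so that vertices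
  can be stored in the memory of the machine below. Edges are two-element sets.\<close>

record trigraph =
  verts :: "nat set"
  black :: "nat set set"
  red :: "nat set set"

definition is_trigraph :: "trigraph \<Rightarrow> bool" where
  "is_trigraph T \<longleftrightarrow> finite (verts T) \<and>
     (\<forall>e \<in> black T \<union> red T. e \<subseteq> verts T \<and> card e = 2) \<and> black T \<inter> red T = {}"

definition is_graph :: "trigraph \<Rightarrow> bool" where
  "is_graph G \<longleftrightarrow> is_trigraph G \<and> red G = {}"

definition adj :: "trigraph \<Rightarrow> nat \<Rightarrow> nat \<Rightarrow> bool" where
  "adj T u v \<longleftrightarrow> {u, v} \<in> black T \<or> {u, v} \<in> red T"

definition contract :: "nat \<Rightarrow> nat \<Rightarrow> nat \<Rightarrow> trigraph \<Rightarrow> trigraph" where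
  "contract u v z T =
     \<lparr>verts = insert z (verts T - {u, v}),
      black = {e \<in> black T. u \<notin> e \<and> v \<notin> e} \<union>
        {{z, x} | x. x \<in> verts T - {u, v} \<and> {u, x} \<in> black T \<and> {v, x} \<in> black T},
      red = {e \<in> red T. u \<notin> e \<and> v \<notin> e} \<union>
        {{z, x} | x. x \<in> verts T - {u, v} \<and>
           (adj T u x \<noteq> adj T v x \<or>
            adj T u x \<and> adj T v x \<and> \<not> ({u, x} \<in> black T \<and> {v, x} \<in> black T))}\<rparr>"

definition contracts_to :: "trigraph \<Rightarrow> nat \<Rightarrow> nat \<Rightarrow> nat \<Rightarrow> trigraph \<Rightarrow> bool" where
  "contracts_to T u v z T' \<longleftrightarrow>
     u \<in> verts T \<and> v \<in> verts T \<and> u \<noteq> v \<and> z \<notin> verts T \<and> T' = contract u v z T"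

lemma contracts_to_is_trigraph:
  assumes "is_trigraph T" and "contracts_to T u v z T'"
  shows "is_trigraph T'"
proof -
  have fin: "finite (verts T)" and disj: "black T \<inter> red T = {}"
    and edge: "\<And>e. e \<in> black T \<union> red T \<Longrightarrow> e \<subseteq> verts T \<and> card e = 2"
    using assms(1) by (auto simp: is_trigraph_def)
  have z: "z \<notin> verts T" and T': "T' = contract u v z T"
    using assms(2) by (auto simp: contracts_to_def)
  have zx: "{z, x} = {z, y} \<longleftrightarrow> x = y" for x y :: nat
    by (auto simp: doubleton_eq_iff)
  have "e \<subseteq> verts T' \<and> card e = 2" if "e \<in> black T' \<union> red T'" for e
    using that edge[of e] z unfolding T' contract_def by (auto simp: card_insert_if)
  moreover have "black T' \<inter> red T' = {}"
  proof -
    have "{z, x} \<notin> black T" "{z, x} \<notin> red T" for x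
      using edge[of "{z, x}"] z by auto
    then show ?thesis
      using disj unfolding T' contract_def by (auto simp: zx adj_def)
  qed
  moreover have "finite (verts T')"
    using fin by (simp add: T' contract_def)
  ultimately show ?thesis
    by (simp add: is_trigraph_def)
qed

definition red_degree :: "trigraph \<Rightarrow> nat \<Rightarrow> nat" where
  "red_degree T v = card {x \<in> verts T. {v, x} \<in> red T}"

text \<open>For an \<open>n\<close>-vertex graph \<open>G\<close>, the trigraph \<open>G\<^sub>n\<^sub>-\<^sub>i\<close> of the sequence is \<open>Ts ! i\<close>.\<close>

definition d_sequence :: "nat \<Rightarrow> trigraph \<Rightarrow> trigraph list \<Rightarrow> bool" where
  "d_sequence d G Ts \<longleftrightarrow>
     Ts \<noteq> [] \<and> length Ts = card (verts G) \<and> hd Ts = G \<and>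
     (\<forall>i. Suc i < length Ts \<longrightarrow> (\<exists>u v z. contracts_to (Ts ! i) u v z (Ts ! Suc i))) \<and>
     (\<forall>T \<in> set Ts. \<forall>v \<in> verts T. red_degree T v \<le> d)"

definition twin_width :: "trigraph \<Rightarrow> nat" where
  "twin_width G = (LEAST d. \<exists>Ts. d_sequence d G Ts)"

section \<open>Polynomial time\<close>

text \<open>The machine is a random access machine with structured control flow. The memory consists
  of named arrays of natural numbers; a program mentions only finitely many names, and a scalar
  variable is cell 0 of an array. The arithmetic operations are addition and truncated
  subtraction. Without multiplication, the bit length of the stored numbers grows by at most
  a constant (depending on the program) per step, so that polynomial time under the unit-cost
  measure is the same as polynomial time on Turing machines.\<close>

type_synonym state = "string \<Rightarrow> nat \<Rightarrow> nat"

datatype aexp = Num nat | Read string aexp | Plus aexp aexp | Minus aexp aexp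

fun aval :: "aexp \<Rightarrow> state \<Rightarrow> nat" where
  "aval (Num k) s = k"
| "aval (Read x a) s = s x (aval a s)"
| "aval (Plus a b) s = aval a s + aval b s"
| "aval (Minus a b) s = aval a s - aval b s"

datatype com =
    Skip
  | Write string aexp aexp
  | Seq com com
  | Cond aexp com com
  | While aexp com

text \<open>\<open>exec c s t s'\<close>: started in \<open>s\<close>, the program \<open>c\<close> halts in \<open>s'\<close> after \<open>t\<close> steps.
  Tests succeed on nonzero values. Each write and each test is one step; the expressions of a
  fixed program have bounded size, so this is accurate up to a constant factor.\<close>

inductive exec :: "com \<Rightarrow> state \<Rightarrow> nat \<Rightarrow> state \<Rightarrow> bool" where
  Skip: "exec Skip s 1 s"
| Write: "exec (Write x a b) s 1 (s(x := (s x)(aval a s := aval b s)))"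
| Seq: "exec c1 s t1 s' \<Longrightarrow> exec c2 s' t2 s'' \<Longrightarrow> exec (Seq c1 c2) s (t1 + t2) s''"
| CondTrue: "aval a s \<noteq> 0 \<Longrightarrow> exec c1 s t s' \<Longrightarrow> exec (Cond a c1 c2) s (t + 1) s'"
| CondFalse: "aval a s = 0 \<Longrightarrow> exec c2 s t s' \<Longrightarrow> exec (Cond a c1 c2) s (t + 1) s'"
| WhileFalse: "aval a s = 0 \<Longrightarrow> exec (While a c) s 1 s"
| WhileTrue: "aval a s \<noteq> 0 \<Longrightarrow> exec c s t1 s' \<Longrightarrow> exec (While a c) s' t2 s'' \<Longrightarrow>
    exec (While a c) s (t1 + t2 + 1) s''"

text \<open>An input is a nonempty graph on the vertices \<open>0, \<dots>, n - 1\<close>, given by \<open>n\<close> and its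
  adjacency matrix in row-major order; all other cells are initially 0. Since the matrix has
  \<open>n\<^sup>2\<close> entries, polynomial in \<open>n\<close> and polynomial in the input length mean the same.\<close>

definition input_graph :: "trigraph \<Rightarrow> bool" where
  "input_graph G \<longleftrightarrow> is_graph G \<and> (\<exists>n\<ge>1. verts G = {..<n})"

definition encode :: "trigraph \<Rightarrow> state" where
  "encode G = (let n = card (verts G) in (\<lambda>x i.
     if x = ''n'' \<and> i = 0 then n
     else if x = ''adj'' \<and> i < n * n \<and> {i div n, i mod n} \<in> black G then 1
     else 0))"

text \<open>\<open>poly_time P Q\<close>: a single program turns every input graph \<open>G\<close> satisfying the promise \<open>P\<close>,
  in time polynomial in the number of vertices, into a final memory satisfying \<open>Q G\<close>.
  Execution is deterministic, so the final memory is unique.\<close>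

definition poly_time :: "(trigraph \<Rightarrow> bool) \<Rightarrow> (trigraph \<Rightarrow> state \<Rightarrow> bool) \<Rightarrow> bool" where
  "poly_time P Q \<longleftrightarrow> (\<exists>(c :: com) (p :: nat poly). \<forall>G. input_graph G \<and> P G \<longrightarrow>
     (\<exists>t s. exec c (encode G) t s \<and> t \<le> poly p (card (verts G)) \<and> Q G s))"

definition poly_time_recognizable :: "(trigraph \<Rightarrow> bool) \<Rightarrow> bool" where
  "poly_time_recognizable C \<longleftrightarrow>
     poly_time (\<lambda>G. True) (\<lambda>G s. s ''out'' 0 = (if C G then 1 else 0))"

text \<open>A sequence of trigraphs starting from an \<open>n\<close>-vertex graph is output as the list of its
  contractions: step \<open>i\<close> contracts the vertices in cell \<open>i\<close> of the arrays \<open>fst\<close> and \<open>snd\<close>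
  into the new vertex \<open>n + i\<close>.\<close>

definition outputs_sequence :: "state \<Rightarrow> trigraph list \<Rightarrow> bool" where
  "outputs_sequence s Ts \<longleftrightarrow>
     (\<forall>i. Suc i < length Ts \<longrightarrow>
        contracts_to (Ts ! i) (s ''fst'' i) (s ''snd'' i) (length Ts + i) (Ts ! Suc i))"

end

theory Submission
  imports Defs
begin

text \<open>Quotients of a graph are given by labellings of its vertices, and two parts are joined by a
  red edge if they are not homogeneous to each other.

  A sequence of red degree at most 1 can be replaced by one with at most one red edge. If the graph
  has a nontrivial module, first contract the module and then the rest. Otherwise every part that
  is incident to no red edge is a single vertex, and then, while there is a red edge \<open>ab\<close>, the
  first contraction that involves \<open>a\<close> or \<open>b\<close> can be moved to the front.

  A trigraph with at most one red edge in such a sequence is an induced subgraph on representatives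
  with at most one recoloured edge. If there is a red edge \<open>ab\<close>, then every legal contraction other
  than that of \<open>a\<close> and \<open>b\<close> yields an induced subtrigraph and is therefore safe; if there is no
  such contraction, then \<open>a\<close> and \<open>b\<close> have to be contracted. So it suffices to guess the first
  contraction whenever there is no red edge, to continue greedily, and to keep the result once
  the red edge disappears: what remains is an induced subgraph of the input.\<close>

section \<open>Chains of quotients\<close>

text \<open>A sequence of red degree at most 1 may carry many red edges at once, and contractions
  made far from the red edge \<open>ab\<close> could interfere with the one that is moved to the
  front. They do not, because a part without red edge is a module: in a prime graph every nontrivial
  part has a red edge of its own, so under the degree bound it cannot also be red to the part that
  the moved contraction forms. Labellings are used up to their kernel, since restricting to a
  subset, collapsing a module and reordering contractions all disturb the names of the parts while
  the equivalence relation is easy to follow. The greedy search never backtracks because possession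
  of a sequence with at most one red edge is inherited by induced subtrigraphs, also when the red
  edge is given back its original adjacency. In particular every state without red edge that is
  reached from a graph of twin-width at most 1 is again such a graph, so committing to it loses
  nothing. This gives at most \<open>n\<close> rounds, each with \<open>n^2\<close> first
  contractions and one greedy completion per contraction.\<close>

definition merge :: "nat \<Rightarrow> nat \<Rightarrow> (nat \<Rightarrow> nat) \<Rightarrow> nat \<Rightarrow> nat" where
  "merge l m g = (\<lambda>x. if g x = m then l else g x)"

definition same_kernel :: "nat set \<Rightarrow> (nat \<Rightarrow> nat) \<Rightarrow> (nat \<Rightarrow> nat) \<Rightarrow> bool" where
  "same_kernel S g h \<longleftrightarrow> (\<forall>x\<in>S. \<forall>y\<in>S. g x = g y \<longleftrightarrow> h x = h y)"

definition constant_on :: "nat set \<Rightarrow> (nat \<Rightarrow> nat) \<Rightarrow> bool" where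
  "constant_on S g \<longleftrightarrow> (\<forall>x\<in>S. \<forall>y\<in>S. g x = g y)"

text \<open>The labels \<open>l\<close> and \<open>m\<close> need not occur on \<open>S\<close>.
  Such a step only renames a part or does nothing, and it lets a chain restrict to a subset step by
  step.\<close>

inductive chain :: "((nat \<Rightarrow> nat) \<Rightarrow> bool) \<Rightarrow> nat set \<Rightarrow> (nat \<Rightarrow> nat) \<Rightarrow> bool" for B S where
  stop: "B g \<Longrightarrow> constant_on S g \<Longrightarrow> chain B S g"
| step: "B g \<Longrightarrow> chain B S (merge l m g) \<Longrightarrow> chain B S g"

lemma chain_bound: "chain B S g \<Longrightarrow> B g"
  by (induction rule: chain.induct) auto

lemma chain_mono:
  assumes "chain B S g" and "S' \<subseteq> S" and "\<And>g. B g \<Longrightarrow> B' g"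
  shows "chain B' S' g"
  using assms(1)
proof (induction rule: chain.induct)
  case (stop g)
  show ?case
    by (rule chain.stop[where B = B']) (use stop assms(2,3) in \<open>auto simp: constant_on_def\<close>)
next
  case (step g l m)
  show ?case
    by (rule chain.step[where B = B' and g = g, OF assms(3)[OF step.hyps(1)] step.IH])
qed

text \<open>If both labels occur on \<open>M\<close>, the merge is copied by merging the labels of
  representatives \<open>p\<close> and \<open>q\<close>; if one is missing, the merge does not
  change the kernel on \<open>M\<close>.\<close>

lemma merge_same_kernel:
  assumes "same_kernel M g h"
  shows "(\<exists>p\<in>M. \<exists>q\<in>M. same_kernel M (merge l m g) (merge (h p) (h q) h)) \<or>
    same_kernel M (merge l m g) h"
proof -
  have ker: "g x = g y \<longleftrightarrow> h x = h y" if "x \<in> M" "y \<in> M" for x y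
    using assms that unfolding same_kernel_def by blast
  consider p q where "p \<in> M" "q \<in> M" "g p = l" "g q = m"
    | "\<forall>p\<in>M. g p \<noteq> l" | "\<forall>q\<in>M. g q \<noteq> m" by blast
  then show ?thesis
  proof cases
    case 1
    have *: "(g x = l \<longleftrightarrow> h x = h p) \<and> (g x = m \<longleftrightarrow> h x = h q)" if "x \<in> M" for x
      using ker[OF that 1(1)] ker[OF that 1(2)] 1(3,4) by simp
    have "merge l m g x = merge l m g y \<longleftrightarrow> merge (h p) (h q) h x = merge (h p) (h q) h y"
      if "x \<in> M" "y \<in> M" for x y
      using *[OF that(1)] *[OF that(2)] ker[OF that] unfolding merge_def by (auto split: if_splits)
    then show ?thesis using 1(1,2) unfolding same_kernel_def by blast
  next
    case 2
    have "merge l m g x = merge l m g y \<longleftrightarrow> h x = h y" if "x \<in> M" "y \<in> M" for x y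
      using 2 that ker[OF that] unfolding merge_def by auto
    then show ?thesis unfolding same_kernel_def by blast
  next
    case 3
    have "merge l m g x = merge l m g y \<longleftrightarrow> h x = h y" if "x \<in> M" "y \<in> M" for x y
      using 3 that ker[OF that] unfolding merge_def by auto
    then show ?thesis unfolding same_kernel_def by blast
  qed
qed

text \<open>The chain for \<open>g\<close> is replayed on a labelling \<open>h\<close> that agrees
  with it on \<open>M\<close> only, while \<open>I\<close> controls \<open>h\<close> elsewhere. When
  \<open>M\<close> has become one part, \<open>fin\<close> supplies the rest of the chain on
  \<open>S\<close>. Renaming, modules and the removal of a contracted vertex are all
  instances.\<close>

lemma chain_simulate:
  assumes "chain B M g" and "same_kernel M g h" and "I h"
    and B: "\<And>g h. B g \<Longrightarrow> same_kernel M g h \<Longrightarrow> I h \<Longrightarrow> B' h"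
    and I: "\<And>h p q. I h \<Longrightarrow> p \<in> M \<Longrightarrow> q \<in> M \<Longrightarrow> I (merge (h p) (h q) h)"
    and fin: "\<And>h. I h \<Longrightarrow> B' h \<Longrightarrow> constant_on M h \<Longrightarrow> chain B' S h"
  shows "chain B' S h"
  using assms(1-3)
proof (induction arbitrary: h rule: chain.induct)
  case (stop g)
  have "constant_on M h"
    using stop.hyps(2) stop.prems(1) unfolding constant_on_def same_kernel_def by blast
  then show ?case using fin B[OF stop.hyps(1) stop.prems] stop.prems(2) by simp
next
  case (step g l m)
  have Bh: "B' h" by (rule B[OF step.hyps(1) step.prems])
  from merge_same_kernel[OF step.prems(1), of l m] show ?case
  proof
    assume "\<exists>p\<in>M. \<exists>q\<in>M. same_kernel M (merge l m g) (merge (h p) (h q) h)"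
    then obtain p q where "p \<in> M" "q \<in> M" "same_kernel M (merge l m g) (merge (h p) (h q) h)"
      by blast
    then have "chain B' S (merge (h p) (h q) h)"
      using step.IH I step.prems(2) by simp
    then show ?thesis by (rule chain.step[where B = B' and g = h, OF Bh])
  next
    assume "same_kernel M (merge l m g) h"
    then show ?thesis by (rule step.IH[OF _ step.prems(2)])
  qed
qed

section \<open>Red pairs of quotients, and chains with bounded red edges\<close>

locale adjacency =
  fixes E :: "nat \<Rightarrow> nat \<Rightarrow> bool"
  assumes E_sym: "E x y \<longleftrightarrow> E y x"
begin

text \<open>Red pairs of the quotient by \<open>g\<close> of the trigraph on \<open>S\<close> whose adjacency is \<open>E\<close> and whose
  only red edge is \<open>{a, b}\<close>; if \<open>a = b\<close> then it has no red edge.\<close>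

definition reds :: "nat set \<Rightarrow> nat \<Rightarrow> nat \<Rightarrow> (nat \<Rightarrow> nat) \<Rightarrow> nat \<Rightarrow> nat \<Rightarrow> bool" where
  "reds S a b g x y \<longleftrightarrow> x \<in> S \<and> y \<in> S \<and> g x \<noteq> g y \<and>
     (\<exists>x'\<in>S. \<exists>y'\<in>S. g x' = g x \<and> g y' = g y \<and> (E x' y' \<noteq> E x y \<or> {x', y'} = {a, b}))"

definition degree_le1 :: "nat set \<Rightarrow> nat \<Rightarrow> nat \<Rightarrow> (nat \<Rightarrow> nat) \<Rightarrow> bool" where
  "degree_le1 S a b g \<longleftrightarrow> (\<forall>x y z. reds S a b g x y \<longrightarrow> reds S a b g x z \<longrightarrow> g y = g z)"

definition edges_le1 :: "nat set \<Rightarrow> nat \<Rightarrow> nat \<Rightarrow> (nat \<Rightarrow> nat) \<Rightarrow> bool" where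
  "edges_le1 S a b g \<longleftrightarrow> (\<forall>x y x' y'. reds S a b g x y \<longrightarrow> reds S a b g x' y' \<longrightarrow>
     g x = g x' \<and> g y = g y' \<or> g x = g y' \<and> g y = g x')"

lemma reds_sym:
  assumes "reds S a b g x y"
  shows "reds S a b g y x"
proof -
  obtain x' y' where *: "x \<in> S" "y \<in> S" "g x \<noteq> g y" "x' \<in> S" "y' \<in> S" "g x' = g x" "g y' = g y"
    "E x' y' \<noteq> E x y \<or> {x', y'} = {a, b}"
    using assms unfolding reds_def by blast
  then have "E y' x' \<noteq> E y x \<or> {y', x'} = {a, b}"
    using E_sym[of x' y'] E_sym[of x y] by (simp add: insert_commute)
  with * show ?thesis unfolding reds_def by metis
qed

text \<open>If the new pair disagrees with the old one, these two pairs themselves witness that the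
  parts are not homogeneous; otherwise the old witness is still good.\<close>

lemma reds_cong:
  assumes "reds S a b g x y" and "x' \<in> S" "y' \<in> S" and "g x' = g x" "g y' = g y"
  shows "reds S a b g x' y'"
proof (cases "E x' y' = E x y")
  case True
  then show ?thesis using assms by (simp add: reds_def)
next
  case False
  then show ?thesis using assms by (auto simp: reds_def)
qed

lemma reds_kernel:
  assumes "same_kernel S g h"
  shows "reds S a b g x y \<longleftrightarrow> reds S a b h x y"
proof (cases "x \<in> S \<and> y \<in> S")
  case True
  then have "\<And>x'. x' \<in> S \<Longrightarrow> g x' = g x \<longleftrightarrow> h x' = h x" "\<And>x'. x' \<in> S \<Longrightarrow> g x' = g y \<longleftrightarrow> h x' = h y"
    using assms unfolding same_kernel_def by blast+
  then show ?thesis using True unfolding reds_def by (simp cong: bex_cong)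
qed (auto simp: reds_def)

lemma degree_le1D: "degree_le1 S a b g \<Longrightarrow> reds S a b g x y \<Longrightarrow> reds S a b g x z \<Longrightarrow> g y = g z"
  unfolding degree_le1_def by iprover

lemma edges_le1D: "edges_le1 S a b g \<Longrightarrow> reds S a b g x y \<Longrightarrow> reds S a b g x' y' \<Longrightarrow>
    g x = g x' \<and> g y = g y' \<or> g x = g y' \<and> g y = g x'"
  unfolding edges_le1_def by iprover

lemma degree_le1_kernel:
  assumes "same_kernel S g h" and "degree_le1 S a b g"
  shows "degree_le1 S a b h"
  unfolding degree_le1_def
proof (intro allI impI)
  fix x y z
  assume *: "reds S a b h x y" "reds S a b h x z"
  then have "reds S a b g x y" "reds S a b g x z"
    by (simp_all add: reds_kernel[OF assms(1)])
  then have "g y = g z" by (rule degree_le1D[OF assms(2)])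
  moreover have "y \<in> S" "z \<in> S" using * by (simp_all add: reds_def)
  ultimately show "h y = h z"
    using assms(1) by (simp add: same_kernel_def)
qed

lemma edges_le1_kernel:
  assumes "same_kernel S g h" and "edges_le1 S a b g"
  shows "edges_le1 S a b h"
  unfolding edges_le1_def
proof (intro allI impI)
  fix x y x' y'
  assume *: "reds S a b h x y" "reds S a b h x' y'"
  then have "reds S a b g x y" "reds S a b g x' y'"
    by (simp_all add: reds_kernel[OF assms(1)])
  then have "g x = g x' \<and> g y = g y' \<or> g x = g y' \<and> g y = g x'"
    by (rule edges_le1D[OF assms(2)])
  moreover have "x \<in> S" "y \<in> S" "x' \<in> S" "y' \<in> S" using * by (simp_all add: reds_def)
  ultimately show "h x = h x' \<and> h y = h y' \<or> h x = h y' \<and> h y = h x'"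
    using assms(1) by (simp add: same_kernel_def)
qed

lemma chain_kernel:
  assumes "chain B S g" and "same_kernel S g h"
    and "\<And>g h. same_kernel S g h \<Longrightarrow> B g \<Longrightarrow> B h"
  shows "chain B S h"
proof (rule chain_simulate[where I = "\<lambda>_. True" and B' = B, OF assms(1,2)])
  show "B h" if "B g" "same_kernel S g h" for g h using assms(3)[OF that(2,1)] .
  show "chain B S h" if "B h" "constant_on S h" for h using chain.stop[where B = B, OF that] .
qed simp_all

text \<open>Passing to an induced subtrigraph, possibly with its red edge given back the adjacency
  \<open>E\<close>, can only lose red pairs. For \<open>c = d\<close> the pair \<open>{c, d}\<close>
  is no witness, as \<open>x'\<close> and \<open>y'\<close> lie in different parts.\<close>

lemma reds_subset:
  assumes "reds S' c d g x y" and "S' \<subseteq> S" and "c = d \<or> (c = a \<and> d = b)"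
  shows "reds S a b g x y"
proof -
  obtain x' y' where *: "x \<in> S'" "y \<in> S'" "g x \<noteq> g y" "x' \<in> S'" "y' \<in> S'" "g x' = g x" "g y' = g y"
    "E x' y' \<noteq> E x y \<or> {x', y'} = {c, d}"
    using assms(1) unfolding reds_def by blast
  have "x' \<noteq> y'" using * by auto
  then have "E x' y' \<noteq> E x y \<or> {x', y'} = {a, b}"
    using *(8) assms(3) by (auto simp: doubleton_eq_iff)
  then show ?thesis using *(1-7) assms(2) unfolding reds_def by blast
qed

lemma degree_le1_subset:
  assumes "degree_le1 S a b g" and "S' \<subseteq> S" and "c = d \<or> (c = a \<and> d = b)"
  shows "degree_le1 S' c d g"
  unfolding degree_le1_def
  by (intro allI impI; rule degree_le1D[OF assms(1)]; rule reds_subset[OF _ assms(2,3)])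

lemma edges_le1_subset:
  assumes "edges_le1 S a b g" and "S' \<subseteq> S" and "c = d \<or> (c = a \<and> d = b)"
  shows "edges_le1 S' c d g"
  unfolding edges_le1_def
  by (intro allI impI; rule edges_le1D[OF assms(1)]; rule reds_subset[OF _ assms(2,3)])

lemma chain_subset_degree:
  assumes "chain (degree_le1 S a b) S g" and "S' \<subseteq> S" and "c = d \<or> (c = a \<and> d = b)"
  shows "chain (degree_le1 S' c d) S' g"
  using assms(1,2) by (rule chain_mono) (rule degree_le1_subset[OF _ assms(2,3)])

lemma chain_subset_edges:
  assumes "chain (edges_le1 S a b) S g" and "S' \<subseteq> S" and "c = d \<or> (c = a \<and> d = b)"
  shows "chain (edges_le1 S' c d) S' g"
  using assms(1,2) by (rule chain_mono) (rule edges_le1_subset[OF _ assms(2,3)])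

text \<open>Steps that keep the kernel are skipped until one really joins two parts, and its labels
  are then expressed by vertices of \<open>S\<close>.\<close>

lemma chain_cases:
  assumes "chain B S g" and ker: "\<And>g h. same_kernel S g h \<Longrightarrow> B g \<Longrightarrow> B h"
  shows "constant_on S g \<or> (\<exists>p\<in>S. \<exists>q\<in>S. g p \<noteq> g q \<and> chain B S (merge (g p) (g q) g))"
  using assms(1)
proof (induction rule: chain.induct)
  case (stop g)
  then show ?case by simp
next
  case (step g l m)
  show ?case
  proof (cases "same_kernel S (merge l m g) g")
    case True
    show ?thesis using step.IH
    proof
      assume "constant_on S (merge l m g)"
      then have "constant_on S g" using True unfolding constant_on_def same_kernel_def by blast
      then show ?thesis ..
    next
      assume "\<exists>p\<in>S. \<exists>q\<in>S. merge l m g p \<noteq> merge l m g q \<and>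
        chain B S (merge (merge l m g p) (merge l m g q) (merge l m g))"
      then obtain p q where pq: "p\<in>S" "q\<in>S" "merge l m g p \<noteq> merge l m g q"
        "chain B S (merge (merge l m g p) (merge l m g q) (merge l m g))" by blast
      have ne: "g p \<noteq> g q" using True pq(1-3) unfolding same_kernel_def by blast
      \<comment> \<open>Stated for an arbitrary \<open>h\<close> so that the case analysis does not
        meet nested merges; it is used with \<open>merge l m g\<close> for \<open>h\<close>.\<close>
      have "same_kernel S (merge (h p) (h q) h) (merge (g p) (g q) g)" if "same_kernel S h g" for h
      proof -
        have hg: "h x = h y \<longleftrightarrow> g x = g y" if "x \<in> S" "y \<in> S" for x y
          using that \<open>same_kernel S h g\<close> unfolding same_kernel_def by blast
        show ?thesis unfolding same_kernel_def
        proof (intro ballI)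
          fix x y assume xy: "x \<in> S" "y \<in> S"
          have "merge (h p) (h q) h x = (if g x = g q then h p else h x)"
            "merge (h p) (h q) h y = (if g y = g q then h p else h y)"
            unfolding merge_def by (simp_all only: hg[OF xy(1) pq(2)] hg[OF xy(2) pq(2)])
          moreover have "merge (g p) (g q) g x = (if g x = g q then g p else g x)"
            "merge (g p) (g q) g y = (if g y = g q then g p else g y)"
            unfolding merge_def by (rule refl)+
          ultimately show "merge (h p) (h q) h x = merge (h p) (h q) h y \<longleftrightarrow>
            merge (g p) (g q) g x = merge (g p) (g q) g y"
            by (cases "g x = g q"; cases "g y = g q")
              (simp_all only: if_True if_False simp_thms hg[OF xy] hg[OF xy(1) pq(1)] hg[OF pq(1) xy(2)])
        qed
      qed
      from this[OF True]
      have "same_kernel S (merge (merge l m g p) (merge l m g q) (merge l m g)) (merge (g p) (g q) g)" .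
      then have "chain B S (merge (g p) (g q) g)"
        by (rule chain_kernel[OF pq(4) _ ker])
      then show ?thesis using pq(1,2) ne by blast
    qed
  next
    case False
    \<comment> \<open>With a missing label, or with \<open>l = m\<close>, the merge would have kept
      the kernel.\<close>
    have "\<exists>p\<in>S. \<exists>q\<in>S. g p = l \<and> g q = m \<and> l \<noteq> m"
      using False unfolding same_kernel_def merge_def by (auto split: if_splits)
    then obtain p q where pq: "p \<in> S" "q \<in> S" "g p = l" "g q = m" "l \<noteq> m" by blast
    have "chain B S (merge (g p) (g q) g)" using step.hyps(2) pq(3,4) by simp
    then show ?thesis using pq by auto
  qed
qed

lemma chain_degree_cases:
  assumes "chain (degree_le1 S a b) S g" and "\<not> constant_on S g"
  obtains p q where "p \<in> S" "q \<in> S" "g p \<noteq> g q" "chain (degree_le1 S a b) S (merge (g p) (g q) g)"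
proof -
  have "constant_on S g \<or>
      (\<exists>p\<in>S. \<exists>q\<in>S. g p \<noteq> g q \<and> chain (degree_le1 S a b) S (merge (g p) (g q) g))"
    by (rule chain_cases[OF assms(1)]) (rule degree_le1_kernel)
  then show ?thesis using assms(2) that by blast
qed

lemma chain_edges_cases:
  assumes "chain (edges_le1 S a b) S g" and "\<not> constant_on S g"
  obtains p q where "p \<in> S" "q \<in> S" "g p \<noteq> g q" "chain (edges_le1 S a b) S (merge (g p) (g q) g)"
proof -
  have "constant_on S g \<or>
      (\<exists>p\<in>S. \<exists>q\<in>S. g p \<noteq> g q \<and> chain (edges_le1 S a b) S (merge (g p) (g q) g))"
    by (rule chain_cases[OF assms(1)]) (rule edges_le1_kernel)
  then show ?thesis using assms(2) that by blast
qed

text \<open>Homogeneity of two parts passes to subparts, so a red pair stays red under coarsening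
  for as long as its ends are separated.\<close>

lemma reds_coarsen:
  assumes "reds S a b g x y" and h: "\<And>x y. g x = g y \<Longrightarrow> h x = h y" and "h x \<noteq> h y"
  shows "reds S a b h x y"
proof -
  obtain x' y' where *: "x \<in> S" "y \<in> S" "g x \<noteq> g y" "x' \<in> S" "y' \<in> S" "g x' = g x" "g y' = g y"
    "E x' y' \<noteq> E x y \<or> {x', y'} = {a, b}"
    using assms(1) unfolding reds_def by blast
  have "h x' = h x" "h y' = h y" by (rule h, rule *)+
  then show ?thesis using * assms(3) unfolding reds_def by blast
qed

lemma reds_merge:
  assumes "reds S a b g x y" and "merge l m g x \<noteq> merge l m g y"
  shows "reds S a b (merge l m g) x y"
  by (rule reds_coarsen[where g = g and h = "merge l m g", OF assms(1) _ assms(2)]) (simp add: merge_def)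

lemma reds_merge_untouched:
  assumes "reds S a b (merge l m g) x y" and "g x \<noteq> l" "g x \<noteq> m" "g y \<noteq> l" "g y \<noteq> m"
  shows "reds S a b g x y"
proof -
  have *: "merge l m g x' = merge l m g x \<longleftrightarrow> g x' = g x" "merge l m g x' = merge l m g y \<longleftrightarrow> g x' = g y" for x'
    using assms(2-5) by (auto simp: merge_def)
  have "merge l m g x = merge l m g y \<longleftrightarrow> g x = g y" by (rule *)
  then show ?thesis using assms(1) unfolding reds_def * by simp
qed

end

section \<open>Prime graphs\<close>

lemma merge_commute_kernel: "same_kernel S (merge l m g) (merge m l g)"
  unfolding same_kernel_def merge_def by auto

lemma card_image_merge_less:
  assumes "finite S" "p \<in> S" "q \<in> S" "g p \<noteq> g q"
  shows "card (merge (g p) (g q) g ` S) < card (g ` S)"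
proof (rule psubset_card_mono)
  show "finite (g ` S)" using assms(1) by simp
  have "merge (g p) (g q) g ` S \<subseteq> g ` S" using assms(2) by (auto simp: merge_def)
  moreover have "g q \<notin> merge (g p) (g q) g ` S" using assms(4) by (auto simp: merge_def)
  ultimately show "merge (g p) (g q) g ` S \<subset> g ` S" using assms(3) by blast
qed

context adjacency
begin

definition is_module :: "nat set \<Rightarrow> nat set \<Rightarrow> bool" where
  "is_module S M \<longleftrightarrow> M \<subseteq> S \<and> (\<forall>y\<in>S - M. \<forall>x\<in>M. \<forall>x'\<in>M. E x y = E x' y)"

definition prime_set :: "nat set \<Rightarrow> bool" where
  "prime_set S \<longleftrightarrow> (\<forall>M m. is_module S M \<longrightarrow> m \<in> M \<longrightarrow> M = {m} \<or> M = S)"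

text \<open>No vertex outside a part without red edges distinguishes two of its members, so the part
  is a module, and a prime set has only the trivial ones.\<close>

lemma unred_part_trivial:
  assumes "prime_set S" and "w \<in> S" and "\<And>y. \<not> reds S 0 0 g w y" and "\<not> constant_on S g"
    and "x \<in> S" "g x = g w"
  shows "x = w"
proof -
  let ?M = "{x\<in>S. g x = g w}"
  have "is_module S ?M"
    unfolding is_module_def
  proof (intro conjI ballI)
    fix y x x' assume y: "y \<in> S - ?M" and x: "x \<in> ?M" "x' \<in> ?M"
    have "\<not> reds S 0 0 g x y"
      using assms(3)[of y] reds_cong[of S 0 0 g x y w y] x y assms(2) by auto
    then show "E x y = E x' y" using x y by (auto simp: reds_def)
  qed auto
  then have "?M = {w} \<or> ?M = S"
    using assms(1,2) unfolding prime_set_def by blast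
  moreover have "?M \<noteq> S"
  proof
    assume "?M = S"
    then have "\<forall>x\<in>S. g x = g w" by blast
    then show False using assms(4) unfolding constant_on_def by metis
  qed
  ultimately show ?thesis using assms(5,6) by blast
qed

text \<open>In a quotient with red edge \<open>ab\<close>, the parts that no contraction avoiding \<open>a\<close> and \<open>b\<close> has
  changed yet.\<close>

definition fresh :: "nat set \<Rightarrow> nat \<Rightarrow> nat \<Rightarrow> (nat \<Rightarrow> nat) \<Rightarrow> nat \<Rightarrow> bool" where
  "fresh S a b g y \<longleftrightarrow> (\<forall>x\<in>S. g x = g y \<longrightarrow> x = y) \<or> g y = g a \<or> g y = g b"

text \<open>The vertices \<open>u\<close> and \<open>v\<close> are each other's only red neighbours
  before the contraction of \<open>u\<close> with \<open>w\<close>. A nontrivial part has a red edge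
  by primality, and a second one would violate the degree bound; this confines \<open>w\<close> and
  the red neighbour of the new part to fresh parts.\<close>

lemma touching_step:
  assumes prime: "prime_set S" and red: "reds S 0 0 g u v" and deg: "degree_le1 S 0 0 g"
    and w: "w \<in> S" "g u \<noteq> g w"
    and deg': "degree_le1 S 0 0 (merge (g u) (g w) g)" (is "degree_le1 S 0 0 ?h")
  shows "fresh S u v g w" and "reds S 0 0 ?h u y \<Longrightarrow> fresh S u v g y"
proof -
  have S: "u \<in> S" "v \<in> S" "g u \<noteq> g v" using red by (auto simp: reds_def)
  then have nconst: "\<not> constant_on S g" by (auto simp: constant_on_def)
  have red': "reds S 0 0 g v u" by (rule reds_sym[OF red])
  have huw: "?h u = ?h w" by (simp add: merge_def)
  have *: "fresh S u v g w \<and> (reds S 0 0 ?h u y \<longrightarrow> fresh S u v g y)"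
  proof (cases "g w = g v")
    case True
    have "fresh S u v g y" if y: "reds S 0 0 ?h u y"
    proof (rule ccontr)
      assume nf: "\<not> fresh S u v g y"
      have yS: "y \<in> S" using y by (simp add: reds_def)
      have gy: "g y \<noteq> g u" "g y \<noteq> g v" using nf by (auto simp: fresh_def)
      obtain z where z: "reds S 0 0 g y z"
        using nf unred_part_trivial[OF prime yS _ nconst] by (auto simp: fresh_def)
      \<comment> \<open>Otherwise \<open>y\<close> would be a second red neighbour of
        \<open>u\<close> or of \<open>v\<close>.\<close>
      have gz: "g z \<noteq> g u" "g z \<noteq> g v"
      proof -
        show "g z \<noteq> g u"
        proof
          assume "g z = g u"
          then have "reds S 0 0 g u y" using reds_cong[OF reds_sym[OF z], of u y] S yS by simp
          then show False using degree_le1D[OF deg _ red] gy by blast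
        qed
        show "g z \<noteq> g v"
        proof
          assume "g z = g v"
          then have "reds S 0 0 g v y" using reds_cong[OF reds_sym[OF z], of v y] S yS by simp
          then show False using degree_le1D[OF deg _ red'] gy by blast
        qed
      qed
      have "g y \<noteq> g z" using z by (simp add: reds_def)
      \<comment> \<open>The red pair of \<open>y\<close> and \<open>z\<close> survives, so that
        \<open>y\<close> would have two red neighbours: \<open>z\<close> and the new part.\<close>
      then have "reds S 0 0 ?h y z"
        by (intro reds_merge[OF z]) (use gy gz True in \<open>simp add: merge_def\<close>)
      then have "?h z = ?h u" using degree_le1D[OF deg' _ reds_sym[OF y]] by blast
      then show False using gz True by (simp add: merge_def)
    qed
    then show ?thesis using True by (simp add: fresh_def)
  next
    case False
    have hv: "reds S 0 0 ?h u v"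
      by (rule reds_merge[OF red]) (use S False in \<open>simp add: merge_def\<close>)
    \<comment> \<open>The new part inherits \<open>v\<close> as a red neighbour from
      \<open>u\<close>. A red edge at \<open>w\<close> would be inherited too, hence would end in
      the part of \<open>v\<close>, which already has its red edge to \<open>u\<close>.\<close>
    have "\<not> reds S 0 0 g w z" for z
    proof
      assume z: "reds S 0 0 g w z"
      have zS: "z \<in> S" and wz: "g w \<noteq> g z" using z by (auto simp: reds_def)
      have zu: "g z \<noteq> g u"
      proof
        assume "g z = g u"
        then have "reds S 0 0 g u w" using reds_cong[OF reds_sym[OF z], of u w] S w by simp
        then show False using degree_le1D[OF deg _ red] False by blast
      qed
      have "reds S 0 0 ?h w z"
        by (rule reds_merge[OF z]) (use zu wz in \<open>simp add: merge_def\<close>)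
      then have "reds S 0 0 ?h u z" using reds_cong[of S 0 0 ?h w z u z] S zS huw by simp
      then have "?h z = ?h v" using degree_le1D[OF deg' _ hv] by blast
      then have "g z = g v" using wz False zu by (simp add: merge_def)
      then have "reds S 0 0 g v w" using reds_cong[OF reds_sym[OF z], of v w] S w by simp
      then show False using degree_le1D[OF deg _ red'] w(2) by force
    qed
    then have fw: "fresh S u v g w"
      using unred_part_trivial[OF prime w(1) _ nconst] by (auto simp: fresh_def)
    have "fresh S u v g y" if y: "reds S 0 0 ?h u y"
    proof -
      have "?h y = ?h v" using degree_le1D[OF deg' y hv] .
      moreover have "?h y \<noteq> ?h u" using y by (simp add: reds_def)
      ultimately have "g y = g v" using False by (simp add: merge_def split: if_splits)
      then show ?thesis by (simp add: fresh_def)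
    qed
    with fw show ?thesis by blast
  qed
  show "fresh S u v g w" using * by blast
  show "fresh S u v g y" if "reds S 0 0 ?h u y" using * that by blast
qed

text \<open>Contractions avoiding the red edge can be postponed until after the first contraction that
  involves one of its ends.\<close>

lemma move_touching_step_first:
  assumes prime: "prime_set S" and fin: "finite S"
  shows "chain (degree_le1 S 0 0) S g \<Longrightarrow> reds S 0 0 g a b \<Longrightarrow>
    \<exists>u w. (u = a \<or> u = b) \<and> w \<in> S \<and> g u \<noteq> g w \<and> fresh S a b g w \<and>
      chain (degree_le1 S 0 0) S (merge (g u) (g w) g) \<and>
      (\<forall>y. reds S 0 0 (merge (g u) (g w) g) u y \<longrightarrow> fresh S a b g y)"
proof (induction "card (g ` S)" arbitrary: g rule: less_induct)
  case less
  note chain = less.prems(1) and red = less.prems(2)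
  have deg: "degree_le1 S 0 0 g" by (rule chain_bound[OF chain])
  have S: "a \<in> S" "b \<in> S" "g a \<noteq> g b" using red by (auto simp: reds_def)
  then have "\<not> constant_on S g" by (auto simp: constant_on_def)
  then obtain p q where pq: "p \<in> S" "q \<in> S" "g p \<noteq> g q"
    and ch': "chain (degree_le1 S 0 0) S (merge (g p) (g q) g)"
    by (rule chain_degree_cases[OF chain])
  have ch'': "chain (degree_le1 S 0 0) S (merge (g q) (g p) g)"
    by (rule chain_kernel[OF ch' merge_commute_kernel degree_le1_kernel])
  show ?case
  proof (cases "\<exists>u w. (u = a \<or> u = b) \<and> w \<in> S \<and> g u \<noteq> g w \<and>
      chain (degree_le1 S 0 0) S (merge (g u) (g w) g)")
    case True
    then obtain u w where uw: "u = a \<or> u = b" "w \<in> S" "g u \<noteq> g w"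
      and ch: "chain (degree_le1 S 0 0) S (merge (g u) (g w) g)" by blast
    define v where "v = (if u = a then b else a)"
    have ruv: "reds S 0 0 g u v" using red reds_sym[OF red] uw(1) by (auto simp: v_def)
    have fr: "fresh S u v g x \<Longrightarrow> fresh S a b g x" for x
      using uw(1) by (auto simp: fresh_def v_def split: if_splits)
    show ?thesis
      using touching_step[OF prime ruv deg uw(2,3) chain_bound[OF ch]] fr uw ch by blast
  next
    case False
    \<comment> \<open>No contraction of \<open>a\<close> or \<open>b\<close> can come first, so the
      chain begins with \<open>p\<close> and \<open>q\<close> elsewhere. The induction hypothesis
      finds a suitable \<open>u\<close> and \<open>w\<close> after that step, and the two
      contractions are then exchanged.\<close>
    have np: "g p \<noteq> g a" "g p \<noteq> g b" "g q \<noteq> g a" "g q \<noteq> g b"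
      using False pq ch' ch'' by metis+
    let ?g' = "merge (g p) (g q) g"
    have lab: "?g' x = g x" if "g x \<noteq> g q" for x using that by (simp add: merge_def)
    have red': "reds S 0 0 ?g' a b"
      by (rule reds_merge[OF red]) (use np S in \<open>simp add: merge_def\<close>)
    \<comment> \<open>The part just formed from \<open>p\<close> and \<open>q\<close> is not a
      singleton and avoids \<open>a\<close> and \<open>b\<close>, so it is not fresh.\<close>
    have fr: "fresh S a b g y \<and> g y \<noteq> g p \<and> g y \<noteq> g q" if "fresh S a b ?g' y" for y
    proof -
      from that consider "\<forall>x\<in>S. ?g' x = ?g' y \<longrightarrow> x = y" | "?g' y = ?g' a \<or> ?g' y = ?g' b"
        unfolding fresh_def by blast
      then show ?thesis
      proof cases
        case 1
        have "?g' p = g p" "?g' q = g p" by (auto simp: merge_def)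
        moreover have "?g' y = g p" if "g y = g p \<or> g y = g q" using that by (auto simp: merge_def)
        ultimately have "\<not> (g y = g p \<or> g y = g q)" using 1 pq by metis
        moreover have "\<forall>x\<in>S. g x = g y \<longrightarrow> x = y" using 1 by (simp add: merge_def)
        ultimately show ?thesis by (simp add: fresh_def)
      next
        case 2
        then have "g y = g a \<or> g y = g b"
          using np by (auto simp: merge_def split: if_splits)
        then show ?thesis using np by (auto simp: fresh_def)
      qed
    qed
    have "\<exists>u w. (u = a \<or> u = b) \<and> w \<in> S \<and> ?g' u \<noteq> ?g' w \<and> fresh S a b ?g' w \<and>
        chain (degree_le1 S 0 0) S (merge (?g' u) (?g' w) ?g') \<and>
        (\<forall>y. reds S 0 0 (merge (?g' u) (?g' w) ?g') u y \<longrightarrow> fresh S a b ?g' y)"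
      by (rule less.hyps[where g = ?g', OF card_image_merge_less[where g = g, OF fin pq] ch' red'])
    then obtain u w where u: "u = a \<or> u = b" and w: "w \<in> S" and uw': "?g' u \<noteq> ?g' w"
      and fw': "fresh S a b ?g' w"
      and ch1: "chain (degree_le1 S 0 0) S (merge (?g' u) (?g' w) ?g')"
      and fy: "\<forall>y. reds S 0 0 (merge (?g' u) (?g' w) ?g') u y \<longrightarrow> fresh S a b ?g' y"
      by (elim exE conjE)
    have uS: "u \<in> S" and gu: "g u \<noteq> g p" "g u \<noteq> g q" using u S np by auto
    have gw: "g w \<noteq> g p" "g w \<noteq> g q" and fw: "fresh S a b g w" using fr[OF fw'] by auto
    have uw: "g u \<noteq> g w" using uw' gu gw by (simp add: merge_def)
    let ?h = "merge (g u) (g w) g"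
    \<comment> \<open>Both orders lead to \<open>?h'\<close>, whose degree bound is known from the
      given chain. The bound has to be pulled back to \<open>?h\<close>, where \<open>p\<close> and
      \<open>q\<close> are still separate.\<close>
    let ?h' = "merge (g p) (g q) ?h"
    have h': "merge (?g' u) (?g' w) ?g' = ?h'"
      using gu gw pq(3) by (auto simp: merge_def fun_eq_iff)
    have deg': "degree_le1 S 0 0 ?h'" using chain_bound[OF ch1] unfolding h' .
    \<comment> \<open>A part other than those of \<open>p\<close> and \<open>q\<close> is not
      changed on the way from \<open>?h\<close> to \<open>?h'\<close>.\<close>
    have sep: "?h' y \<noteq> ?h' z" if "g y \<noteq> g p" "g y \<noteq> g q" "?h y \<noteq> ?h z" for y z
    proof -
      have "?h y \<noteq> g p" "?h y \<noteq> g q" using that gu by (auto simp: merge_def)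
      then show ?thesis using that(3) by (simp add: merge_def[of "g p"])
    qed
    have up: "reds S 0 0 ?h' y z" if "reds S 0 0 ?h y z" "g y \<noteq> g p" "g y \<noteq> g q" for y z
      using reds_merge[OF that(1)] sep[OF that(2,3)] that(1) by (simp add: reds_def)
    have redu: "fresh S a b ?g' y" if "reds S 0 0 ?h u y" for y
      using fy up[OF that gu] unfolding h' by blast
    have hu: "?h u = g u" by (simp add: merge_def)
    have "degree_le1 S 0 0 ?h"
      unfolding degree_le1_def
    proof (intro allI impI)
      fix x y z assume xy: "reds S 0 0 ?h x y" and xz: "reds S 0 0 ?h x z"
      have inS: "x \<in> S" "y \<in> S" "z \<in> S" using xy xz by (auto simp: reds_def)
      \<comment> \<open>The red neighbours of the new part are fresh, hence different from
        \<open>p\<close> and \<open>q\<close>, so two distinct ones would remain distinct in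
        \<open>?h'\<close>.\<close>
      have caseu: "?h y = ?h z" if "reds S 0 0 ?h u y" "reds S 0 0 ?h u z" for y z
      proof (rule ccontr)
        assume "?h y \<noteq> ?h z"
        then have "?h' y \<noteq> ?h' z" using sep fr[OF redu[OF that(1)]] by blast
        then show False using degree_le1D[OF deg' up[OF that(1) gu] up[OF that(2) gu]] by blast
      qed
      \<comment> \<open>If \<open>x\<close> is red to the new part then \<open>x\<close> is fresh
        itself, and both of its red pairs survive in \<open>?h'\<close>.\<close>
      have casey: "?h y = ?h z" if "reds S 0 0 ?h x y" "reds S 0 0 ?h x z" "?h y = ?h u" "y \<in> S" for y z
      proof (rule ccontr)
        assume ne: "?h y \<noteq> ?h z"
        have "reds S 0 0 ?h x u" using reds_cong[OF that(1) inS(1) uS] that(3) by simp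
        note xu = this
        have x: "g x \<noteq> g p" "g x \<noteq> g q" using fr[OF redu[OF reds_sym[OF xu]]] by auto
        have "?h' u = ?h' z" by (rule degree_le1D[OF deg' up[OF xu x] up[OF that(2) x]])
        then show False using sep[OF gu, of z] ne that(3) by simp
      qed
      show "?h y = ?h z"
      proof (cases "?h x = ?h u \<or> ?h y = ?h u \<or> ?h z = ?h u")
        case True
        then show ?thesis
        proof (elim disjE)
          assume "?h x = ?h u"
          then have ux: "?h u = ?h x" by (rule sym)
          show ?thesis
            by (rule caseu[OF reds_cong[OF xy uS inS(2) ux refl] reds_cong[OF xz uS inS(3) ux refl]])
        next
          assume "?h y = ?h u"
          then show ?thesis by (rule casey[OF xy xz _ inS(2)])
        next
          assume "?h z = ?h u"
          then have "?h z = ?h y" by (rule casey[OF xz xy _ inS(3)])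
          then show ?thesis by simp
        qed
      next
        case False
        \<comment> \<open>Away from the new part \<open>?h\<close> has only red pairs of
          \<open>g\<close>, so the bound for \<open>g\<close> applies.\<close>
        then have un: "g x \<noteq> g u" "g x \<noteq> g w" "g y \<noteq> g u" "g y \<noteq> g w" "g z \<noteq> g u" "g z \<noteq> g w"
          by (auto simp: merge_def split: if_splits)
        have "g y = g z"
          by (rule degree_le1D[OF deg reds_merge_untouched[OF xy un(1-4)]
                reds_merge_untouched[OF xz un(1,2,5,6)]])
        then show ?thesis by (simp add: merge_def)
      qed
    qed
    then have "chain (degree_le1 S 0 0) S ?h"
      by (rule chain.step[where B = "degree_le1 S 0 0" and g = ?h and l = "g p" and m = "g q"]) (use ch1 h' in simp)
    moreover have "\<forall>y. reds S 0 0 ?h u y \<longrightarrow> fresh S a b g y"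
      using redu fr by blast
    ultimately show ?thesis using u w uw fw by blast
  qed
qed

text \<open>Each contraction is chosen to involve an end of the only red edge, if there is one.
  Afterwards every red edge is incident to the new part, and red degree at most 1 there leaves a
  single edge.\<close>

lemma prime_degree_imp_edges:
  assumes prime: "prime_set S" and fin: "finite S"
  shows "chain (degree_le1 S 0 0) S g \<Longrightarrow> edges_le1 S 0 0 g \<Longrightarrow> chain (edges_le1 S 0 0) S g"
proof (induction "card (g ` S)" arbitrary: g rule: less_induct)
  case less
  note chain = less.prems(1)
  have deg: "degree_le1 S 0 0 g" by (rule chain_bound[OF chain])
  show ?case
  proof (cases "constant_on S g")
    case True
    then show ?thesis by (intro chain.stop[where g = g] less.prems)
  next
    case False
    have "\<exists>u w. u \<in> S \<and> w \<in> S \<and> g u \<noteq> g w \<and> chain (degree_le1 S 0 0) S (merge (g u) (g w) g) \<and>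
      (\<forall>x y. reds S 0 0 g x y \<longrightarrow> g x = g u \<or> g y = g u)"
    proof (cases "\<exists>a b. reds S 0 0 g a b")
      case True
      then obtain a b where ab: "reds S 0 0 g a b" by blast
      obtain u w where u: "u = a \<or> u = b" "w \<in> S" "g u \<noteq> g w"
        "chain (degree_le1 S 0 0) S (merge (g u) (g w) g)"
        using move_touching_step_first[OF prime fin chain ab] by blast
      have "g x = g u \<or> g y = g u" if "reds S 0 0 g x y" for x y
        using edges_le1D[OF less.prems(2) ab that] u(1) by metis
      moreover have "u \<in> S" using u(1) ab by (auto simp: reds_def)
      ultimately show ?thesis using u by blast
    next
      case False
      obtain p q where "p \<in> S" "q \<in> S" "g p \<noteq> g q"
        "chain (degree_le1 S 0 0) S (merge (g p) (g q) g)"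
        by (rule chain_degree_cases[OF chain \<open>\<not> constant_on S g\<close>])
      then show ?thesis using False by blast
    qed
    then obtain u w where uw: "u \<in> S" "w \<in> S" "g u \<noteq> g w"
      and ch: "chain (degree_le1 S 0 0) S (merge (g u) (g w) g)"
      and touch: "\<And>x y. reds S 0 0 g x y \<Longrightarrow> g x = g u \<or> g y = g u" by blast
    let ?h = "merge (g u) (g w) g"
    have deg': "degree_le1 S 0 0 ?h" by (rule chain_bound[OF ch])
    have hu: "?h u = g u" by (simp add: merge_def)
    have touch': "?h x = ?h u \<or> ?h y = ?h u" if "reds S 0 0 ?h x y" for x y
    proof (rule ccontr)
      assume "\<not> ?thesis"
      then have un: "g x \<noteq> g u" "g x \<noteq> g w" "g y \<noteq> g u" "g y \<noteq> g w"
        by (auto simp: merge_def split: if_splits)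
      show False using touch[OF reds_merge_untouched[OF that un]] un by blast
    qed
    have nbr: "\<exists>y'. reds S 0 0 ?h u y' \<and> (?h x = ?h u \<and> ?h y = ?h y' \<or> ?h y = ?h u \<and> ?h x = ?h y')"
      if "reds S 0 0 ?h x y" for x y
    proof -
      have xyS: "x \<in> S" "y \<in> S" using that by (auto simp: reds_def)
      from touch'[OF that] show ?thesis
      proof
        assume *: "?h x = ?h u"
        have "reds S 0 0 ?h u y" using reds_cong[OF that uw(1) xyS(2)] * by simp
        then show ?thesis using * by blast
      next
        assume *: "?h y = ?h u"
        have "reds S 0 0 ?h u x" using reds_cong[OF reds_sym[OF that] uw(1) xyS(1)] * by simp
        then show ?thesis using * by blast
      qed
    qed
    have "edges_le1 S 0 0 ?h"
      unfolding edges_le1_def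
    proof (intro allI impI)
      fix x y x' y' assume "reds S 0 0 ?h x y" "reds S 0 0 ?h x' y'"
      from nbr[OF this(1)] nbr[OF this(2)]
      obtain z z' where z: "reds S 0 0 ?h u z" "reds S 0 0 ?h u z'"
        and "?h x = ?h u \<and> ?h y = ?h z \<or> ?h y = ?h u \<and> ?h x = ?h z"
        and "?h x' = ?h u \<and> ?h y' = ?h z' \<or> ?h y' = ?h u \<and> ?h x' = ?h z'" by blast
      then show "?h x = ?h x' \<and> ?h y = ?h y' \<or> ?h x = ?h y' \<and> ?h y = ?h x'"
        using degree_le1D[OF deg' z] by auto
    qed
    then have "chain (edges_le1 S 0 0) S ?h"
      by (rule less.hyps[OF card_image_merge_less[where g = g, OF fin uw] ch])
    then show ?thesis by (rule chain.step[where B = "edges_le1 S 0 0" and g = g, OF less.prems(2)])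
  qed
qed

end

section \<open>Modules\<close>

context adjacency
begin

lemma constant_onI: "(\<And>x. x \<in> S \<Longrightarrow> h x = c) \<Longrightarrow> constant_on S h"
  unfolding constant_on_def by simp

lemma edges_le1_inj: "inj_on g S \<Longrightarrow> edges_le1 S 0 0 g"
proof -
  assume inj: "inj_on g S"
  have "\<not> reds S 0 0 g x y" for x y
  proof
    assume "reds S 0 0 g x y"
    then obtain x' y' where *: "x \<in> S" "y \<in> S" "g x \<noteq> g y" "x' \<in> S" "y' \<in> S" "g x' = g x" "g y' = g y"
      "E x' y' \<noteq> E x y \<or> {x', y'} = {0, 0}"
      unfolding reds_def by blast
    have "x' = x" "y' = y" using inj_onD[OF inj *(6) *(4,1)] inj_onD[OF inj *(7) *(5,2)] by simp_all
    then show False using *(3,8) by auto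
  qed
  then show ?thesis unfolding edges_le1_def by simp
qed

text \<open>Once \<open>M\<close> lies in one part, the representative \<open>m\<close> can stand
  for all of \<open>M\<close>: the map \<open>r\<close> preserves adjacency between vertices of
  different parts.\<close>

lemma reds_collapsed_module:
  assumes M: "is_module S M" "m \<in> M" and h: "\<forall>x\<in>M. h x = h m"
    and red: "reds S 0 0 h x y"
  defines "r \<equiv> \<lambda>x. if x \<in> M then m else x"
  shows "reds (insert m (S - M)) 0 0 h (r x) (r y)"
proof -
  have MS: "M \<subseteq> S" and mod: "\<And>y x x'. y \<in> S - M \<Longrightarrow> x \<in> M \<Longrightarrow> x' \<in> M \<Longrightarrow> E x y = E x' y"
    using M(1) unfolding is_module_def by blast+
  have r: "r x \<in> insert m (S - M)" "h (r x) = h x" if "x \<in> S" for x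
    using that h by (simp_all add: r_def)
  have Er: "E (r x) (r y) = E x y" if "x \<in> S" "y \<in> S" "h x \<noteq> h y" for x y
  proof (cases "x \<in> M"; cases "y \<in> M")
    assume "x \<in> M" "y \<in> M"
    then have "h x = h m" "h y = h m" using h by blast+
    then show ?thesis using that(3) by simp
  next
    assume "x \<in> M" "y \<notin> M"
    then show ?thesis using mod[of y x m] M(2) that(2) by (simp add: r_def)
  next
    assume "x \<notin> M" "y \<in> M"
    then show ?thesis
      using mod[of x y m] M(2) that(1) by (simp add: r_def E_sym[of x])
  next
    assume "x \<notin> M" "y \<notin> M"
    then show ?thesis by (simp add: r_def)
  qed
  obtain x' y' where *: "x \<in> S" "y \<in> S" "h x \<noteq> h y" "x' \<in> S" "y' \<in> S" "h x' = h x" "h y' = h y"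
    "E x' y' \<noteq> E x y \<or> {x', y'} = {0, 0}"
    using red unfolding reds_def by blast
  have ne: "h x' \<noteq> h y'" using *(3,6,7) by simp
  have "x' \<noteq> y'" using ne by blast
  then have "E x' y' \<noteq> E x y" using *(8) by (auto simp: doubleton_eq_iff)
  then have "E (r x') (r y') \<noteq> E (r x) (r y)"
    using Er[OF *(1,2,3)] Er[OF *(4,5) ne] by simp
  moreover have "h (r x') = h (r x)" "h (r y') = h (r y)" "h (r x) \<noteq> h (r y)"
    using r(2)[OF *(1)] r(2)[OF *(2)] r(2)[OF *(4)] r(2)[OF *(5)] *(3,6,7) by simp_all
  ultimately show ?thesis
    unfolding reds_def using r(1)[OF *(1)] r(1)[OF *(2)] r(1)[OF *(4)] r(1)[OF *(5)] by blast
qed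

text \<open>The invariant that \<open>M\<close> stays within one part makes every red pair of
  \<open>S\<close> visible on \<open>insert m (S - M)\<close>, so the chain given there can be
  replayed.\<close>

lemma chain_collapsed_module:
  assumes M: "is_module S M" "m \<in> M"
    and ch: "chain (edges_le1 (insert m (S - M)) 0 0) (insert m (S - M)) g"
    and ker: "same_kernel (insert m (S - M)) g h" and h: "\<forall>x\<in>M. h x = h m"
  shows "chain (edges_le1 S 0 0) S h"
proof (rule chain_simulate[where I = "\<lambda>h. \<forall>x\<in>M. h x = h m" and B' = "edges_le1 S 0 0", OF ch ker h])
  let ?S = "insert m (S - M)"
  let ?r = "\<lambda>x. if x \<in> M then m else x"
  fix g h :: "nat \<Rightarrow> nat"
  assume *: "edges_le1 ?S 0 0 g" "same_kernel ?S g h" "\<forall>x\<in>M. h x = h m"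
  have e: "edges_le1 ?S 0 0 h" by (rule edges_le1_kernel[OF *(2,1)])
  have hr: "h (?r x) = h x" for x using *(3) by simp
  show "edges_le1 S 0 0 h"
    unfolding edges_le1_def
  proof (intro allI impI)
    fix x y x' y' assume "reds S 0 0 h x y" "reds S 0 0 h x' y'"
    then have "reds ?S 0 0 h (?r x) (?r y)" "reds ?S 0 0 h (?r x') (?r y')"
      by - (rule reds_collapsed_module[OF M *(3)], assumption)+
    from edges_le1D[OF e this]
    show "h x = h x' \<and> h y = h y' \<or> h x = h y' \<and> h y = h x'" unfolding hr .
  qed
next
  fix h :: "nat \<Rightarrow> nat" and p q assume *: "\<forall>x\<in>M. h x = h m"
  show "\<forall>x\<in>M. merge (h p) (h q) h x = merge (h p) (h q) h m"
  proof
    fix x assume "x \<in> M"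
    then have "h x = h m" using * by blast
    then show "merge (h p) (h q) h x = merge (h p) (h q) h m" unfolding merge_def by simp
  qed
next
  fix h :: "nat \<Rightarrow> nat"
  assume *: "\<forall>x\<in>M. h x = h m" "edges_le1 S 0 0 h" "constant_on (insert m (S - M)) h"
  have "h x = h m" if "x \<in> S" for x
    using *(1,3) that unfolding constant_on_def by blast
  then have "constant_on S h" by (rule constant_onI)
  then show "chain (edges_le1 S 0 0) S h" by (rule chain.stop[where B = "edges_le1 S 0 0" and g = h, OF *(2)])
qed

text \<open>As long as the parts outside \<open>M\<close> are singletons, a vertex outside sees each
  part inside \<open>M\<close> homogeneously, so contracting inside a module makes no red edge that
  leaves it.\<close>

lemma reds_within_module:
  assumes M: "is_module S M" and h: "inj_on h (S - M)" "h ` M \<inter> h ` (S - M) = {}"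
    and red: "reds S 0 0 h x y"
  shows "reds M 0 0 h x y"
proof -
  have MS: "M \<subseteq> S" and mod: "\<And>y x x'. y \<in> S - M \<Longrightarrow> x \<in> M \<Longrightarrow> x' \<in> M \<Longrightarrow> E x y = E x' y"
    using M unfolding is_module_def by blast+
  obtain x' y' where *: "x \<in> S" "y \<in> S" "h x \<noteq> h y" "x' \<in> S" "y' \<in> S" "h x' = h x" "h y' = h y"
    "E x' y' \<noteq> E x y \<or> {x', y'} = {0, 0}"
    using red unfolding reds_def by blast
  have "x' \<noteq> y'" using *(3,6,7) by auto
  then have ne: "E x' y' \<noteq> E x y" using *(8) by (auto simp: doubleton_eq_iff)
  have out: "x = x'" if "x \<notin> M" "x \<in> S" "x' \<in> S" "h x' = h x" for x x'
  proof -
    have "x' \<notin> M" using that h(2) by (auto simp: disjoint_iff)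
    then show ?thesis using inj_onD[OF h(1) that(4)] that by simp
  qed
  have inM: "x' \<in> M" if "x \<in> M" "x' \<in> S" "h x' = h x" for x x'
    using that h(2) by (auto simp: disjoint_iff)
  have "x \<in> M \<and> y \<in> M"
  proof (rule ccontr)
    assume "\<not> (x \<in> M \<and> y \<in> M)"
    then consider "x \<notin> M" "y \<notin> M" | "x \<notin> M" "y \<in> M" | "x \<in> M" "y \<notin> M" by blast
    then show False
    proof cases
      case 1
      then show False using out[OF 1(1) *(1,4,6)] out[OF 1(2) *(2,5,7)] ne by simp
    next
      case 2
      then show False
        using out[OF 2(1) *(1,4,6)] mod[of x y' y] inM[OF 2(2) *(5,7)] ne *(1)
          E_sym[of x y] E_sym[of x y'] by simp
    next
      case 3
      then show False
        using out[OF 3(2) *(2,5,7)] mod[of y x' x] inM[OF 3(1) *(4,6)] ne *(2) by simp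
    qed
  qed
  then show ?thesis
    using *(3,6,7,8) inM[OF _ *(4,6)] inM[OF _ *(5,7)] unfolding reds_def by blast
qed

text \<open>The chain of \<open>M\<close> runs first, with the vertices outside kept as separate
  singletons. When \<open>M\<close> is one part, the chain with \<open>M\<close> replaced by
  \<open>m\<close> takes over.\<close>

lemma chain_compose_module:
  assumes M: "is_module S M" "m \<in> M" and g: "inj_on g S"
    and chM: "chain (edges_le1 M 0 0) M g"
    and chS: "chain (edges_le1 (insert m (S - M)) 0 0) (insert m (S - M)) g"
  shows "chain (edges_le1 S 0 0) S g"
proof (rule chain_simulate[where I = "\<lambda>h. inj_on h (S - M) \<and> h ` M \<inter> h ` (S - M) = {}"
      and B' = "edges_le1 S 0 0", OF chM])
  have MS: "M \<subseteq> S" using M(1) by (simp add: is_module_def)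
  show "same_kernel M g g" by (simp add: same_kernel_def)
  show "inj_on g (S - M) \<and> g ` M \<inter> g ` (S - M) = {}"
    using g MS inj_on_image_Int[OF g MS, of "S - M"] by (auto intro: inj_on_subset)
  show "edges_le1 S 0 0 h"
    if *: "edges_le1 M 0 0 g" "same_kernel M g h" "inj_on h (S - M) \<and> h ` M \<inter> h ` (S - M) = {}" for g h
  proof -
    have e: "edges_le1 M 0 0 h" by (rule edges_le1_kernel[OF *(2,1)])
    have "reds M 0 0 h x y" if "reds S 0 0 h x y" for x y
      using reds_within_module[OF M(1) _ _ that] *(3) by blast
    then show ?thesis
      unfolding edges_le1_def using edges_le1D[OF e] by metis
  qed
  show "inj_on (merge (h p) (h q) h) (S - M) \<and> merge (h p) (h q) h ` M \<inter> merge (h p) (h q) h ` (S - M) = {}"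
    if *: "inj_on h (S - M) \<and> h ` M \<inter> h ` (S - M) = {}" "p \<in> M" "q \<in> M" for h p q
  proof
    have out: "merge (h p) (h q) h x = h x" if "x \<in> S - M" for x
      using that * by (auto simp: merge_def)
    show "inj_on (merge (h p) (h q) h) (S - M)"
      using *(1) inj_on_cong[of "S - M" "merge (h p) (h q) h" h] out by blast
    have "merge (h p) (h q) h ` (S - M) = h ` (S - M)" using out by (rule image_cong[OF refl])
    moreover have "merge (h p) (h q) h ` M \<subseteq> h ` M" using *(2) by (auto simp: merge_def)
    ultimately show "merge (h p) (h q) h ` M \<inter> merge (h p) (h q) h ` (S - M) = {}"
      using *(1) by blast
  qed
  show "chain (edges_le1 S 0 0) S h"
    if *: "inj_on h (S - M) \<and> h ` M \<inter> h ` (S - M) = {}" "edges_le1 S 0 0 h" "constant_on M h" for h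
  proof (rule chain_collapsed_module[OF M chS])
    show "\<forall>x\<in>M. h x = h m" using *(3) M(2) unfolding constant_on_def by blast
    have "inj_on h (insert m (S - M))"
      using *(1) M(2) by (auto simp: inj_on_insert disjoint_iff)
    moreover have "inj_on g (insert m (S - M))"
      by (rule inj_on_subset[OF g]) (use MS M(2) in blast)
    ultimately show "same_kernel (insert m (S - M)) g h"
      unfolding same_kernel_def using inj_on_eq_iff[of h] inj_on_eq_iff[of g] by meson
  qed
qed

theorem degree_chain_imp_edges_chain:
  "finite S \<Longrightarrow> inj_on g S \<Longrightarrow> chain (degree_le1 S 0 0) S g \<Longrightarrow> chain (edges_le1 S 0 0) S g"
proof (induction "card S" arbitrary: S rule: less_induct)
  case less
  note fin = less.prems(1) and inj = less.prems(2) and ch = less.prems(3)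
  show ?case
  proof (cases "prime_set S")
    case True
    show ?thesis by (rule prime_degree_imp_edges[OF True fin ch edges_le1_inj[OF inj]])
  next
    case False
    then obtain M m where M: "is_module S M" "m \<in> M" and ne: "M \<noteq> {m}" "M \<noteq> S"
      unfolding prime_set_def by blast
    have MS: "M \<subseteq> S" using M(1) by (simp add: is_module_def)
    obtain m' where m': "m' \<in> M" "m' \<noteq> m" using ne(1) M(2) by blast
    have IH: "chain (edges_le1 T 0 0) T g" if "T \<subset> S" for T
    proof (rule less.hyps)
      show "card T < card S" using psubset_card_mono[OF fin that] .
      show "finite T" using that fin finite_subset by blast
      show "inj_on g T" by (rule inj_on_subset[OF inj]) (use that in blast)
      show "chain (degree_le1 T 0 0) T g" by (rule chain_subset_degree[OF ch]) (use that in auto)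
    qed
    \<comment> \<open>Both \<open>M\<close> and \<open>insert m (S - M)\<close> are proper subsets,
      the latter because it omits \<open>m'\<close>, so both inherit a chain of red degree at most 1
      and the induction hypothesis applies.\<close>
    show ?thesis
      by (rule chain_compose_module[OF M inj]; rule IH) (use MS M(2) ne m' in blast)+
  qed
qed

end

section \<open>Contraction sequences as chains of quotients\<close>

lemma pair_in_contract:
  assumes "is_trigraph T" and "z \<notin> verts T" and "x \<in> verts T - {u, v}" and "y \<in> verts T - {u, v}"
  shows "{x, y} \<in> black (contract u v z T) \<longleftrightarrow> {x, y} \<in> black T"
    and "{x, y} \<in> red (contract u v z T) \<longleftrightarrow> {x, y} \<in> red T"
  using assms unfolding contract_def by (auto simp: doubleton_eq_iff)

lemma new_pair_in_contract:
  assumes "is_trigraph T" and "z \<notin> verts T" and "x \<in> verts T - {u, v}"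
  shows "{z, x} \<in> black (contract u v z T) \<longleftrightarrow> {u, x} \<in> black T \<and> {v, x} \<in> black T"
    and "{z, x} \<in> red (contract u v z T) \<longleftrightarrow> adj T u x \<noteq> adj T v x \<or>
      adj T u x \<and> adj T v x \<and> \<not> ({u, x} \<in> black T \<and> {v, x} \<in> black T)"
proof -
  have "{z, x} \<notin> black T" "{z, x} \<notin> red T" "x \<noteq> z"
    using assms unfolding is_trigraph_def by blast+
  then show "{z, x} \<in> black (contract u v z T) \<longleftrightarrow> {u, x} \<in> black T \<and> {v, x} \<in> black T"
    and "{z, x} \<in> red (contract u v z T) \<longleftrightarrow> adj T u x \<noteq> adj T v x \<or>
      adj T u x \<and> adj T v x \<and> \<not> ({u, x} \<in> black T \<and> {v, x} \<in> black T)"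
    using assms(3) unfolding contract_def by (auto simp: doubleton_eq_iff)
qed

lemma card_verts_contract:
  assumes "finite (verts T)" and "contracts_to T u v z T'"
  shows "Suc (card (verts T')) = card (verts T)"
proof -
  have *: "u \<in> verts T" "v \<in> verts T" "u \<noteq> v" "z \<notin> verts T" "verts T' = insert z (verts T - {u, v})"
    using assms(2) by (auto simp: contracts_to_def contract_def)
  have "2 \<le> card (verts T)"
    using card_mono[OF assms(1), of "{u, v}"] * by auto
  then show ?thesis
    using assms(1) * by (simp add: card_Diff_subset)
qed

text \<open>Black means completely joined and nonadjacent means without any edge, while a red edge
  promises nothing. These implications already force a red edge between inhomogeneous parts.\<close>

definition labels_trigraph :: "(nat \<Rightarrow> nat \<Rightarrow> bool) \<Rightarrow> nat set \<Rightarrow> trigraph \<Rightarrow> (nat \<Rightarrow> nat) \<Rightarrow> bool" where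
  "labels_trigraph E V T g \<longleftrightarrow> is_trigraph T \<and> g ` V = verts T \<and>
     (\<forall>x\<in>V. \<forall>y\<in>V. g x \<noteq> g y \<longrightarrow> ({g x, g y} \<in> black T \<longrightarrow> E x y) \<and> (E x y \<longrightarrow> adj T (g x) (g y)))"

text \<open>A contraction creates a black edge from two black edges only, and it keeps every
  adjacency.\<close>

lemma labels_trigraph_contract:
  assumes lab: "labels_trigraph E V T g" and con: "contracts_to T u v z T'"
  shows "labels_trigraph E V T' (\<lambda>x. if g x \<in> {u, v} then z else g x)" (is "labels_trigraph E V T' ?h")
proof -
  have T: "is_trigraph T" and gV: "g ` V = verts T"
    and bl: "\<And>x y. x \<in> V \<Longrightarrow> y \<in> V \<Longrightarrow> g x \<noteq> g y \<Longrightarrow> {g x, g y} \<in> black T \<Longrightarrow> E x y"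
    and ad: "\<And>x y. x \<in> V \<Longrightarrow> y \<in> V \<Longrightarrow> g x \<noteq> g y \<Longrightarrow> E x y \<Longrightarrow> adj T (g x) (g y)"
    using lab unfolding labels_trigraph_def by blast+
  have uv: "u \<in> verts T" "v \<in> verts T" "u \<noteq> v" and z: "z \<notin> verts T" and T': "T' = contract u v z T"
    using con by (auto simp: contracts_to_def)
  have sym: "adj X x y = adj X y x" for X x y by (simp add: adj_def insert_commute)
  have new: "({z, g y} \<in> black T' \<longrightarrow> {g x, g y} \<in> black T) \<and> (adj T (g x) (g y) \<longrightarrow> adj T' z (g y))"
    if "y \<in> V" "g x \<in> {u, v}" "g y \<notin> {u, v}" for x y
  proof -
    have y: "g y \<in> verts T - {u, v}" using that gV by blast
    show ?thesis
      using that(2) new_pair_in_contract[OF T z y] unfolding adj_def T' by auto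
  qed
  have old: "({g x, g y} \<in> black T' \<longrightarrow> {g x, g y} \<in> black T) \<and> (adj T (g x) (g y) \<longrightarrow> adj T' (g x) (g y))"
    if "x \<in> V" "y \<in> V" "g x \<notin> {u, v}" "g y \<notin> {u, v}" for x y
  proof -
    have xy: "g x \<in> verts T - {u, v}" "g y \<in> verts T - {u, v}" using that gV by blast+
    show ?thesis
      unfolding adj_def T' pair_in_contract[OF T z xy] by simp
  qed
  have "({?h x, ?h y} \<in> black T' \<longrightarrow> E x y) \<and> (E x y \<longrightarrow> adj T' (?h x) (?h y))"
    if xy: "x \<in> V" "y \<in> V" and ne: "?h x \<noteq> ?h y" for x y
  proof -
    have gxy: "g x \<noteq> g y" using ne by metis
    consider "g x \<in> {u, v}" "g y \<notin> {u, v}" | "g x \<notin> {u, v}" "g y \<in> {u, v}" | "g x \<notin> {u, v}" "g y \<notin> {u, v}"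
      using ne by fastforce
    then show ?thesis
    proof cases
      case 1
      then have "?h x = z" "?h y = g y" by simp_all
      then show ?thesis
        using new[OF xy(2) 1] bl[OF xy gxy] ad[OF xy gxy] by (simp only:) blast
    next
      case 2
      then have h: "?h x = g x" "?h y = z" by simp_all
      show ?thesis unfolding h
        using new[OF xy(1) 2(2,1)] bl[OF xy gxy] ad[OF xy gxy]
        unfolding sym[of T' z] sym[of T "g y"] insert_commute[of z] insert_commute[of "g y"] by blast
    next
      case 3
      then have h: "?h x = g x" "?h y = g y" by simp_all
      show ?thesis unfolding h using old[OF xy 3] bl[OF xy gxy] ad[OF xy gxy] by blast
    qed
  qed
  moreover have "?h ` V = verts T'"
  proof
    show "?h ` V \<subseteq> verts T'" using gV by (auto simp: T' contract_def)
    show "verts T' \<subseteq> ?h ` V"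
    proof
      fix t assume "t \<in> verts T'"
      then consider "t = z" | "t \<in> verts T - {u, v}" by (auto simp: T' contract_def)
      then show "t \<in> ?h ` V"
      proof cases
        case 1
        obtain x where "x \<in> V" "u = g x" using uv(1) unfolding gV[symmetric] by (rule imageE)
        then show ?thesis using 1 by (intro image_eqI[of _ _ x]) simp_all
      next
        case 2
        then have "t \<in> g ` V" using gV by simp
        then obtain x where "t = g x" "x \<in> V" by (rule imageE)
        then show ?thesis using 2 by (intro image_eqI[of _ _ x]) auto
      qed
    qed
  qed
  ultimately show ?thesis
    unfolding labels_trigraph_def using contracts_to_is_trigraph[OF T con] by blast
qed

context adjacency
begin

text \<open>Between inhomogeneous parts there are an edge, so they are adjacent in \<open>T\<close>,
  and a nonedge, so they are not joined by a black edge.\<close>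

lemma reds_labels_trigraph:
  assumes "labels_trigraph E V T g" and "reds V 0 0 g x y"
  shows "{g x, g y} \<in> red T"
proof -
  obtain x' y' where *: "x \<in> V" "y \<in> V" "g x \<noteq> g y" "x' \<in> V" "y' \<in> V" "g x' = g x" "g y' = g y"
    "E x' y' \<noteq> E x y \<or> {x', y'} = {0, 0}"
    using assms(2) unfolding reds_def by blast
  have "x' \<noteq> y'" using *(3,6,7) by auto
  then have "E x' y' \<noteq> E x y" using *(8) by (auto simp: doubleton_eq_iff)
  moreover have "({g x, g y} \<in> black T \<longrightarrow> E x y) \<and> (E x y \<longrightarrow> adj T (g x) (g y))"
    using assms(1) *(1-3) unfolding labels_trigraph_def by blast
  moreover have "({g x', g y'} \<in> black T \<longrightarrow> E x' y') \<and> (E x' y' \<longrightarrow> adj T (g x') (g y'))"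
    using assms(1) *(3-7) unfolding labels_trigraph_def by metis
  ultimately show ?thesis unfolding *(6,7) adj_def by blast
qed

lemma degree_le1_labels_trigraph:
  assumes lab: "labels_trigraph E V T g" and deg: "\<forall>v\<in>verts T. red_degree T v \<le> 1"
  shows "degree_le1 V 0 0 g"
  unfolding degree_le1_def
proof (intro allI impI)
  fix x y z assume xy: "reds V 0 0 g x y" and xz: "reds V 0 0 g x z"
  have V: "g ` V = verts T" and fin: "finite (verts T)"
    using lab by (auto simp: labels_trigraph_def is_trigraph_def)
  have "x \<in> V" "y \<in> V" "z \<in> V" using xy xz by (auto simp: reds_def)
  then have in_verts: "g x \<in> verts T" "g y \<in> verts T" "g z \<in> verts T" using V by blast+
  then have "card {w \<in> verts T. {g x, w} \<in> red T} \<le> Suc 0"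
    using deg by (simp add: red_degree_def)
  moreover have "g y \<in> {w \<in> verts T. {g x, w} \<in> red T}" "g z \<in> {w \<in> verts T. {g x, w} \<in> red T}"
    using reds_labels_trigraph[OF lab xy] reds_labels_trigraph[OF lab xz] in_verts by simp_all
  ultimately show "g y = g z"
    using card_le_Suc0_iff_eq[of "{w \<in> verts T. {g x, w} \<in> red T}"] fin by simp
qed

lemma contractions_imp_chain:
  assumes "Ts \<noteq> []" and "labels_trigraph E V (hd Ts) g" and "card (verts (hd Ts)) = length Ts"
    and "\<forall>i. Suc i < length Ts \<longrightarrow> (\<exists>u v z. contracts_to (Ts ! i) u v z (Ts ! Suc i))"
    and "\<forall>T\<in>set Ts. \<forall>v\<in>verts T. red_degree T v \<le> 1"
  shows "chain (degree_le1 V 0 0) V g"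
  using assms
proof (induction Ts arbitrary: g)
  case (Cons T Ts)
  have lab: "labels_trigraph E V T g" using Cons.prems(2) by simp
  have deg: "degree_le1 V 0 0 g"
    by (rule degree_le1_labels_trigraph[OF lab]) (use Cons.prems(5) in simp)
  have V: "g ` V = verts T" and fin: "finite (verts T)"
    using lab by (auto simp: labels_trigraph_def is_trigraph_def)
  show ?case
  proof (cases Ts)
    case Nil
    then have "card (verts T) = 1" using Cons.prems(3) by simp
    then obtain c where "verts T = {c}" using card_1_singletonE by blast
    then have "constant_on V g" using V by (intro constant_onI[of _ _ c]) auto
    then show ?thesis
      by (rule chain.stop[where B = "degree_le1 V 0 0" and g = g, OF deg])
  next
    case (Cons T' Ts')
    have "\<exists>u v z. contracts_to T u v z T'"
      using Cons.prems(4)[rule_format, of 0] Cons by simp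
    then obtain u v z where con: "contracts_to T u v z T'" by blast
    let ?h = "\<lambda>x. if g x \<in> {u, v} then z else g x"
    have lab': "labels_trigraph E V T' ?h" by (rule labels_trigraph_contract[OF lab con])
    have "chain (degree_le1 V 0 0) V ?h"
    proof (rule Cons.IH)
      show "Ts \<noteq> []" using Cons by simp
      show "labels_trigraph E V (hd Ts) ?h" using lab' Cons by simp
      show "card (verts (hd Ts)) = length Ts"
        using card_verts_contract[OF fin con] Cons.prems(3) Cons by simp
      show "\<forall>i. Suc i < length Ts \<longrightarrow> (\<exists>u v z. contracts_to (Ts ! i) u v z (Ts ! Suc i))"
        using Cons.prems(4) by (metis Suc_less_eq length_Cons nth_Cons_Suc)
      show "\<forall>T\<in>set Ts. \<forall>v\<in>verts T. red_degree T v \<le> 1" using Cons.prems(5) by simp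
    qed
    \<comment> \<open>A contraction gives the part a new name \<open>z\<close>, whereas
      \<open>merge\<close> reuses \<open>u\<close>; since \<open>z\<close> did not occur before, the
      kernel is the same.\<close>
    moreover have "same_kernel V ?h (merge u v g)"
    proof -
      have "g x \<noteq> z" if "x \<in> V" for x using con that V by (auto simp: contracts_to_def)
      then show ?thesis unfolding same_kernel_def merge_def by auto
    qed
    ultimately have "chain (degree_le1 V 0 0) V (merge u v g)"
      by (rule chain_kernel) (rule degree_le1_kernel)
    then show ?thesis
      by (rule chain.step[where B = "degree_le1 V 0 0" and g = g, OF deg])
  qed
qed simp

end

text \<open>The twin-width is a \<open>LEAST\<close>, which has meaning only if some bound is
  attained. Arbitrary contractions down to one vertex give a sequence, and its red degrees are
  finitely many numbers.\<close>

lemma d_sequence_exists: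
  assumes "is_trigraph T" and "verts T \<noteq> {}"
  shows "\<exists>d Ts. d_sequence d T Ts"
proof -
  have "\<exists>Ts. Ts \<noteq> [] \<and> length Ts = card (verts T) \<and> hd Ts = T \<and>
     (\<forall>i. Suc i < length Ts \<longrightarrow> (\<exists>u v z. contracts_to (Ts ! i) u v z (Ts ! Suc i))) \<and>
     (\<forall>T'\<in>set Ts. finite (verts T'))"
    using assms
  proof (induction "card (verts T)" arbitrary: T rule: less_induct)
    case less
    have fin: "finite (verts T)" using less.prems by (simp add: is_trigraph_def)
    show ?case
    proof (cases "card (verts T) = 1")
      case True
      then show ?thesis using fin by (intro exI[of _ "[T]"]) simp
    next
      case False
      then have "\<not> card (verts T) \<le> Suc 0"
        using less.prems(2) fin by (metis One_nat_def card_0_eq le_SucE le_zero_eq)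
      then obtain u v where uv: "u \<in> verts T" "v \<in> verts T" "u \<noteq> v"
        using card_le_Suc0_iff_eq[OF fin] by blast
      obtain z where z: "z \<notin> verts T" using ex_new_if_finite[OF infinite_UNIV_nat fin] by blast
      define T' where "T' = contract u v z T"
      have con: "contracts_to T u v z T'" using uv z by (simp add: contracts_to_def T'_def)
      have "\<exists>Ts. Ts \<noteq> [] \<and> length Ts = card (verts T') \<and> hd Ts = T' \<and>
        (\<forall>i. Suc i < length Ts \<longrightarrow> (\<exists>u v z. contracts_to (Ts ! i) u v z (Ts ! Suc i))) \<and>
        (\<forall>T''\<in>set Ts. finite (verts T''))"
      proof (rule less.hyps)
        show "card (verts T') < card (verts T)" using card_verts_contract[OF fin con] by simp
        show "is_trigraph T'" by (rule contracts_to_is_trigraph[OF less.prems(1) con])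
        show "verts T' \<noteq> {}" by (simp add: T'_def contract_def)
      qed
      then obtain Ts where Ts: "Ts \<noteq> []" "length Ts = card (verts T')" "hd Ts = T'"
        "\<forall>i. Suc i < length Ts \<longrightarrow> (\<exists>u v z. contracts_to (Ts ! i) u v z (Ts ! Suc i))"
        "\<forall>T''\<in>set Ts. finite (verts T'')" by blast
      have "\<exists>u v z. contracts_to ((T # Ts) ! i) u v z ((T # Ts) ! Suc i)" if "Suc i < length (T # Ts)" for i
      proof (cases i)
        case 0
        then show ?thesis using con Ts(1,3) by (auto simp: hd_conv_nth)
      next
        case (Suc j)
        then show ?thesis using Ts(4) that by simp
      qed
      then show ?thesis
        using Ts card_verts_contract[OF fin con] fin by (intro exI[of _ "T # Ts"]) simp
    qed
  qed
  then obtain Ts where Ts: "Ts \<noteq> []" "length Ts = card (verts T)" "hd Ts = T"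
    "\<forall>i. Suc i < length Ts \<longrightarrow> (\<exists>u v z. contracts_to (Ts ! i) u v z (Ts ! Suc i))"
    "\<forall>T'\<in>set Ts. finite (verts T')" by blast
  have "red_degree T' v \<le> (\<Sum>T\<in>set Ts. card (verts T))" if "T' \<in> set Ts" for T' v
  proof -
    have "red_degree T' v \<le> card (verts T')"
      unfolding red_degree_def using Ts(5) that by (intro card_mono) auto
    also have "\<dots> \<le> (\<Sum>T\<in>set Ts. card (verts T))"
      using that by (intro member_le_sum) auto
    finally show ?thesis .
  qed
  then show ?thesis unfolding d_sequence_def using Ts by blast
qed

lemma twin_width_le1_iff:
  assumes "is_trigraph G" and "verts G \<noteq> {}"
  shows "twin_width G \<le> 1 \<longleftrightarrow> (\<exists>Ts. d_sequence 1 G Ts)"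
proof
  assume "\<exists>Ts. d_sequence 1 G Ts"
  then show "twin_width G \<le> 1" unfolding twin_width_def by (rule Least_le)
next
  assume le: "twin_width G \<le> 1"
  have "\<exists>Ts. d_sequence (twin_width G) G Ts"
    unfolding twin_width_def using d_sequence_exists[OF assms] by (rule LeastI_ex)
  then show "\<exists>Ts. d_sequence 1 G Ts"
  proof
    fix Ts assume "d_sequence (twin_width G) G Ts"
    then have "d_sequence 1 G Ts"
      using le unfolding d_sequence_def by (meson order_trans)
    then show ?thesis by blast
  qed
qed

lemma twin_width_le1_imp_chain:
  assumes "is_graph G" and "verts G \<noteq> {}" and "twin_width G \<le> 1"
  shows "chain (adjacency.edges_le1 (\<lambda>x y. {x, y} \<in> black G) (verts G) 0 0) (verts G) id"
proof -
  interpret adjacency "\<lambda>x y. {x, y} \<in> black G"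
    by unfold_locales (simp add: insert_commute)
  have G: "is_trigraph G" using assms(1) by (simp add: is_graph_def)
  obtain Ts where Ts: "d_sequence 1 G Ts"
    using assms(3) twin_width_le1_iff[OF G assms(2)] by blast
  have "chain (degree_le1 (verts G) 0 0) (verts G) id"
  proof (rule contractions_imp_chain)
    show "labels_trigraph (\<lambda>x y. {x, y} \<in> black G) (verts G) (hd Ts) id"
      using Ts G by (auto simp: labels_trigraph_def d_sequence_def adj_def)
  qed (use Ts in \<open>auto simp: d_sequence_def\<close>)
  then show ?thesis
    using G by (intro degree_chain_imp_edges_chain) (auto simp: is_trigraph_def)
qed

section \<open>States with at most one red edge\<close>

lemma trigraph_eqI:
  fixes T T' :: trigraph
  assumes "is_trigraph T" and "is_trigraph T'" and "verts T = verts T'"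
    and "\<And>x y. x \<in> verts T \<Longrightarrow> y \<in> verts T \<Longrightarrow> x \<noteq> y \<Longrightarrow> {x, y} \<in> black T \<longleftrightarrow> {x, y} \<in> black T'"
    and "\<And>x y. x \<in> verts T \<Longrightarrow> y \<in> verts T \<Longrightarrow> x \<noteq> y \<Longrightarrow> {x, y} \<in> red T \<longleftrightarrow> {x, y} \<in> red T'"
  shows "T = T'"
proof (rule trigraph.equality)
  have pair: "\<exists>x y. e = {x, y} \<and> x \<in> verts T \<and> y \<in> verts T \<and> x \<noteq> y"
    if "e \<in> black T \<union> red T \<union> black T' \<union> red T'" for e
  proof -
    have "e \<subseteq> verts T \<and> card e = 2" using that assms(1-3) unfolding is_trigraph_def by blast
    then show ?thesis by (auto simp: card_2_iff)
  qed
  show "black T = black T'"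
  proof (rule set_eqI)
    fix e show "e \<in> black T \<longleftrightarrow> e \<in> black T'" using pair[of e] assms(4) by blast
  qed
  show "red T = red T'"
  proof (rule set_eqI)
    fix e show "e \<in> red T \<longleftrightarrow> e \<in> red T'" using pair[of e] assms(5) by blast
  qed
qed (use assms(3) in simp_all)

lemma red_degree_le_card_red:
  assumes "finite (red T)"
  shows "red_degree T v \<le> card (red T)"
  unfolding red_degree_def
proof (rule card_inj_on_le)
  show "inj_on (\<lambda>x. {v, x}) {x \<in> verts T. {v, x} \<in> red T}"
    by (auto simp: inj_on_def doubleton_eq_iff)
qed (use assms in auto)

text \<open>A move keeps the survivor \<open>ps i\<close> as representative, whereas the output must
  call it \<open>n + i\<close>. This function translates representatives into current names; the
  name of a removed representative becomes stale, but no later move mentions it.\<close>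

primrec names :: "nat \<Rightarrow> (nat \<Rightarrow> nat) \<Rightarrow> nat \<Rightarrow> nat \<Rightarrow> nat" where
  "names n ps 0 = id"
| "names n ps (Suc i) = (names n ps i)(ps i := n + i)"

lemma names_cong: "(\<And>j. j < i \<Longrightarrow> ps j = qs j) \<Longrightarrow> names n ps i = names n qs i"
  by (induction i) auto

lemma names_less: "x < n \<Longrightarrow> names n ps i x < n + i"
  by (induction i) (auto simp: less_Suc_eq)

lemma inj_names: "inj_on (names n ps i) {..<n}"
proof (induction i)
  case (Suc i)
  have "n + i \<notin> names n ps i ` {..<n}"
  proof
    assume "n + i \<in> names n ps i ` {..<n}"
    then obtain x where "x < n" "n + i = names n ps i x" by auto
    then show False using names_less[of x n ps i] by simp
  qed
  then show ?case unfolding names.simps by (rule inj_on_fun_updI[OF Suc])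
qed simp

context adjacency
begin

text \<open>A trigraph with at most one red edge that arises by contractions from the graph \<open>E\<close> is,
  up to the names of its vertices, an induced subgraph on representatives \<open>S\<close>, one edge of
  which may have been recoloured. Hence a state is a set \<open>S\<close> with a red pair \<open>{a, b}\<close>, where
  \<open>a = b\<close> means that there is none.\<close>

definition differs :: "nat set \<Rightarrow> nat \<Rightarrow> nat \<Rightarrow> nat \<Rightarrow> nat \<Rightarrow> nat \<Rightarrow> bool" where
  "differs S a b p q x \<longleftrightarrow> x \<in> S \<and> x \<noteq> p \<and> x \<noteq> q \<and>
     (E p x \<noteq> E q x \<or> {p, x} = {a, b} \<or> {q, x} = {a, b})"

definition kept :: "nat \<Rightarrow> nat \<Rightarrow> nat \<Rightarrow> nat \<Rightarrow> bool" where
  "kept a b p q \<longleftrightarrow> a \<noteq> b \<and> p \<notin> {a, b} \<and> q \<notin> {a, b}"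

text \<open>The survivor is \<open>p\<close>, so a newly created red edge is recorded as starting at
  \<open>p\<close>. The absence of a red edge may be recorded by any pair of equal numbers, and the
  result is unique up to that choice.\<close>

definition move :: "nat set \<Rightarrow> nat \<Rightarrow> nat \<Rightarrow> nat \<Rightarrow> nat \<Rightarrow> nat \<Rightarrow> nat \<Rightarrow> bool" where
  "move S a b p q a' b' \<longleftrightarrow> p \<in> S \<and> q \<in> S \<and> p \<noteq> q \<and>
     ((\<forall>x. \<not> differs S a b p q x) \<and> (if kept a b p q then a' = a \<and> b' = b else a' = b') \<or>
      \<not> kept a b p q \<and> a' = p \<and> (\<forall>x. differs S a b p q x \<longleftrightarrow> x = b'))"

definition valid_pair :: "nat set \<Rightarrow> nat \<Rightarrow> nat \<Rightarrow> bool" where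
  "valid_pair S a b \<longleftrightarrow> a = b \<or> a \<in> S \<and> b \<in> S"

definition good :: "nat set \<Rightarrow> nat \<Rightarrow> nat \<Rightarrow> bool" where
  "good S a b \<longleftrightarrow> (\<exists>g. inj_on g S \<and> chain (edges_le1 S a b) S g)"

text \<open>Goodness is inherited by induced subtrigraphs, with or without the red edge. Both the
  greedy steps and the commitment to intermediate graphs rest on this.\<close>

lemma good_subset:
  assumes "good S a b" and "S' \<subseteq> S" and "c = d \<or> {c, d} = {a, b}"
  shows "good S' c d"
proof -
  obtain g where g: "inj_on g S" "chain (edges_le1 S a b) S g"
    using assms(1) unfolding good_def by blast
  have "edges_le1 S b a = edges_le1 S a b"
    unfolding fun_eq_iff edges_le1_def reds_def insert_commute[of a b "{}"] by simp
  then have "chain (edges_le1 S b a) S g" using g(2) by simp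
  then have "chain (edges_le1 S' c d) S' g"
    using chain_subset_edges[OF g(2) assms(2)] chain_subset_edges[OF _ assms(2), of b a g c d] assms(3)
    by (auto simp: doubleton_eq_iff)
  then show ?thesis unfolding good_def using inj_on_subset[OF g(1) assms(2)] by blast
qed

lemma move_cases:
  assumes "move S a b p q a' b'"
  obtains "\<not> kept a b p q" "a' = b'" "\<forall>x. \<not> differs S a b p q x" | "kept a b p q" "a' = a" "b' = b" "\<forall>x. \<not> differs S a b p q x"
    | "\<not> kept a b p q" "a' = p" "\<forall>x. differs S a b p q x \<longleftrightarrow> x = b'"
  using assms unfolding move_def by (meson)

lemma move_valid_pair:
  assumes "move S a b p q a' b'" and "valid_pair S a b"
  shows "valid_pair (S - {q}) a' b'"
  using assms(1)
proof (cases rule: move_cases)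
  case 1
  then show ?thesis by (simp add: valid_pair_def)
next
  case 2
  then show ?thesis using assms(2) by (auto simp: valid_pair_def kept_def)
next
  case 3
  then have "differs S a b p q b'" by blast
  then show ?thesis using 3(2) assms(1) by (simp add: valid_pair_def differs_def move_def)
qed

lemma move_unique:
  assumes "move S a b p q a' b'" and "move S a b p q c d"
  shows "(c = a' \<and> d = b') \<or> (c = d \<and> a' = b')"
  using assms unfolding move_def by (auto split: if_splits)

lemma good_move_unique:
  assumes "move S a b p q a' b'" and "move S a b p q c d" and "good S' a' b'"
  shows "good S' c d"
  using move_unique[OF assms(1,2)] assms(3) good_subset[OF assms(3), of S' c d] by auto

text \<open>With \<open>p\<close> and \<open>q\<close> in one part, the pairs \<open>px\<close> and
  \<open>qx\<close> run between the same two parts and either disagree or include the red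
  edge.\<close>

lemma differs_imp_reds:
  assumes "differs S a b p q x" and "p \<in> S" "q \<in> S" and h: "h p = h q" "h x \<noteq> h p"
  shows "reds S a b h p x"
proof -
  have *: "x \<in> S" "E q x \<noteq> E p x \<or> {p, x} = {a, b} \<or> {q, x} = {a, b}"
    using assms(1) unfolding differs_def by auto
  then show ?thesis
    unfolding reds_def using assms(2,3) h by (metis (no_types, lifting))
qed

text \<open>A new red edge \<open>p b'\<close> records a difference between \<open>p\<close> and
  \<open>q\<close>. As long as these share a part, the same pair of parts is red in the old trigraph
  because of \<open>q\<close>, so dropping \<open>q\<close> introduces no red pair.\<close>

lemma reds_after_move:
  assumes mv: "move S a b p q a' b'" and h: "h p = h q"
    and red: "reds (S - {q}) a' b' h x y"
  shows "reds S a b h x y"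
proof -
  have pq: "p \<in> S" "q \<in> S" "p \<noteq> q" using mv by (auto simp: move_def)
  consider "a' = b' \<or> a' = a \<and> b' = b" | "a' = p" "differs S a b p q b'"
    using mv unfolding move_def by (auto split: if_splits)
  then show ?thesis
  proof cases
    case 1
    then show ?thesis by (intro reds_subset[OF red]) auto
  next
    case 2
    obtain x' y' where *: "x \<in> S" "y \<in> S" "h x \<noteq> h y" "x' \<in> S" "y' \<in> S" "h x' = h x" "h y' = h y"
      "E x' y' \<noteq> E x y \<or> {x', y'} = {p, b'}"
      using red unfolding reds_def 2(1) by blast
    show ?thesis
    proof (cases "E x' y' = E x y")
      case False
      then show ?thesis unfolding reds_def using *(1-7) by blast
    next
      case True
      then have "x' = p \<and> y' = b' \<or> x' = b' \<and> y' = p" using *(8) by (auto simp: doubleton_eq_iff)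
      then have "reds S a b h x' y'"
      proof
        assume eq: "x' = p \<and> y' = b'"
        then have "h b' \<noteq> h p" using *(3,6,7) by simp
        then show ?thesis using differs_imp_reds[OF 2(2) pq(1,2) h] eq by simp
      next
        assume eq: "x' = b' \<and> y' = p"
        then have "h b' \<noteq> h p" using *(3,6,7) by simp
        then show ?thesis using reds_sym[OF differs_imp_reds[OF 2(2) pq(1,2) h]] eq by simp
      qed
      then show ?thesis using reds_cong *(1,2,6,7) by metis
    qed
  qed
qed

lemma chain_after_move:
  assumes mv: "move S a b p q a' b'" and g: "g p = g q"
    and ch: "chain (edges_le1 S a b) S g"
  shows "chain (edges_le1 (S - {q}) a' b') (S - {q}) g"
proof (rule chain_simulate[where I = "\<lambda>h. h p = h q" and B' = "edges_le1 (S - {q}) a' b'", OF ch])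
  show "same_kernel S g g" by (simp add: same_kernel_def)
  show "g p = g q" by (rule g)
  show "edges_le1 (S - {q}) a' b' h"
    if *: "edges_le1 S a b k" "same_kernel S k h" "h p = h q" for k h
  proof -
    have e: "edges_le1 S a b h" by (rule edges_le1_kernel[OF *(2,1)])
    show ?thesis unfolding edges_le1_def
      by (intro allI impI; rule edges_le1D[OF e]; rule reds_after_move[OF mv *(3)])
  qed
  show "merge (h x) (h y) h p = merge (h x) (h y) h q" if "h p = h q" for h x y
    using that by (simp add: merge_def)
  show "chain (edges_le1 (S - {q}) a' b') (S - {q}) h"
    if "edges_le1 (S - {q}) a' b' h" "constant_on S h" for h
  proof (rule chain.stop[where B = "edges_le1 (S - {q}) a' b'" and g = h, OF that(1)])
    show "constant_on (S - {q}) h" using that(2) unfolding constant_on_def by blast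
  qed
qed

text \<open>Here only \<open>p\<close> and \<open>q\<close> have been joined. Each differing vertex
  yields a red edge at their part, and a kept red edge would be disjoint from it, so the bound of
  one red edge is exactly what \<open>move\<close> demands.\<close>

lemma identified_pair_move:
  assumes pq: "p \<in> S" "q \<in> S" "p \<noteq> q" and h: "h p = h q" and inj: "inj_on h (S - {q})"
    and e: "edges_le1 S a b h" and valid: "valid_pair S a b"
  shows "\<exists>a' b'. move S a b p q a' b'"
proof -
  have ne: "h x \<noteq> h p" if "x \<in> S" "x \<noteq> p" "x \<noteq> q" for x
    using inj_onD[OF inj, of x p] that pq by blast
  have dr: "reds S a b h p x" if "differs S a b p q x" for x
    using differs_imp_reds[OF that pq(1,2) h] ne[of x] that unfolding differs_def by blast
  have un: "x = y" if x: "differs S a b p q x" and y: "differs S a b p q y" for x y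
  proof -
    have xy: "x \<in> S - {q}" "y \<in> S - {q}" "x \<noteq> p" "y \<noteq> p" using x y by (auto simp: differs_def)
    have "h x = h y"
      using edges_le1D[OF e dr[OF x] dr[OF y]] ne[of y] ne[of x] xy by auto
    then show ?thesis using inj_onD[OF inj] xy by blast
  qed
  have nk: "\<not> kept a b p q" if x: "differs S a b p q x" for x
  proof
    assume k: "kept a b p q"
    then have ab: "a \<in> S" "b \<in> S" "a \<noteq> b" "a \<noteq> p" "a \<noteq> q" "b \<noteq> p" "b \<noteq> q"
      using valid by (auto simp: kept_def valid_pair_def)
    have "h a \<noteq> h b" using inj_onD[OF inj, of a b] ab by blast
    then have "reds S a b h a b" using ab unfolding reds_def by blast
    from edges_le1D[OF e dr[OF x] this] show False using ne[of a] ne[of b] ab by auto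
  qed
  show ?thesis
  proof (cases "\<exists>x. differs S a b p q x")
    case True
    then obtain x where x: "differs S a b p q x" by blast
    then have "move S a b p q p x" using pq nk[OF x] un unfolding move_def by blast
    then show ?thesis by blast
  next
    case False
    then have "move S a b p q a b \<or> move S a b p q a a"
      using pq unfolding move_def by simp
    then show ?thesis by blast
  qed
qed

text \<open>The pair comes from the first proper merge of a chain. Both orders are provided because
  the survivor matters: greedy steps may remove only a vertex outside the red edge.\<close>

lemma good_has_move:
  assumes good: "good S a b" and valid: "valid_pair S a b" and xy: "x \<in> S" "y \<in> S" "x \<noteq> y"
  obtains p q where "p \<noteq> q" "\<exists>a' b'. move S a b p q a' b'" "\<exists>a' b'. move S a b q p a' b'"
    "\<And>a' b'. move S a b p q a' b' \<Longrightarrow> good (S - {q}) a' b'"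
    "\<And>a' b'. move S a b q p a' b' \<Longrightarrow> good (S - {p}) a' b'"
proof -
  obtain g where g: "inj_on g S" "chain (edges_le1 S a b) S g"
    using good unfolding good_def by blast
  have "g x \<noteq> g y" using inj_onD[OF g(1)] xy by blast
  then have "\<not> constant_on S g" using xy unfolding constant_on_def by blast
  then obtain p q where pq: "p \<in> S" "q \<in> S" "g p \<noteq> g q"
    and ch: "chain (edges_le1 S a b) S (merge (g p) (g q) g)"
    by (rule chain_edges_cases[OF g(2)])
  let ?h = "merge (g p) (g q) g"
  have h: "?h p = ?h q" by (simp add: merge_def)
  have e: "edges_le1 S a b ?h" by (rule chain_bound[OF ch])
  have val: "?h z = (if z = q then g p else g z)" if "z \<in> S" for z
    using that pq inj_on_eq_iff[OF g(1)] by (simp add: merge_def)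
  have inj: "inj_on ?h (S - {q})" "inj_on ?h (S - {p})"
    using val inj_on_eq_iff[OF g(1)] pq by (auto simp: inj_on_def)
  show ?thesis
  proof (rule that)
    show ne: "p \<noteq> q" using pq by blast
    show "\<exists>a' b'. move S a b p q a' b'"
      by (rule identified_pair_move[OF pq(1,2) ne h inj(1) e valid])
    show "\<exists>a' b'. move S a b q p a' b'"
      by (rule identified_pair_move[OF pq(2,1) ne[symmetric] h[symmetric] inj(2) e valid])
    show "good (S - {q}) a' b'" if "move S a b p q a' b'" for a' b'
      unfolding good_def using chain_after_move[OF that h ch] inj(1) by blast
    show "good (S - {p}) a' b'" if "move S a b q p a' b'" for a' b'
      unfolding good_def using chain_after_move[OF that h[symmetric] ch] inj(2) by blast
  qed
qed

text \<open>When the removed vertex is not on the red edge, the only red edge that can remain is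
  \<open>ab\<close> itself, so the result is an induced subtrigraph.\<close>

lemma good_safe_move:
  assumes good: "good S a b" and ab: "a \<noteq> b" and valid: "valid_pair S a b"
    and mv: "move S a b p q a' b'" and q: "q \<notin> {a, b}"
  shows "good (S - {q}) a' b'"
proof -
  consider "a' = b' \<or> a' = a \<and> b' = b" | "\<not> kept a b p q" "a' = p" "\<forall>x. differs S a b p q x \<longleftrightarrow> x = b'"
    using mv unfolding move_def by (auto split: if_splits)
  then have "a' = b' \<or> {a', b'} = {a, b}"
  proof cases
    case 2
    then have "p = a \<or> p = b" using ab q by (simp add: kept_def)
    define c where "c = (if p = a then b else a)"
    have c: "{p, c} = {a, b}" "c \<in> S" "c \<noteq> p" "c \<noteq> q"
      using \<open>p = a \<or> p = b\<close> ab q valid by (auto simp: c_def valid_pair_def)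
    \<comment> \<open>The red edge \<open>pc\<close> stays red in the contraction, so it is the
      single red edge that is allowed.\<close>
    then have "differs S a b p q c" by (simp add: differs_def)
    then have "b' = c" using 2(3)[rule_format, of c] by simp
    then show ?thesis using c 2(2) by simp
  qed auto
  then show ?thesis by (rule good_subset[OF good Diff_subset])
qed

text \<open>The first merge of a chain has both ends in \<open>{a, b}\<close>: an end outside could
  be taken as the removed vertex, which \<open>none\<close> excludes.\<close>

lemma good_forced_move:
  assumes good: "good S a b" and ab: "a \<noteq> b" and valid: "valid_pair S a b"
    and none: "\<And>p q a' b'. q \<notin> {a, b} \<Longrightarrow> \<not> move S a b p q a' b'"
  shows "\<exists>a' b'. move S a b a b a' b'"
    and "move S a b a b a' b' \<Longrightarrow> good (S - {b}) a' b'"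
proof -
  have S: "a \<in> S" "b \<in> S" using valid ab by (auto simp: valid_pair_def)
  obtain p q where pq: "p \<noteq> q" "\<exists>a' b'. move S a b p q a' b'" "\<exists>a' b'. move S a b q p a' b'"
    "\<And>a' b'. move S a b p q a' b' \<Longrightarrow> good (S - {q}) a' b'"
    "\<And>a' b'. move S a b q p a' b' \<Longrightarrow> good (S - {p}) a' b'"
    by (rule good_has_move[OF good valid S ab]) iprover
  have "p \<in> {a, b}" "q \<in> {a, b}" using none pq(2,3) by blast+
  then have cases: "p = a \<and> q = b \<or> p = b \<and> q = a" using pq(1) by blast
  then show "\<exists>a' b'. move S a b a b a' b'" using pq(2,3) by blast
  show "good (S - {b}) a' b'" if "move S a b a b a' b'"
    using cases pq(4)[of a' b'] pq(5)[of a' b'] that by blast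
qed

section \<open>Recorded moves and the states they lead to\<close>

inductive reach :: "nat \<Rightarrow> (nat \<times> nat) list \<Rightarrow> nat set \<Rightarrow> nat \<Rightarrow> nat \<Rightarrow> bool" for n where
  reach_start: "a = b \<Longrightarrow> reach n [] {..<n} a b"
| reach_move: "reach n ms S a b \<Longrightarrow> move S a b p q a' b' \<Longrightarrow> reach n (ms @ [(p, q)]) (S - {q}) a' b'"

text \<open>The pair that records the absence of a red edge is an arbitrary choice in the last move,
  so it can be replaced, in particular by the \<open>0, 0\<close> to which the program
  resets.\<close>

lemma reach_reset:
  assumes "reach n ms S a a"
  shows "reach n ms S c c"
  using assms
proof cases
  case reach_start
  then show ?thesis by (simp add: reach.reach_start)
next
  case (reach_move ms' S' a' b' p q)
  \<comment> \<open>The alternative with a new red edge would need \<open>p\<close> to differ from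
    itself, and a kept red edge would have distinct ends.\<close>
  have "\<forall>x. \<not> differs S' a' b' p q x"
    using reach_move(4) by (auto simp: move_def differs_def split: if_splits)
  moreover have "\<not> kept a' b' p q"
    using reach_move(4) by (auto simp: move_def kept_def differs_def split: if_splits)
  ultimately have "move S' a' b' p q c c"
    using reach_move(4) unfolding move_def by simp
  then show ?thesis using reach.reach_move[OF reach_move(3)] reach_move(1,2) by simp
qed

lemma reach_valid: "reach n ms S a b \<Longrightarrow> valid_pair S a b"
  by (induction rule: reach.induct) (auto simp: valid_pair_def[of "{..<n}"] move_valid_pair)

lemma reach_verts: "reach n ms S a b \<Longrightarrow> S = {..<n} - snd ` set ms"
  by (induction rule: reach.induct) auto

lemma reach_card: "reach n ms S a b \<Longrightarrow> finite S \<and> card S + length ms = n"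
proof (induction rule: reach.induct)
  case (reach_move ms S a b p q a' b')
  then have "q \<in> S" by (simp add: move_def)
  moreover have "card S > 0" using reach_move.IH \<open>q \<in> S\<close> card_gt_0_iff by blast
  ultimately show ?case using reach_move.IH by simp
qed simp

lemma reach_moves_less:
  "reach n ms S a b \<Longrightarrow> i < length ms \<Longrightarrow> fst (ms ! i) < n \<and> snd (ms ! i) < n"
proof (induction rule: reach.induct)
  case (reach_move ms S a b p q a' b')
  have "p < n" "q < n" using reach_verts[OF reach_move.hyps(1)] reach_move.hyps(2) by (auto simp: move_def)
  then show ?case using reach_move by (cases "i = length ms") (auto simp: nth_append)
qed simp

end

section \<open>From moves to contraction sequences\<close>

context adjacency
begin

definition state_trigraph :: "(nat \<Rightarrow> nat) \<Rightarrow> nat set \<Rightarrow> nat \<Rightarrow> nat \<Rightarrow> trigraph" where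
  "state_trigraph f S a b = \<lparr>verts = f ` S,
     black = {{f x, f y} | x y. x \<in> S \<and> y \<in> S \<and> x \<noteq> y \<and> E x y \<and> {x, y} \<noteq> {a, b}},
     red = (if a = b then {} else {{f a, f b}})\<rparr>"

lemma verts_state_trigraph [simp]: "verts (state_trigraph f S a b) = f ` S"
  by (simp add: state_trigraph_def)

lemma pair_in_state_trigraph:
  assumes "inj_on f S" and "x \<in> S" "y \<in> S" "x \<noteq> y"
  shows "{f x, f y} \<in> black (state_trigraph f S a b) \<longleftrightarrow> E x y \<and> {x, y} \<noteq> {a, b}"
    and "valid_pair S a b \<Longrightarrow> {f x, f y} \<in> red (state_trigraph f S a b) \<longleftrightarrow> {x, y} = {a, b}"
proof -
  have eq: "{f x, f y} = {f x', f y'} \<longleftrightarrow> {x, y} = {x', y'}" if "x' \<in> S" "y' \<in> S" for x' y'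
    using that assms by (auto simp: doubleton_eq_iff inj_on_eq_iff)
  show "{f x, f y} \<in> black (state_trigraph f S a b) \<longleftrightarrow> E x y \<and> {x, y} \<noteq> {a, b}"
  proof
    assume "{f x, f y} \<in> black (state_trigraph f S a b)"
    then obtain x' y' where *: "x' \<in> S" "y' \<in> S" "E x' y'" "{x', y'} \<noteq> {a, b}" "{f x, f y} = {f x', f y'}"
      unfolding state_trigraph_def by auto
    then have xy: "{x, y} = {x', y'}" using eq[OF *(1,2)] by simp
    then have "E x y" using *(3) E_sym[of x' y'] by (auto simp: doubleton_eq_iff)
    then show "E x y \<and> {x, y} \<noteq> {a, b}" using xy *(4) by simp
  next
    assume "E x y \<and> {x, y} \<noteq> {a, b}"
    then show "{f x, f y} \<in> black (state_trigraph f S a b)"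
      unfolding state_trigraph_def using assms by auto
  qed
  show "{f x, f y} \<in> red (state_trigraph f S a b) \<longleftrightarrow> {x, y} = {a, b}" if "valid_pair S a b"
  proof (cases "a = b")
    case True
    then show ?thesis using assms(4) by (auto simp: state_trigraph_def)
  next
    case False
    then show ?thesis using that eq[of a b] by (simp add: state_trigraph_def valid_pair_def)
  qed
qed

lemma is_trigraph_state_trigraph:
  assumes "inj_on f S" and "finite S" and "valid_pair S a b"
  shows "is_trigraph (state_trigraph f S a b)"
  unfolding is_trigraph_def
proof (intro conjI ballI)
  let ?T = "state_trigraph f S a b"
  show "finite (verts ?T)" using assms(2) by simp
  have pair: "\<exists>x\<in>S. \<exists>y\<in>S. x \<noteq> y \<and> e = {f x, f y}" if "e \<in> black ?T \<union> red ?T" for e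
    using that assms(3) unfolding state_trigraph_def valid_pair_def
    by (auto split: if_splits)
  show "e \<subseteq> verts ?T" if "e \<in> black ?T \<union> red ?T" for e
    using pair[OF that] by auto
  show "card e = 2" if e: "e \<in> black ?T \<union> red ?T" for e
  proof -
    obtain x y where "x \<in> S" "y \<in> S" "x \<noteq> y" "e = {f x, f y}" using pair[OF e] by blast
    then show ?thesis using inj_on_eq_iff[OF assms(1)] by simp
  qed
  show "black ?T \<inter> red ?T = {}"
  proof (rule equals0I)
    fix e assume e: "e \<in> black ?T \<inter> red ?T"
    then obtain x y where xy: "x \<in> S" "y \<in> S" "x \<noteq> y" "e = {f x, f y}" using pair[of e] by blast
    then show False
      using e pair_in_state_trigraph[OF assms(1) xy(1-3), of a b] assms(3) by simp
  qed
qed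

lemma pair_after_move:
  assumes mv: "move S a b p q a' b'" and "x \<in> S - {q}" "y \<in> S - {q}" "x \<noteq> y"
  shows "{x, y} = {a', b'} \<longleftrightarrow> (if x = p then differs S a b p q y else
    if y = p then differs S a b p q x else {x, y} = {a, b})"
proof -
  have pq: "p \<noteq> q" using mv by (simp add: move_def)
  have untouched: "{x, y} \<noteq> {a, b}" if nk: "\<not> kept a b p q" and "x \<noteq> p" "y \<noteq> p"
  proof
    assume eq: "{x, y} = {a, b}"
    then have "a \<noteq> b" using assms(4) by (auto simp: doubleton_eq_iff)
    then have "p \<in> {x, y} \<or> q \<in> {x, y}" using nk unfolding eq kept_def by blast
    then show False using that(2,3) assms(2,3) by auto
  qed
  from mv show ?thesis
  proof (cases rule: move_cases)
    case 1
    have "{x, y} \<noteq> {a', b'}" using 1 assms(4) by auto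
    then show ?thesis using untouched 1 by simp
  next
    case 2
    then show ?thesis by (auto simp: kept_def doubleton_eq_iff)
  next
    case 3
    have "differs S a b p q b'" using 3(3) by blast
    then have "b' \<noteq> p" by (simp add: differs_def)
    then show ?thesis
      using untouched[OF 3(1)] 3(2,3) assms(4) by (simp add: doubleton_eq_iff)
  qed
qed

text \<open>A move is a genuine contraction once the survivor \<open>p\<close> is renamed
  \<open>z\<close>: edges away from \<open>p\<close> are untouched, and at \<open>p\<close> the red
  edges are those to differing vertices, while elsewhere \<open>p\<close> and \<open>q\<close>
  agree.\<close>

lemma contract_state_trigraph:
  assumes mv: "move S a b p q a' b'" and inj: "inj_on f S" and fin: "finite S"
    and valid: "valid_pair S a b" and z: "z \<notin> f ` S"
  shows "contracts_to (state_trigraph f S a b) (f p) (f q) z (state_trigraph (f(p := z)) (S - {q}) a' b')"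
    (is "contracts_to ?T _ _ _ ?T'")
proof -
  have pq: "p \<in> S" "q \<in> S" "p \<noteq> q" using mv by (auto simp: move_def)
  have T: "is_trigraph ?T" by (rule is_trigraph_state_trigraph[OF inj fin valid])
  have zT: "z \<notin> verts ?T" using z by simp
  have con: "contracts_to ?T (f p) (f q) z (contract (f p) (f q) z ?T)"
    using pq z inj_on_eq_iff[OF inj] by (auto simp: contracts_to_def)
  have valid': "valid_pair (S - {q}) a' b'" by (rule move_valid_pair[OF mv valid])
  have inj': "inj_on (f(p := z)) (S - {q})"
    using inj z by (auto simp: inj_on_def)
  have vT: "x \<in> S \<Longrightarrow> x \<noteq> p \<Longrightarrow> x \<noteq> q \<Longrightarrow> f x \<in> verts ?T - {f p, f q}" for x
    using inj_on_eq_iff[OF inj] pq by auto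
  have new: "({z, f y} \<in> black (contract (f p) (f q) z ?T) \<longleftrightarrow> E p y \<and> \<not> differs S a b p q y) \<and>
      ({z, f y} \<in> red (contract (f p) (f q) z ?T) \<longleftrightarrow> differs S a b p q y)"
    if y: "y \<in> S" "y \<noteq> p" "y \<noteq> q" for y
    unfolding new_pair_in_contract[OF T zT vT[OF y]] adj_def
      pair_in_state_trigraph(1)[OF inj pq(1) y(1) y(2)[symmetric]]
      pair_in_state_trigraph(1)[OF inj pq(2) y(1) y(3)[symmetric]]
      pair_in_state_trigraph(2)[OF inj pq(1) y(1) y(2)[symmetric] valid]
      pair_in_state_trigraph(2)[OF inj pq(2) y(1) y(3)[symmetric] valid]
      differs_def using y by blast
  have old: "({f x, f y} \<in> black (contract (f p) (f q) z ?T) \<longleftrightarrow> E x y \<and> {x, y} \<noteq> {a, b}) \<and>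
      ({f x, f y} \<in> red (contract (f p) (f q) z ?T) \<longleftrightarrow> {x, y} = {a, b})"
    if xy: "x \<in> S" "x \<noteq> p" "x \<noteq> q" "y \<in> S" "y \<noteq> p" "y \<noteq> q" "x \<noteq> y" for x y
    unfolding pair_in_contract[OF T zT vT[OF xy(1-3)] vT[OF xy(4-6)]]
      pair_in_state_trigraph(1)[OF inj xy(1,4,7)] pair_in_state_trigraph(2)[OF inj xy(1,4,7) valid]
    by (intro conjI refl)
  let ?f = "f(p := z)"
  have mem: "({?f x, ?f y} \<in> black (contract (f p) (f q) z ?T) \<longleftrightarrow> {?f x, ?f y} \<in> black ?T') \<and>
      ({?f x, ?f y} \<in> red (contract (f p) (f q) z ?T) \<longleftrightarrow> {?f x, ?f y} \<in> red ?T')"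
    if xy: "x \<in> S - {q}" "y \<in> S - {q}" "x \<noteq> y" for x y
  proof -
    have S: "x \<in> S" "x \<noteq> q" "y \<in> S" "y \<noteq> q" using xy by auto
    consider "x = p" "y \<noteq> p" | "x \<noteq> p" "y = p" | "x \<noteq> p" "y \<noteq> p" using xy by blast
    then show ?thesis
      unfolding pair_in_state_trigraph(1)[OF inj' xy] pair_in_state_trigraph(2)[OF inj' xy valid']
        pair_after_move[OF mv xy]
    proof cases
      case 1
      then show "({?f x, ?f y} \<in> black (contract (f p) (f q) z ?T)) = (E x y \<and> \<not> (if x = p then differs S a b p q y else if y = p then differs S a b p q x else {x, y} = {a, b})) \<and>
        ({?f x, ?f y} \<in> red (contract (f p) (f q) z ?T)) = (if x = p then differs S a b p q y else if y = p then differs S a b p q x else {x, y} = {a, b})"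
        using new[OF S(3) _ S(4)] by simp
    next
      case 2
      then show "({?f x, ?f y} \<in> black (contract (f p) (f q) z ?T)) = (E x y \<and> \<not> (if x = p then differs S a b p q y else if y = p then differs S a b p q x else {x, y} = {a, b})) \<and>
        ({?f x, ?f y} \<in> red (contract (f p) (f q) z ?T)) = (if x = p then differs S a b p q y else if y = p then differs S a b p q x else {x, y} = {a, b})"
        using new[OF S(1) _ S(2)] E_sym[of x p] by (simp add: insert_commute[of "f x" z])
    next
      case 3
      then show "({?f x, ?f y} \<in> black (contract (f p) (f q) z ?T)) = (E x y \<and> \<not> (if x = p then differs S a b p q y else if y = p then differs S a b p q x else {x, y} = {a, b})) \<and>
        ({?f x, ?f y} \<in> red (contract (f p) (f q) z ?T)) = (if x = p then differs S a b p q y else if y = p then differs S a b p q x else {x, y} = {a, b})"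
        using old[OF S(1) _ S(2,3) _ S(4) xy(3)] by simp
    qed
  qed
  have verts: "verts (contract (f p) (f q) z ?T) = ?f ` (S - {q})"
  proof -
    have "f ` S - {f p, f q} = f ` (S - {p, q})"
      using inj_on_image_set_diff[OF inj, of S "{p, q}"] pq by auto
    moreover have "?f ` (S - {q}) = insert z (f ` (S - {p, q}))"
      using pq by (auto simp: image_iff)
    ultimately show ?thesis by (simp add: contract_def)
  qed
  have "contract (f p) (f q) z ?T = ?T'"
  proof (rule trigraph_eqI)
    show "is_trigraph (contract (f p) (f q) z ?T)" by (rule contracts_to_is_trigraph[OF T con])
    show "is_trigraph ?T'" by (rule is_trigraph_state_trigraph[OF inj' _ valid']) (use fin in simp)
    show "verts (contract (f p) (f q) z ?T) = verts ?T'" using verts by simp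
    fix X Y assume XY: "X \<in> verts (contract (f p) (f q) z ?T)" "Y \<in> verts (contract (f p) (f q) z ?T)" "X \<noteq> Y"
    obtain x where x: "x \<in> S - {q}" "X = ?f x" using XY(1) unfolding verts by blast
    obtain y where y: "y \<in> S - {q}" "Y = ?f y" using XY(2) unfolding verts by blast
    have "x \<noteq> y" using XY(3) x y by blast
    note m = mem[OF x(1) y(1) this]
    show "{X, Y} \<in> black (contract (f p) (f q) z ?T) \<longleftrightarrow> {X, Y} \<in> black ?T'"
      unfolding x(2) y(2) using m by blast
    show "{X, Y} \<in> red (contract (f p) (f q) z ?T) \<longleftrightarrow> {X, Y} \<in> red ?T'"
      unfolding x(2) y(2) using m by blast
  qed
  then show ?thesis using con by simp
qed

lemma card_red_state_trigraph: "finite (red (state_trigraph f S a b)) \<and> card (red (state_trigraph f S a b)) \<le> 1"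
  by (simp add: state_trigraph_def)

lemma reach_contractions:
  assumes "reach n ms S a b"
  shows "\<exists>Ts. length Ts = Suc (length ms) \<and> hd Ts = state_trigraph id {..<n} 0 0 \<and>
    last Ts = state_trigraph (names n (\<lambda>i. fst (ms ! i)) (length ms)) S a b \<and>
    (\<forall>i<length ms. contracts_to (Ts ! i) (names n (\<lambda>i. fst (ms ! i)) i (fst (ms ! i)))
      (names n (\<lambda>i. fst (ms ! i)) i (snd (ms ! i))) (n + i) (Ts ! Suc i)) \<and>
    (\<forall>T\<in>set Ts. finite (red T) \<and> card (red T) \<le> 1)"
  using assms
proof (induction rule: reach.induct)
  case (reach_start a b)
  have "state_trigraph id {..<n} a b = state_trigraph id {..<n} 0 0"
    using reach_start by (auto simp: state_trigraph_def)
  then show ?case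
    by (intro exI[of _ "[state_trigraph id {..<n} 0 0]"])
      (simp add: id_def card_red_state_trigraph[THEN conjunct1] card_red_state_trigraph[THEN conjunct2, simplified])
next
  case (reach_move ms S a b p q a' b')
  let ?ms = "ms @ [(p, q)]" and ?k = "length ms"
  let ?ps = "\<lambda>i. fst (ms ! i)" and ?ps' = "\<lambda>i. fst (?ms ! i)"
  \<comment> \<open>The first \<open>i\<close> names depend on earlier moves only, so appending a
    move leaves them alone.\<close>
  have nm: "names n ?ps' i = names n ?ps i" if "i \<le> ?k" for i
    by (rule names_cong) (use that in \<open>simp add: nth_append\<close>)
  from reach_move.IH obtain Ts where *: "length Ts = Suc ?k \<and> hd Ts = state_trigraph id {..<n} 0 0 \<and>
    last Ts = state_trigraph (names n ?ps ?k) S a b \<and>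
    (\<forall>i<?k. contracts_to (Ts ! i) (names n ?ps i (fst (ms ! i)))
      (names n ?ps i (snd (ms ! i))) (n + i) (Ts ! Suc i)) \<and>
    (\<forall>T\<in>set Ts. finite (red T) \<and> card (red T) \<le> 1)" by (rule exE)
  then have Ts: "length Ts = Suc ?k" "hd Ts = state_trigraph id {..<n} 0 0"
    "last Ts = state_trigraph (names n ?ps ?k) S a b"
    "\<And>i. i < ?k \<Longrightarrow> contracts_to (Ts ! i) (names n ?ps i (fst (ms ! i)))
      (names n ?ps i (snd (ms ! i))) (n + i) (Ts ! Suc i)"
    "\<And>T. T \<in> set Ts \<Longrightarrow> finite (red T) \<and> card (red T) \<le> 1"
    by simp_all
  let ?f = "names n ?ps ?k"
  let ?T' = "state_trigraph (?f(p := n + ?k)) (S - {q}) a' b'"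
  have Sn: "S \<subseteq> {..<n}" using reach_verts[OF reach_move.hyps(1)] by blast
  have step: "contracts_to (last Ts) (?f p) (?f q) (n + ?k) ?T'"
    unfolding Ts(3)
  proof (rule contract_state_trigraph[OF reach_move.hyps(2)])
    show "inj_on ?f S" by (rule inj_on_subset[OF inj_names Sn])
    show "finite S" using reach_card[OF reach_move.hyps(1)] by blast
    show "valid_pair S a b" by (rule reach_valid[OF reach_move.hyps(1)])
    show "n + ?k \<notin> ?f ` S"
    proof
      assume "n + ?k \<in> ?f ` S"
      then obtain x where "n + ?k = ?f x" "x \<in> S" by (rule imageE)
      then show False using names_less[of x n ?ps ?k] Sn by auto
    qed
  qed
  have lastTs: "Ts ! ?k = last Ts" using Ts(1) by (metis diff_Suc_1 last_conv_nth list.size(3) nat.distinct(1))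
  show ?case
  proof (intro exI[of _ "Ts @ [?T']"] conjI allI impI ballI)
    show "length (Ts @ [?T']) = Suc (length ?ms)" using Ts(1) by simp
    show "hd (Ts @ [?T']) = state_trigraph id {..<n} 0 0" using Ts(1,2) by (cases Ts) auto
    show "last (Ts @ [?T']) = state_trigraph (names n ?ps' (length ?ms)) (S - {q}) a' b'"
      by (simp add: nm)
    show "contracts_to ((Ts @ [?T']) ! i) (names n ?ps' i (fst (?ms ! i)))
      (names n ?ps' i (snd (?ms ! i))) (n + i) ((Ts @ [?T']) ! Suc i)" if "i < length ?ms" for i
    proof -
      have i: "i \<le> ?k" using that by simp
      show ?thesis unfolding nm[OF i]
      proof (cases "i = ?k")
        case True
        then show "contracts_to ((Ts @ [?T']) ! i) (names n ?ps i (fst (?ms ! i)))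
          (names n ?ps i (snd (?ms ! i))) (n + i) ((Ts @ [?T']) ! Suc i)"
          using step Ts(1) lastTs by (simp add: nth_append)
      next
        case False
        then have "i < ?k" using i by simp
        then show "contracts_to ((Ts @ [?T']) ! i) (names n ?ps i (fst (?ms ! i)))
          (names n ?ps i (snd (?ms ! i))) (n + i) ((Ts @ [?T']) ! Suc i)"
          using Ts(4)[of i] Ts(1) by (simp add: nth_append)
      qed
    qed
    show "finite (red T)" "card (red T) \<le> 1" if "T \<in> set (Ts @ [?T'])" for T
      using that Ts(5) card_red_state_trigraph by auto
  qed
qed

end

lemma reach_imp_d_sequence:
  assumes G: "is_graph G" "verts G = {..<n}" and "n \<ge> 1"
    and reach: "adjacency.reach (\<lambda>x y. {x, y} \<in> black G) n ms S a b" and len: "Suc (length ms) = n"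
  shows "\<exists>Ts. d_sequence 1 G Ts \<and> length Ts = n \<and> (\<forall>T\<in>set Ts. card (red T) \<le> 1) \<and>
    (\<forall>i<length ms. contracts_to (Ts ! i) (names n (\<lambda>i. fst (ms ! i)) i (fst (ms ! i)))
      (names n (\<lambda>i. fst (ms ! i)) i (snd (ms ! i))) (n + i) (Ts ! Suc i))"
proof -
  interpret adjacency "\<lambda>x y. {x, y} \<in> black G"
    by unfold_locales (simp add: insert_commute)
  have T: "is_trigraph G" and r: "red G = {}" using G by (auto simp: is_graph_def)
  have start: "state_trigraph id {..<n} 0 0 = G"
  proof (rule trigraph_eqI)
    show "is_trigraph (state_trigraph id {..<n} 0 0)"
      by (rule is_trigraph_state_trigraph) (simp_all add: valid_pair_def)
    show "is_trigraph G" by (rule T)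
    show "verts (state_trigraph id {..<n} 0 0) = verts G" using G by simp
    show "{x, y} \<in> black (state_trigraph id {..<n} 0 0) \<longleftrightarrow> {x, y} \<in> black G"
      if "x \<in> verts (state_trigraph id {..<n} 0 0)" "y \<in> verts (state_trigraph id {..<n} 0 0)" "x \<noteq> y" for x y
      using pair_in_state_trigraph(1)[of id "{..<n}" x y 0 0] that by (auto simp: doubleton_eq_iff)
    show "{x, y} \<in> red (state_trigraph id {..<n} 0 0) \<longleftrightarrow> {x, y} \<in> red G" for x y
      using r by (simp add: state_trigraph_def)
  qed
  from reach_contractions[OF reach, unfolded start]
  obtain Ts where *: "length Ts = Suc (length ms) \<and> hd Ts = G \<and>
    last Ts = state_trigraph (names n (\<lambda>i. fst (ms ! i)) (length ms)) S a b \<and>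
    (\<forall>i<length ms. contracts_to (Ts ! i) (names n (\<lambda>i. fst (ms ! i)) i (fst (ms ! i)))
      (names n (\<lambda>i. fst (ms ! i)) i (snd (ms ! i))) (n + i) (Ts ! Suc i)) \<and>
    (\<forall>T\<in>set Ts. finite (red T) \<and> card (red T) \<le> 1)" by (rule exE)
  then have Ts: "length Ts = Suc (length ms)" "hd Ts = G"
    "\<And>i. i < length ms \<Longrightarrow> contracts_to (Ts ! i) (names n (\<lambda>i. fst (ms ! i)) i (fst (ms ! i)))
      (names n (\<lambda>i. fst (ms ! i)) i (snd (ms ! i))) (n + i) (Ts ! Suc i)"
    "\<And>T. T \<in> set Ts \<Longrightarrow> finite (red T) \<and> card (red T) \<le> 1"
    by simp_all
  have "red_degree T v \<le> 1" if "T \<in> set Ts" for T v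
    using red_degree_le_card_red[of T v] Ts(4)[OF that] by linarith
  moreover have "\<exists>u v z. contracts_to (Ts ! i) u v z (Ts ! Suc i)" if "Suc i < length Ts" for i
    using Ts(3)[of i] that Ts(1) by auto
  moreover have "Ts \<noteq> []" using Ts(1) by auto
  ultimately have "d_sequence 1 G Ts"
    unfolding d_sequence_def using Ts(1,2) G(2) len by simp
  then show ?thesis using Ts len by (intro exI[of _ Ts]) simp
qed

section \<open>Reasoning about programs\<close>

definition var :: "string \<Rightarrow> aexp" where "var x = Read x (Num 0)"
definition assign :: "string \<Rightarrow> aexp \<Rightarrow> com" where "assign x a = Write x (Num 0) a"

definition b_not :: "aexp \<Rightarrow> aexp" where "b_not a = Minus (Num 1) a"
definition b_or :: "aexp \<Rightarrow> aexp \<Rightarrow> aexp" where "b_or a b = Plus a b"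
definition b_and :: "aexp \<Rightarrow> aexp \<Rightarrow> aexp" where "b_and a b = b_not (b_or (b_not a) (b_not b))"
definition b_neq :: "aexp \<Rightarrow> aexp \<Rightarrow> aexp" where "b_neq a b = Plus (Minus a b) (Minus b a)"

lemma aval_simps [simp]:
  "aval (var x) s = s x 0"
  "aval (b_not a) s = 0 \<longleftrightarrow> aval a s \<noteq> 0"
  "aval (b_or a b) s = 0 \<longleftrightarrow> aval a s = 0 \<and> aval b s = 0"
  "aval (b_and a b) s = 0 \<longleftrightarrow> aval a s = 0 \<or> aval b s = 0"
  "aval (b_neq a b) s = 0 \<longleftrightarrow> aval a s = aval b s"
  by (auto simp: var_def b_not_def b_or_def b_and_def b_neq_def)

primrec block :: "com list \<Rightarrow> com" where
  "block [] = Skip"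
| "block (c # cs) = Seq c (block cs)"

text \<open>The bound is evaluated anew at every test, which is why \<open>runs_for\<close> asks
  that the loop does not change its value.\<close>

definition For :: "string \<Rightarrow> aexp \<Rightarrow> com \<Rightarrow> com" where
  "For i e c = Seq (assign i (Num 0))
     (While (Minus e (var i)) (Seq c (assign i (Plus (var i) (Num 1)))))"

primrec writes :: "com \<Rightarrow> string set" where
  "writes Skip = {}"
| "writes (Write x a b) = {x}"
| "writes (Seq c1 c2) = writes c1 \<union> writes c2"
| "writes (Cond a c1 c2) = writes c1 \<union> writes c2"
| "writes (While a c) = writes c"

lemma writes_simps [simp]:
  "writes (assign x a) = {x}"
  "writes (block []) = {}"
  "writes (block (c # cs)) = writes c \<union> writes (block cs)"
  "writes (For i e c) = insert i (writes c)"
  by (auto simp: assign_def For_def)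

text \<open>Arrays that do not occur in \<open>writes c\<close> are preserved, so a specification
  need only describe what the program changes; \<open>runs_use\<close> supplies the rest.\<close>

lemma exec_frame: "exec c s t s' \<Longrightarrow> x \<notin> writes c \<Longrightarrow> s' x = s x"
  by (induction rule: exec.induct) auto

definition runs :: "com \<Rightarrow> state \<Rightarrow> nat \<Rightarrow> (state \<Rightarrow> bool) \<Rightarrow> bool" where
  "runs c s T Q \<longleftrightarrow> (\<exists>t s'. exec c s t s' \<and> t \<le> T \<and> Q s')"

lemma runs_mono: "runs c s T Q \<Longrightarrow> T \<le> T' \<Longrightarrow> (\<And>s'. Q s' \<Longrightarrow> Q' s') \<Longrightarrow> runs c s T' Q'"
  unfolding runs_def by (meson order_trans)

lemma runs_time: "runs c s T Q \<Longrightarrow> T \<le> T' \<Longrightarrow> runs c s T' Q"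
  by (rule runs_mono)

lemma runs_frame:
  "runs c s T Q \<Longrightarrow> runs c s T (\<lambda>s'. Q s' \<and> (\<forall>x. x \<notin> writes c \<longrightarrow> s' x = s x))"
  unfolding runs_def using exec_frame by blast

lemma runs_use:
  assumes "runs c s T Q" and "\<And>s'. Q s' \<Longrightarrow> (\<forall>x. x \<notin> writes c \<longrightarrow> s' x = s x) \<Longrightarrow> Q' s'"
  shows "runs c s T Q'"
  by (rule runs_mono[OF runs_frame[OF assms(1)] order_refl]) (use assms(2) in blast)

lemma runs_skip: "Q s \<Longrightarrow> runs Skip s 1 Q"
  unfolding runs_def using exec.Skip by blast

lemma runs_write: "Q (s(x := (s x)(aval a s := aval b s))) \<Longrightarrow> runs (Write x a b) s 1 Q"
  unfolding runs_def using exec.Write by blast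

lemma runs_assign: "Q (s(x := (s x)(0 := aval b s))) \<Longrightarrow> runs (assign x b) s 1 Q"
  unfolding assign_def by (rule runs_write) simp

lemma runs_seq: "runs c1 s T1 (\<lambda>s'. runs c2 s' T2 Q) \<Longrightarrow> runs (Seq c1 c2) s (T1 + T2) Q"
  unfolding runs_def by (meson add_mono exec.Seq)

lemma runs_cond:
  assumes "aval a s \<noteq> 0 \<Longrightarrow> runs c1 s T1 Q" and "aval a s = 0 \<Longrightarrow> runs c2 s T2 Q"
  shows "runs (Cond a c1 c2) s (T1 + T2 + 1) Q"
proof (cases "aval a s = 0")
  case True
  then obtain t s' where "exec c2 s t s'" "t \<le> T2" "Q s'" using assms(2) unfolding runs_def by blast
  then show ?thesis unfolding runs_def using exec.CondFalse[OF True]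
    by (intro exI[of _ "t + 1"] exI[of _ s']) auto
next
  case False
  then obtain t s' where "exec c1 s t s'" "t \<le> T1" "Q s'" using assms(1) unfolding runs_def by blast
  then show ?thesis unfolding runs_def using exec.CondTrue[OF False]
    by (intro exI[of _ "t + 1"] exI[of _ s']) auto
qed

lemma runs_block:
  "Q s \<Longrightarrow> runs (block []) s 1 Q"
  "runs c s T1 (\<lambda>s'. runs (block cs) s' T2 Q) \<Longrightarrow> runs (block (c # cs)) s (T1 + T2) Q"
  unfolding block.simps by (rule runs_skip, assumption) (rule runs_seq, assumption)

text \<open>Each round costs the body, one test and one increment; the final \<open>2\<close> pays
  for the initialisation and the failing test. The counter is increased after the body, so the
  invariant must not depend on the array \<open>i\<close>.\<close>

lemma runs_for:
  fixes I :: "nat \<Rightarrow> state \<Rightarrow> bool"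
  assumes init: "I 0 s"
    and body: "\<And>j t. j < N \<Longrightarrow> I j t \<Longrightarrow> t i 0 = j \<Longrightarrow> (\<forall>x. x \<notin> insert i (writes c) \<longrightarrow> t x = s x) \<Longrightarrow>
      runs c t T (I (Suc j))"
    and stable: "\<And>j t v. I j t \<Longrightarrow> I j (t(i := v))"
    and bound: "\<And>t. (\<forall>x. x \<notin> insert i (writes c) \<longrightarrow> t x = s x) \<Longrightarrow> aval e t = N"
    and i: "i \<notin> writes c"
  shows "runs (For i e c) s (N * (T + 2) + 2) (I N)"
proof -
  let ?w = "While (Minus e (var i)) (Seq c (assign i (Plus (var i) (Num 1))))"
  let ?fr = "\<lambda>t. \<forall>x. x \<notin> insert i (writes c) \<longrightarrow> t x = s x"
  have loop: "runs ?w t (d * (T + 2) + 1) (I N)"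
    if "I j t" "t i 0 = j" "?fr t" "d = N - j" "j \<le> N" for j t d
    using that
  proof (induction d arbitrary: j t)
    case 0
    then have "aval (Minus e (var i)) t = 0" "j = N" using bound[OF 0(3)] by simp_all
    then show ?case unfolding runs_def using exec.WhileFalse[of _ t] 0(1)
      by (intro exI[of _ 1] exI[of _ t]) simp
  next
    case (Suc d)
    then have j: "j < N" by simp
    have "runs c t T (\<lambda>t1. I (Suc j) t1 \<and> (\<forall>x. x \<notin> writes c \<longrightarrow> t1 x = t x))"
      by (rule runs_frame[OF body[OF j Suc.prems(1-3)]])
    then obtain k t1 where t1: "exec c t k t1" "k \<le> T" "I (Suc j) t1"
      and fr: "\<And>x. x \<notin> writes c \<Longrightarrow> t1 x = t x" unfolding runs_def by blast
    let ?t2 = "t1(i := (t1 i)(0 := Suc j))"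
    have "t1 i 0 = j" using fr[OF i] Suc.prems(2) by simp
    then have ex: "exec (Seq c (assign i (Plus (var i) (Num 1)))) t (k + 1) ?t2"
      using exec.Seq[OF t1(1) exec.Write[of i "Num 0" "Plus (var i) (Num 1)" t1]]
      by (simp add: assign_def)
    have "runs ?w ?t2 (d * (T + 2) + 1) (I N)"
    proof (rule Suc.IH)
      show "I (Suc j) ?t2" by (rule stable[OF t1(3)])
      show "?fr ?t2" using fr Suc.prems(3) by simp
    qed (use Suc.prems j in auto)
    then obtain k' s' where s': "exec ?w ?t2 k' s'" "k' \<le> d * (T + 2) + 1" "I N s'"
      unfolding runs_def by blast
    have "aval (Minus e (var i)) t \<noteq> 0" using bound[OF Suc.prems(3)] Suc.prems(2) j by simp
    from exec.WhileTrue[OF this ex s'(1)]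
    show ?case unfolding runs_def using s'(2,3) t1(2)
      by (intro exI[of _ "k + 1 + k' + 1"] exI[of _ s']) simp
  qed
  let ?t = "s(i := (s i)(0 := 0))"
  have "runs ?w ?t (N * (T + 2) + 1) (I N)"
    by (rule loop[where j = 0]) (use stable[OF init] in simp_all)
  then have "runs (For i e c) s (1 + (N * (T + 2) + 1)) (I N)"
    unfolding For_def by (intro runs_seq runs_assign) simp
  then show ?thesis by (rule runs_time) simp
qed

section \<open>Closure rules for polynomial time bounds\<close>

definition polynomially_bounded :: "(nat \<Rightarrow> nat) \<Rightarrow> bool" where
  "polynomially_bounded f \<longleftrightarrow> (\<exists>p :: nat poly. \<forall>n. f n \<le> poly p n)"

lemma polynomially_bounded_intros:
  "polynomially_bounded (\<lambda>n. c)"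
  "polynomially_bounded (\<lambda>n. n)"
  "polynomially_bounded f \<Longrightarrow> polynomially_bounded g \<Longrightarrow> polynomially_bounded (\<lambda>n. f n + g n)"
  "polynomially_bounded f \<Longrightarrow> polynomially_bounded g \<Longrightarrow> polynomially_bounded (\<lambda>n. f n * g n)"
proof -
  show "polynomially_bounded (\<lambda>n. c)"
    unfolding polynomially_bounded_def by (intro exI[of _ "[:c:]"]) simp
  show "polynomially_bounded (\<lambda>n. n)"
    unfolding polynomially_bounded_def by (intro exI[of _ "[:0, 1:]"]) simp
  assume "polynomially_bounded f" "polynomially_bounded g"
  then obtain p q :: "nat poly" where pq: "\<And>n. f n \<le> poly p n" "\<And>n. g n \<le> poly q n"
    unfolding polynomially_bounded_def by blast
  show "polynomially_bounded (\<lambda>n. f n + g n)"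
    unfolding polynomially_bounded_def using pq by (intro exI[of _ "p + q"]) (simp add: add_mono)
  show "polynomially_bounded (\<lambda>n. f n * g n)"
    unfolding polynomially_bounded_def using pq by (intro exI[of _ "p * q"]) (simp add: mult_mono)
qed

section \<open>The algorithm\<close>

definition b_eq :: "aexp \<Rightarrow> aexp \<Rightarrow> aexp" where "b_eq a b = b_not (b_neq a b)"

lemma aval_b_eq [simp]: "aval (b_eq a b) s = 0 \<longleftrightarrow> aval a s \<noteq> aval b s"
  by (simp add: b_eq_def)

text \<open>The machine has no multiplication, so the offsets \<open>u * n\<close> of the matrix
  rows are read from the array \<open>row\<close>, which is filled in advance by repeated
  addition.\<close>

definition adjacent :: "string \<Rightarrow> string \<Rightarrow> aexp" where
  "adjacent p x = Read ''adj'' (Plus (Read ''row'' (var p)) (var x))"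

definition is_red :: "string \<Rightarrow> string \<Rightarrow> aexp" where
  "is_red p x = b_or (b_and (b_eq (var p) (var ''a'')) (b_eq (var x) (var ''b'')))
     (b_and (b_eq (var p) (var ''b'')) (b_eq (var x) (var ''a'')))"

definition kept_exp :: aexp where
  "kept_exp = b_and (b_neq (var ''a'') (var ''b''))
     (b_and (b_and (b_neq (var ''p'') (var ''a'')) (b_neq (var ''p'') (var ''b'')))
       (b_and (b_neq (var ''q'') (var ''a'')) (b_neq (var ''q'') (var ''b''))))"

definition differs_exp :: aexp where
  "differs_exp = b_and (Read ''al'' (var ''x''))
     (b_and (b_and (b_neq (var ''x'') (var ''p'')) (b_neq (var ''x'') (var ''q'')))
       (b_or (b_neq (adjacent ''p'' ''x'') (adjacent ''q'' ''x''))
         (b_or (is_red ''p'' ''x'') (is_red ''q'' ''x''))))"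

text \<open>\<open>try_move\<close> counts the red edges that contracting \<open>p\<close> and \<open>q\<close> would produce in \<open>c\<close>, with one
  of them in \<open>e\<close>, \<open>f\<close>, and contracts if there is at most one. The representatives are marked in
  \<open>al\<close>, the red pair is \<open>a\<close>, \<open>b\<close>, and the \<open>kk\<close> moves made so far are in \<open>ru\<close>, \<open>rw\<close>.\<close>

definition try_init :: com where
  "try_init = block [assign ''c'' (Num 0), assign ''e'' (Num 0), assign ''f'' (Num 0),
     Cond kept_exp
       (block [assign ''c'' (Num 1), assign ''e'' (var ''a''), assign ''f'' (var ''b'')]) Skip]"

definition try_scan_body :: com where
  "try_scan_body = Cond differs_exp
     (block [assign ''c'' (Plus (var ''c'') (Num 1)), assign ''e'' (var ''p''),
       assign ''f'' (var ''x'')]) Skip"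

definition try_commit :: com where
  "try_commit = Cond (Minus (Num 2) (var ''c''))
     (block [assign ''a'' (var ''e''), assign ''b'' (var ''f''),
       Write ''ru'' (var ''kk'') (var ''p''), Write ''rw'' (var ''kk'') (var ''q''),
       Write ''al'' (var ''q'') (Num 0), assign ''kk'' (Plus (var ''kk'') (Num 1)),
       assign ''d'' (Num 1)]) Skip"

definition try_move :: com where
  "try_move = block [try_init, For ''x'' (var ''n'') try_scan_body, try_commit]"

lemma writes_try [simp]:
  "writes try_init = {''c'', ''e'', ''f''}"
  "writes try_scan_body = {''c'', ''e'', ''f''}"
  "writes try_commit = {''a'', ''b'', ''ru'', ''rw'', ''al'', ''kk'', ''d''}"
  "writes try_move = {''c'', ''e'', ''f'', ''x'', ''a'', ''b'', ''ru'', ''rw'', ''al'', ''kk'', ''d''}"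
  by (auto simp: try_init_def try_scan_body_def try_commit_def try_move_def simp del: block.simps)

definition time_try :: "nat \<Rightarrow> nat" where "time_try n = n * 20 + 60"

context adjacency
begin

definition env :: "nat \<Rightarrow> state \<Rightarrow> bool" where
  "env n s \<longleftrightarrow> s ''n'' 0 = n \<and> (\<forall>u<n. s ''row'' u = u * n) \<and>
     (\<forall>u<n. \<forall>v<n. s ''adj'' (u * n + v) = (if E u v then 1 else 0))"

definition stores :: "state \<Rightarrow> (nat \<times> nat) list \<Rightarrow> bool" where
  "stores s ms \<longleftrightarrow> (\<forall>i<length ms. s ''ru'' i = fst (ms ! i) \<and> s ''rw'' i = snd (ms ! i))"

text \<open>The invariant contains \<open>reach\<close>, so the moves in memory are legal
  contractions even where the state is not good; this is what makes acceptance sound.\<close>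

definition work :: "nat \<Rightarrow> (nat \<times> nat) list \<Rightarrow> nat set \<Rightarrow> nat \<Rightarrow> nat \<Rightarrow> state \<Rightarrow> bool" where
  "work n ms S a b s \<longleftrightarrow> env n s \<and> s ''kk'' 0 = length ms \<and> stores s ms \<and>
     (\<forall>x<n. s ''al'' x \<noteq> 0 \<longleftrightarrow> x \<in> S) \<and> s ''a'' 0 = a \<and> s ''b'' 0 = b \<and> reach n ms S a b"

lemma env_cong:
  assumes "env n s" and "t ''n'' = s ''n''" "t ''row'' = s ''row''" "t ''adj'' = s ''adj''"
  shows "env n t"
  using assms by (simp add: env_def)

lemma work_cong:
  assumes "work n ms S a b s"
    and "t ''n'' = s ''n''" "t ''row'' = s ''row''" "t ''adj'' = s ''adj''" "t ''kk'' = s ''kk''"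
    and "t ''ru'' = s ''ru''" "t ''rw'' = s ''rw''" "t ''al'' = s ''al''" "t ''a'' = s ''a''" "t ''b'' = s ''b''"
  shows "work n ms S a b t"
  using assms env_cong[of n s t] by (simp add: work_def stores_def)

text \<open>A red edge that survives the contraction is counted in advance. Otherwise
  \<open>e = f = 0\<close> stands for no red edge until the scan finds one.\<close>

lemma runs_try_init:
  assumes "s ''a'' 0 = a" "s ''b'' 0 = b" "s ''p'' 0 = p" "s ''q'' 0 = q"
  shows "runs try_init s 20 (\<lambda>t. t ''c'' 0 = (if kept a b p q then 1 else 0) \<and>
    (if kept a b p q then t ''e'' 0 = a \<and> t ''f'' 0 = b else t ''e'' 0 = t ''f'' 0))"
    (is "runs _ _ _ ?Q")
proof -
  have "runs try_init s (1 + (1 + (1 + ((1 + (1 + (1 + 1)) + 1 + 1) + 1)))) ?Q"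
    unfolding try_init_def
    by (intro runs_block runs_assign runs_cond runs_skip)
      (use assms in \<open>auto simp: kept_exp_def kept_def\<close>)
  then show ?thesis by (rule runs_time) simp
qed

lemma aval_differs_exp:
  assumes "env n t" and al: "\<forall>x<n. t ''al'' x \<noteq> 0 \<longleftrightarrow> x \<in> S"
    and "t ''a'' 0 = a" "t ''b'' 0 = b" "t ''p'' 0 = p" "t ''q'' 0 = q" "t ''x'' 0 = x"
    and "p < n" "q < n" "x < n"
  shows "aval differs_exp t = 0 \<longleftrightarrow> \<not> differs S a b p q x"
proof -
  have al': "t ''al'' x = 0 \<longleftrightarrow> x \<notin> S" using al \<open>x < n\<close> by blast
  have adj: "aval (adjacent ''p'' ''x'') t = aval (adjacent ''q'' ''x'') t \<longleftrightarrow> E p x = E q x"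
    using assms by (simp add: env_def adjacent_def)
  have red: "aval (is_red ''p'' ''x'') t = 0 \<longleftrightarrow> {p, x} \<noteq> {a, b}"
    "aval (is_red ''q'' ''x'') t = 0 \<longleftrightarrow> {q, x} \<noteq> {a, b}"
    using assms(3-7) by (auto simp: is_red_def doubleton_eq_iff)
  show ?thesis
    by (simp only: differs_def differs_exp_def aval_simps aval.simps(2) assms(3-7) al' adj red) blast
qed

text \<open>The cell \<open>f\<close> holds the differing vertex found last; it matters when there
  is exactly one, and then it is that vertex.\<close>

lemma runs_try_scan:
  assumes w: "work n ms S a b s" and pq: "s ''p'' 0 = p" "s ''q'' 0 = q" "p < n" "q < n"
  defines "D \<equiv> \<lambda>j. {x. x < j \<and> differs S a b p q x}"
  shows "runs (For ''x'' (var ''n'') try_scan_body) s (n * 20 + 2)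
    (\<lambda>t. t ''c'' 0 = s ''c'' 0 + card (D n) \<and>
      (if D n = {} then t ''e'' 0 = s ''e'' 0 \<and> t ''f'' 0 = s ''f'' 0
       else t ''e'' 0 = p \<and> t ''f'' 0 \<in> D n))"
proof -
  define I where "I j t \<longleftrightarrow> t ''c'' 0 = s ''c'' 0 + card (D j) \<and>
      (if D j = {} then t ''e'' 0 = s ''e'' 0 \<and> t ''f'' 0 = s ''f'' 0
       else t ''e'' 0 = p \<and> t ''f'' 0 \<in> D j)" for j and t :: state
  have "runs (For ''x'' (var ''n'') try_scan_body) s (n * (18 + 2) + 2) (I n)"
  proof (rule runs_for)
    show "I 0 s" by (simp add: I_def D_def)
    show "I j (t(''x'' := v))" if "I j t" for j t v using that by (simp add: I_def)
    show "aval (var ''n'') t = n"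
      if "\<forall>x. x \<notin> insert ''x'' (writes try_scan_body) \<longrightarrow> t x = s x" for t
      using that w by (simp add: work_def env_def)
    show "''x'' \<notin> writes try_scan_body" by simp
    fix j t assume j: "j < n" "I j t" "t ''x'' 0 = j"
      and fr: "\<forall>x. x \<notin> insert ''x'' (writes try_scan_body) \<longrightarrow> t x = s x"
    have wt: "work n ms S a b t" by (rule work_cong[OF w]) (use fr in simp_all)
    have tpq: "t ''p'' 0 = p" "t ''q'' 0 = q" using fr pq by simp_all
    have cond: "aval differs_exp t = 0 \<longleftrightarrow> \<not> differs S a b p q j"
      by (rule aval_differs_exp[of n]) (use wt tpq j pq in \<open>simp_all add: work_def\<close>)
    have fin: "finite (D j)" by (simp add: D_def)
    have Dn: "D (Suc j) = D j" if "\<not> differs S a b p q j"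
      using that by (auto simp: D_def less_Suc_eq)
    have Di: "D (Suc j) = insert j (D j)" "j \<notin> D j" if "differs S a b p q j"
      using that by (auto simp: D_def less_Suc_eq)
    show "runs try_scan_body t 18 (I (Suc j))"
      unfolding try_scan_body_def
    proof (rule runs_time, rule runs_cond)
      assume "aval differs_exp t \<noteq> 0"
      then have d: "differs S a b p q j" using cond by simp
      show "runs (block [assign ''c'' (Plus (var ''c'') (Num 1)), assign ''e'' (var ''p''),
          assign ''f'' (var ''x'')]) t (1 + (1 + (1 + 1))) (I (Suc j))"
        by (intro runs_block runs_assign)
          (use j tpq fin Di[OF d] in \<open>simp add: I_def\<close>)
    next
      assume "aval differs_exp t = 0"
      then have "\<not> differs S a b p q j" using cond by simp
      then show "runs Skip t 1 (I (Suc j))"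
        using j(2) by (intro runs_skip) (simp add: I_def Dn)
    qed simp
  qed
  then show ?thesis unfolding I_def by simp
qed

lemma runs_try_move:
  assumes w: "work n ms S a b s" and pq: "s ''p'' 0 = p" "s ''q'' 0 = q" "p \<in> S" "q \<in> S" "p \<noteq> q"
  shows "runs try_move s (time_try n) (\<lambda>t.
    (\<exists>a' b'. move S a b p q a' b' \<and> work n (ms @ [(p, q)]) (S - {q}) a' b' t \<and> t ''d'' 0 = 1) \<or>
    (\<forall>a' b'. \<not> move S a b p q a' b') \<and> work n ms S a b t \<and> t ''d'' = s ''d'')"
    (is "runs _ _ _ ?Q")
proof -
  have reach: "reach n ms S a b" and ab: "s ''a'' 0 = a" "s ''b'' 0 = b"
    using w by (simp_all add: work_def)
  have Sn: "S \<subseteq> {..<n}" using reach_verts[OF reach] by blast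
  then have pqn: "p < n" "q < n" using pq by auto
  define D where "D = {x. x < n \<and> differs S a b p q x}"
  have finD: "finite D" by (simp add: D_def)
  have D: "x \<in> D \<longleftrightarrow> differs S a b p q x" for x using Sn by (auto simp: D_def differs_def)
  have "runs try_move s (20 + ((n * 20 + 2) + (30 + 1))) ?Q"
    unfolding try_move_def
  proof (rule runs_block(2), rule runs_use[OF runs_try_init[where s = s, OF ab pq(1,2)]])
    fix s1 assume init: "s1 ''c'' 0 = (if kept a b p q then 1 else 0) \<and>
      (if kept a b p q then s1 ''e'' 0 = a \<and> s1 ''f'' 0 = b else s1 ''e'' 0 = s1 ''f'' 0)"
      and fr1: "\<forall>x. x \<notin> writes try_init \<longrightarrow> s1 x = s x"
    have w1: "work n ms S a b s1" by (rule work_cong[OF w]) (use fr1 in simp_all)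
    have pq1: "s1 ''p'' 0 = p" "s1 ''q'' 0 = q" using fr1 pq by simp_all
    show "runs (block [For ''x'' (var ''n'') try_scan_body, try_commit]) s1 ((n * 20 + 2) + (30 + 1)) ?Q"
    proof (rule runs_block(2), rule runs_use[OF runs_try_scan[OF w1 pq1 pqn]], fold D_def)
      fix s2 assume scan: "s2 ''c'' 0 = s1 ''c'' 0 + card D \<and>
          (if D = {} then s2 ''e'' 0 = s1 ''e'' 0 \<and> s2 ''f'' 0 = s1 ''f'' 0
           else s2 ''e'' 0 = p \<and> s2 ''f'' 0 \<in> D)"
        and fr2: "\<forall>x. x \<notin> writes (For ''x'' (var ''n'') try_scan_body) \<longrightarrow> s2 x = s1 x"
      have w2: "work n ms S a b s2" by (rule work_cong[OF w1]) (use fr2 in simp_all)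
      have pq2: "s2 ''p'' 0 = p" "s2 ''q'' 0 = q" and d2: "s2 ''d'' = s ''d''"
        using fr2 fr1 pq1 by simp_all
      have move: "move S a b p q (s2 ''e'' 0) (s2 ''f'' 0)" if c: "s2 ''c'' 0 < 2"
      proof (cases "D = {}")
        case True
        then have "\<forall>x. \<not> differs S a b p q x" using D by blast
        then show ?thesis
          using True scan init pq(3-5) unfolding move_def by (auto split: if_splits)
      next
        case False
        \<comment> \<open>A count below 2 with a differing vertex leaves room for this vertex alone
          and for no kept red edge.\<close>
        then have "card D \<noteq> 0" using finD by simp
        then have "card D = 1" "\<not> kept a b p q"
          using c scan init by (auto split: if_splits)
        then obtain y where "D = {y}" using card_1_singletonE by blast
        moreover have e: "s2 ''e'' 0 = p" "s2 ''f'' 0 \<in> D" using scan False by simp_all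
        ultimately have "D = {s2 ''f'' 0}" by simp
        then have "\<forall>x. differs S a b p q x \<longleftrightarrow> x = s2 ''f'' 0" using D by blast
        then show ?thesis
          using \<open>\<not> kept a b p q\<close> pq(3-5) e(1) unfolding move_def by blast
      qed
      have no_move: "\<not> move S a b p q a' b'" if c: "\<not> s2 ''c'' 0 < 2" for a' b'
      proof
        assume "move S a b p q a' b'"
        then show False
        proof (cases rule: move_cases)
          case 1
          then have "D = {}" using D by blast
          then show ?thesis using scan init c by (simp split: if_splits)
        next
          case 2
          then have "D = {}" using D by blast
          then show ?thesis using scan init c by (simp split: if_splits)
        next
          case 3
          then have "D = {b'}" using D by blast
          then show ?thesis using scan init c 3(1) by simp
        qed
      qed
      show "runs (block [try_commit]) s2 (30 + 1) ?Q"
      proof (rule runs_block(2), unfold try_commit_def, rule runs_time, rule runs_cond)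
        assume "aval (Minus (Num 2) (var ''c'')) s2 \<noteq> 0"
        then have mv: "move S a b p q (s2 ''e'' 0) (s2 ''f'' 0)" using move by simp
        let ?m = "ms @ [(p, q)]"
        let ?t = "s2(''a'' := (s2 ''a'')(0 := s2 ''e'' 0), ''b'' := (s2 ''b'')(0 := s2 ''f'' 0),
          ''ru'' := (s2 ''ru'')(length ms := p), ''rw'' := (s2 ''rw'')(length ms := q),
          ''al'' := (s2 ''al'')(q := 0), ''kk'' := (s2 ''kk'')(0 := Suc (length ms)),
          ''d'' := (s2 ''d'')(0 := 1))"
        have kk: "s2 ''kk'' 0 = length ms" using w2 by (simp add: work_def)
        have "work n ?m (S - {q}) (s2 ''e'' 0) (s2 ''f'' 0) ?t"
          unfolding work_def
        proof (intro conjI)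
          show "env n ?t" using w2 by (simp add: work_def env_def)
          show "stores ?t ?m" using w2 by (auto simp: work_def stores_def nth_append less_Suc_eq)
          show "\<forall>x<n. ?t ''al'' x \<noteq> 0 \<longleftrightarrow> x \<in> S - {q}" using w2 by (simp add: work_def)
          show "reach n ?m (S - {q}) (s2 ''e'' 0) (s2 ''f'' 0)" by (rule reach_move[OF reach mv])
        qed simp_all
        then have Q: "?Q ?t" using mv by auto
        show "runs (block [assign ''a'' (var ''e''), assign ''b'' (var ''f''),
            Write ''ru'' (var ''kk'') (var ''p''), Write ''rw'' (var ''kk'') (var ''q''),
            Write ''al'' (var ''q'') (Num 0), assign ''kk'' (Plus (var ''kk'') (Num 1)),
            assign ''d'' (Num 1)]) s2 (1 + (1 + (1 + (1 + (1 + (1 + (1 + 1)))))))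
            (\<lambda>t. runs (block []) t 1 ?Q)"
          by (intro runs_block runs_assign runs_write) (use Q kk pq2 in simp)
      next
        assume "aval (Minus (Num 2) (var ''c'')) s2 = 0"
        then have "?Q s2" using no_move w2 d2 by simp
        then show "runs Skip s2 1 (\<lambda>t. runs (block []) t 1 ?Q)"
          by (intro runs_skip runs_block(1))
      qed simp
    qed
  qed
  then show ?thesis by (rule runs_time) (simp add: time_try_def)
qed

end

text \<open>The vertex \<open>q\<close> is the one removed and must lie off the red edge, as in
  \<open>good_safe_move\<close>. The flag \<open>d\<close> ends the scan after the first
  success.\<close>

definition pick_exp :: aexp where
  "pick_exp = b_and (b_eq (var ''d'') (Num 0))
     (b_and (b_and (Read ''al'' (var ''p'')) (Read ''al'' (var ''q'')))
       (b_and (b_neq (var ''p'') (var ''q''))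
         (b_and (b_neq (var ''q'') (var ''a'')) (b_neq (var ''q'') (var ''b'')))))"

definition pick :: com where "pick = Cond pick_exp try_move Skip"

text \<open>One step of the greedy completion: contracting the red edge itself is only tried when
  nothing else works, since every other contraction leaves an induced subtrigraph.\<close>

definition step :: com where
  "step = block [assign ''d'' (Num 0), For ''p'' (var ''n'') (For ''q'' (var ''n'') pick),
     Cond (b_eq (var ''d'') (Num 0))
       (block [assign ''p'' (var ''a''), assign ''q'' (var ''b''), try_move]) Skip]"

definition greedy :: com where
  "greedy = For ''g'' (var ''n'') (Cond (b_neq (var ''a'') (var ''b'')) step Skip)"

lemma writes_step [simp]:
  "writes pick = {''c'', ''e'', ''f'', ''x'', ''a'', ''b'', ''ru'', ''rw'', ''al'', ''kk'', ''d''}"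
  "writes step = {''c'', ''e'', ''f'', ''x'', ''a'', ''b'', ''ru'', ''rw'', ''al'', ''kk'', ''d'', ''p'', ''q''}"
  "writes greedy = {''c'', ''e'', ''f'', ''x'', ''a'', ''b'', ''ru'', ''rw'', ''al'', ''kk'', ''d'', ''p'', ''q'', ''g''}"
  by (auto simp: pick_def step_def greedy_def simp del: block.simps)

definition time_step :: "nat \<Rightarrow> nat" where
  "time_step n = n * (n * (time_try n + 4) + 4) + time_try n + 20"

definition time_greedy :: "nat \<Rightarrow> nat" where
  "time_greedy n = n * (time_step n + 4) + 2"

section \<open>Correctness of the greedy completion\<close>

context adjacency
begin

text \<open>Goodness enters as an implication because the scan also runs on states that are not
  good, where only the legality of the moves is guaranteed.\<close>

definition scanned :: "nat \<Rightarrow> (nat \<times> nat) list \<Rightarrow> nat set \<Rightarrow> nat \<Rightarrow> nat \<Rightarrow> (nat \<times> nat) set \<Rightarrow> state \<Rightarrow> bool" where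
  "scanned n ms S a b A t \<longleftrightarrow>
     (work n ms S a b t \<and> t ''d'' 0 = 0 \<and>
       (\<forall>x y. (x, y) \<in> A \<longrightarrow> y \<notin> {a, b} \<longrightarrow> (\<forall>a' b'. \<not> move S a b x y a' b'))) \<or>
     (\<exists>m S' a' b'. work n (ms @ [m]) S' a' b' t \<and> t ''d'' 0 = 1 \<and> (good S a b \<longrightarrow> good S' a' b'))"

lemma work_reach: "work n ms S a b s \<Longrightarrow> reach n ms S a b"
  by (simp add: work_def)

lemma scanned_cong:
  assumes "scanned n ms S a b A s"
    and "t ''n'' = s ''n''" "t ''row'' = s ''row''" "t ''adj'' = s ''adj''" "t ''kk'' = s ''kk''"
    and "t ''ru'' = s ''ru''" "t ''rw'' = s ''rw''" "t ''al'' = s ''al''" "t ''a'' = s ''a''" "t ''b'' = s ''b''"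
    and "t ''d'' = s ''d''"
  shows "scanned n ms S a b A t"
proof -
  have "work n ms' S' a' b' t \<longleftrightarrow> work n ms' S' a' b' s" for ms' S' a' b'
    using work_cong[of n ms' S' a' b' s t] work_cong[of n ms' S' a' b' t s] assms(2-10) by auto
  then show ?thesis using assms(1,11) unfolding scanned_def by simp
qed

lemma runs_pick:
  assumes sc: "scanned n ms S a b A s" and pq: "s ''p'' 0 = p" "s ''q'' 0 = q" "p < n" "q < n"
    and ab: "a \<noteq> b"
  shows "runs pick s (time_try n + 1 + 1) (scanned n ms S a b (insert (p, q) A))"
  unfolding pick_def
proof (rule runs_cond)
  assume pick: "aval pick_exp s \<noteq> 0"
  then have "s ''d'' 0 = 0" by (simp add: pick_exp_def)
  then have w: "work n ms S a b s"
    and none: "\<forall>x y. (x, y) \<in> A \<longrightarrow> y \<notin> {a, b} \<longrightarrow> (\<forall>a' b'. \<not> move S a b x y a' b')"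
    using sc unfolding scanned_def by auto
  have S: "p \<in> S" "q \<in> S" "p \<noteq> q" and q: "q \<notin> {a, b}"
    using pick w pq by (auto simp: pick_exp_def work_def)
  have valid: "valid_pair S a b" by (rule reach_valid[OF work_reach[OF w]])
  show "runs try_move s (time_try n) (scanned n ms S a b (insert (p, q) A))"
  proof (rule runs_use[OF runs_try_move[OF w pq(1,2) S]])
    fix t assume "(\<exists>a' b'. move S a b p q a' b' \<and> work n (ms @ [(p, q)]) (S - {q}) a' b' t \<and> t ''d'' 0 = 1) \<or>
      (\<forall>a' b'. \<not> move S a b p q a' b') \<and> work n ms S a b t \<and> t ''d'' = s ''d''"
    then show "scanned n ms S a b (insert (p, q) A) t"
    proof
      assume "\<exists>a' b'. move S a b p q a' b' \<and> work n (ms @ [(p, q)]) (S - {q}) a' b' t \<and> t ''d'' 0 = 1"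
      then obtain a' b' where *: "move S a b p q a' b'" "work n (ms @ [(p, q)]) (S - {q}) a' b' t" "t ''d'' 0 = 1"
        by (elim exE conjE)
      have "good S a b \<longrightarrow> good (S - {q}) a' b'"
        using good_safe_move[OF _ ab valid *(1) q] by blast
      then show ?thesis unfolding scanned_def using *(2,3) by blast
    next
      assume *: "(\<forall>a' b'. \<not> move S a b p q a' b') \<and> work n ms S a b t \<and> t ''d'' = s ''d''"
      then have "t ''d'' 0 = 0" using \<open>s ''d'' 0 = 0\<close> by simp
      then show ?thesis unfolding scanned_def using * none by simp
    qed
  qed
next
  assume pick: "aval pick_exp s = 0"
  from sc have "scanned n ms S a b (insert (p, q) A) s"
  proof (unfold scanned_def, elim disjE)
    assume *: "work n ms S a b s \<and> s ''d'' 0 = 0 \<and>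
       (\<forall>x y. (x, y) \<in> A \<longrightarrow> y \<notin> {a, b} \<longrightarrow> (\<forall>a' b'. \<not> move S a b x y a' b'))"
    have "\<not> move S a b p q a' b'" if "q \<notin> {a, b}" for a' b'
      using pick * pq that by (auto simp: pick_exp_def work_def move_def)
    then show "(work n ms S a b s \<and> s ''d'' 0 = 0 \<and>
       (\<forall>x y. (x, y) \<in> insert (p, q) A \<longrightarrow> y \<notin> {a, b} \<longrightarrow> (\<forall>a' b'. \<not> move S a b x y a' b'))) \<or>
       (\<exists>m S' a' b'. work n (ms @ [m]) S' a' b' s \<and> s ''d'' 0 = 1 \<and> (good S a b \<longrightarrow> good S' a' b'))"
      using * by simp
  qed (rule disjI2)
  then show "runs Skip s 1 (scanned n ms S a b (insert (p, q) A))"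
    by (rule runs_skip[where Q = "scanned n ms S a b (insert (p, q) A)" and s = s])
qed

lemma runs_scan_pairs:
  assumes sc: "scanned n ms S a b {} s" and ab: "a \<noteq> b" and n: "s ''n'' 0 = n"
  shows "runs (For ''p'' (var ''n'') (For ''q'' (var ''n'') pick)) s (n * (n * (time_try n + 4) + 4) + 2)
    (scanned n ms S a b ({..<n} \<times> {..<n}))"
proof -
  have "runs (For ''p'' (var ''n'') (For ''q'' (var ''n'') pick)) s
      (n * ((n * ((time_try n + 1 + 1) + 2) + 2) + 2) + 2)
      (scanned n ms S a b ({..<n} \<times> {..<n}))"
  proof (rule runs_for[where I = "\<lambda>j. scanned n ms S a b ({..<j} \<times> {..<n})"])
    show "scanned n ms S a b ({..<0} \<times> {..<n}) s" using sc by simp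
    show "scanned n ms S a b ({..<j} \<times> {..<n}) (t(''p'' := v))"
      if "scanned n ms S a b ({..<j} \<times> {..<n}) t" for j t v
      by (rule scanned_cong[OF that]) simp_all
    show "aval (var ''n'') t = n"
      if "\<forall>x. x \<notin> insert ''p'' (writes (For ''q'' (var ''n'') pick)) \<longrightarrow> t x = s x" for t
      using that n by simp
    show "''p'' \<notin> writes (For ''q'' (var ''n'') pick)" by simp
    fix j t assume j: "j < n" and t: "scanned n ms S a b ({..<j} \<times> {..<n}) t" "t ''p'' 0 = j"
      and fr: "\<forall>x. x \<notin> insert ''p'' (writes (For ''q'' (var ''n'') pick)) \<longrightarrow> t x = s x"
    let ?A = "\<lambda>i. {..<j} \<times> {..<n} \<union> {j} \<times> {..<i}"
    have "runs (For ''q'' (var ''n'') pick) t (n * ((time_try n + 1 + 1) + 2) + 2)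
      (scanned n ms S a b (?A n))"
    proof (rule runs_for[where I = "\<lambda>i. scanned n ms S a b (?A i)"])
      show "scanned n ms S a b (?A 0) t" using t by simp
      show "scanned n ms S a b (?A i) (u(''q'' := v))"
        if "scanned n ms S a b (?A i) u" for i u v
        by (rule scanned_cong[OF that]) simp_all
      show "aval (var ''n'') u = n"
        if "\<forall>x. x \<notin> insert ''q'' (writes pick) \<longrightarrow> u x = t x" for u
        using that fr n by simp
      show "''q'' \<notin> writes pick" by simp
      fix i u assume i: "i < n" and u: "scanned n ms S a b (?A i) u" "u ''q'' 0 = i"
        and fr': "\<forall>x. x \<notin> insert ''q'' (writes pick) \<longrightarrow> u x = t x"
      have up: "u ''p'' 0 = j" using fr' t(2) by simp
      have eq: "insert (j, i) (?A i) = ?A (Suc i)" by auto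
      show "runs pick u (time_try n + 1 + 1) (scanned n ms S a b (?A (Suc i)))"
        using runs_pick[OF u(1) up u(2) j i ab] unfolding eq .
    qed
    moreover have "?A n = {..<Suc j} \<times> {..<n}" by auto
    ultimately show "runs (For ''q'' (var ''n'') pick) t (n * ((time_try n + 1 + 1) + 2) + 2)
      (scanned n ms S a b ({..<Suc j} \<times> {..<n}))" by simp
  qed
  then show ?thesis by (rule runs_time) (simp add: algebra_simps)
qed

text \<open>If the scan finds nothing, \<open>good_forced_move\<close> leaves only the contraction
  of the red edge. If that fails too, the state was not good, and \<open>xs = []\<close> records
  that nothing happened.\<close>

lemma runs_step:
  assumes w: "work n ms S a b s" and ab: "a \<noteq> b"
  shows "runs step s (time_step n) (\<lambda>t. \<exists>xs S' a' b'. work n (ms @ xs) S' a' b' t \<and>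
    (good S a b \<longrightarrow> length xs = 1 \<and> good S' a' b'))" (is "runs _ _ _ ?Q")
proof -
  have reach: "reach n ms S a b" and n: "s ''n'' 0 = n" using w by (simp_all add: work_def env_def)
  have valid: "valid_pair S a b" by (rule reach_valid[OF reach])
  then have S: "a \<in> S" "b \<in> S" using ab by (simp_all add: valid_pair_def)
  let ?s0 = "s(''d'' := (s ''d'')(0 := 0))"
  have w0: "work n ms S a b ?s0" by (rule work_cong[OF w]) simp_all
  have sc0: "scanned n ms S a b {} ?s0" using w0 by (simp add: scanned_def)
  have n0: "?s0 ''n'' 0 = n" using n by simp
  have one: "?Q t" if "work n (ms @ [m]) S' a' b' t" "good S a b \<longrightarrow> good S' a' b'" for m S' a' b' t
    using that by (intro exI[of _ "[m]"] exI[of _ S'] exI[of _ a'] exI[of _ b']) simp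
  have "runs step s (1 + ((n * (n * (time_try n + 4) + 4) + 2) + (((1 + (1 + (time_try n + 1))) + 1 + 1) + 1))) ?Q"
    unfolding step_def
  proof (rule runs_block(2), rule runs_assign, simp only: aval.simps(1),
      rule runs_block(2), rule runs_use[OF runs_scan_pairs[OF sc0 ab n0]])
    fix t assume sc: "scanned n ms S a b ({..<n} \<times> {..<n}) t"
    show "runs (block [Cond (b_eq (var ''d'') (Num 0))
       (block [assign ''p'' (var ''a''), assign ''q'' (var ''b''), try_move]) Skip]) t
       (((1 + (1 + (time_try n + 1))) + 1 + 1) + 1) ?Q"
    proof (rule runs_block(2), rule runs_cond)
      assume "aval (b_eq (var ''d'') (Num 0)) t = 0"
      then have "t ''d'' 0 \<noteq> 0" by simp
      then obtain m S' a' b' where *: "work n (ms @ [m]) S' a' b' t" "good S a b \<longrightarrow> good S' a' b'"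
        using sc unfolding scanned_def by auto
      then have "?Q t" by (rule one)
      then show "runs Skip t 1 (\<lambda>t. runs (block []) t 1 ?Q)" by (intro runs_skip runs_block(1))
    next
      assume "aval (b_eq (var ''d'') (Num 0)) t \<noteq> 0"
      then have "t ''d'' 0 = 0" by simp
      then have wt: "work n ms S a b t"
        and none: "\<And>x y a' b'. x < n \<Longrightarrow> y < n \<Longrightarrow> y \<notin> {a, b} \<Longrightarrow> \<not> move S a b x y a' b'"
        using sc unfolding scanned_def by auto
      have Sn: "S \<subseteq> {..<n}" using reach_verts[OF reach] by blast
      have none': "\<not> move S a b x y a' b'" if "y \<notin> {a, b}" for x y a' b'
        using none[of x y a' b'] that Sn unfolding move_def by blast
      let ?t = "t(''p'' := (t ''p'')(0 := a), ''q'' := (t ''q'')(0 := b))"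
      have w2: "work n ms S a b ?t" by (rule work_cong[OF wt]) simp_all
      have pq: "?t ''p'' 0 = a" "?t ''q'' 0 = b" by simp_all
      have tab: "t ''a'' 0 = a" "t ''b'' 0 = b" using wt by (simp_all add: work_def)
      have "runs try_move ?t (time_try n) ?Q"
      proof (rule runs_use[OF runs_try_move[OF w2 pq S ab]])
        fix u assume "(\<exists>a' b'. move S a b a b a' b' \<and> work n (ms @ [(a, b)]) (S - {b}) a' b' u \<and> u ''d'' 0 = 1) \<or>
          (\<forall>a' b'. \<not> move S a b a b a' b') \<and> work n ms S a b u \<and> u ''d'' = ?t ''d''"
        then show "?Q u"
        proof
          assume "\<exists>a' b'. move S a b a b a' b' \<and> work n (ms @ [(a, b)]) (S - {b}) a' b' u \<and> u ''d'' 0 = 1"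
          then obtain a' b' where *: "move S a b a b a' b'" "work n (ms @ [(a, b)]) (S - {b}) a' b' u"
            by (elim exE conjE)
          have "good S a b \<longrightarrow> good (S - {b}) a' b'"
            using good_forced_move(2)[OF _ ab valid none' *(1)] by blast
          then show ?thesis by (rule one[OF *(2)])
        next
          assume *: "(\<forall>a' b'. \<not> move S a b a b a' b') \<and> work n ms S a b u \<and> u ''d'' = ?t ''d''"
          then have "\<not> good S a b"
            using good_forced_move(1)[OF _ ab valid none'] by blast
          then show ?thesis
            using * by (intro exI[of _ "[]"] exI[of _ S] exI[of _ a] exI[of _ b]) simp
        qed
      qed
      then have "runs try_move ?t (time_try n) (\<lambda>u. runs (block []) u 1 (\<lambda>t. runs (block []) t 1 ?Q))"
        by (rule runs_mono[OF _ order_refl]) (intro runs_block(1))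
      then show "runs (block [assign ''p'' (var ''a''), assign ''q'' (var ''b''), try_move]) t
          (1 + (1 + (time_try n + 1))) (\<lambda>t. runs (block []) t 1 ?Q)"
        using tab by (intro runs_block(2) runs_assign) simp
    qed
  qed
  then show ?thesis by (rule runs_time) (simp add: time_step_def)
qed

lemma runs_greedy:
  assumes w: "work n ms S a b s" and n: "n \<ge> 1"
  shows "runs greedy s (time_greedy n) (\<lambda>t. \<exists>xs S' a' b'. work n (ms @ xs) S' a' b' t \<and>
    (good S a b \<longrightarrow> a' = b'))"
proof -
  define I where "I j t \<longleftrightarrow> (\<exists>xs S' a' b'. work n (ms @ xs) S' a' b' t \<and>
    (good S a b \<longrightarrow> good S' a' b' \<and> (a' = b' \<or> length xs \<ge> j)))" for j t
  have body: "runs (Cond (b_neq (var ''a'') (var ''b'')) step Skip) t (time_step n + 1 + 1) (I (Suc j))"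
    if inv: "I j t" for j t
  proof -
    obtain xs S' a' b' where wt: "work n (ms @ xs) S' a' b' t"
      and gd: "good S a b \<longrightarrow> good S' a' b' \<and> (a' = b' \<or> length xs \<ge> j)"
      using inv unfolding I_def by (elim exE conjE)
    have ab: "t ''a'' 0 = a'" "t ''b'' 0 = b'" using wt by (simp_all add: work_def)
    have then_branch: "runs step t (time_step n) (I (Suc j))" if "a' \<noteq> b'"
    proof (rule runs_mono[OF runs_step[OF wt that] order_refl])
      fix u assume "\<exists>ys S'' a'' b''. work n ((ms @ xs) @ ys) S'' a'' b'' u \<and>
        (good S' a' b' \<longrightarrow> length ys = 1 \<and> good S'' a'' b'')"
      then obtain ys S'' a'' b'' where *: "work n ((ms @ xs) @ ys) S'' a'' b'' u"
        "good S' a' b' \<longrightarrow> length ys = 1 \<and> good S'' a'' b''" by (elim exE conjE)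
      have "work n (ms @ (xs @ ys)) S'' a'' b'' u" using *(1) by simp
      moreover have "good S a b \<longrightarrow> good S'' a'' b'' \<and> (a'' = b'' \<or> length (xs @ ys) \<ge> Suc j)"
        using *(2) gd that by auto
      ultimately show "I (Suc j) u" unfolding I_def by blast
    qed
    have else_branch: "runs Skip t 1 (I (Suc j))" if "a' = b'"
    proof -
      have "I (Suc j) t" unfolding I_def using wt gd that by blast
      then show ?thesis by (rule runs_skip[where Q = "I (Suc j)" and s = t])
    qed
    show ?thesis
    proof (rule runs_cond)
      show "runs step t (time_step n) (I (Suc j))" if "aval (b_neq (var ''a'') (var ''b'')) t \<noteq> 0"
        by (rule then_branch) (use that ab in simp)
      show "runs Skip t 1 (I (Suc j))" if "aval (b_neq (var ''a'') (var ''b'')) t = 0"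
        by (rule else_branch) (use that ab in simp)
    qed
  qed
  have "runs greedy s (n * ((time_step n + 1 + 1) + 2) + 2) (I n)"
    unfolding greedy_def
  proof (rule runs_for[where I = I])
    show "I 0 s" unfolding I_def using w
      by (intro exI[of _ "[]"] exI[of _ S] exI[of _ a] exI[of _ b]) simp
    show "I j (t(''g'' := v))" if inv: "I j t" for j t v
    proof -
      obtain xs S' a' b' where wt: "work n (ms @ xs) S' a' b' t"
        and gd: "good S a b \<longrightarrow> good S' a' b' \<and> (a' = b' \<or> length xs \<ge> j)"
        using inv unfolding I_def by (elim exE conjE)
      have "work n (ms @ xs) S' a' b' (t(''g'' := v))" by (rule work_cong[OF wt]) simp_all
      then show ?thesis unfolding I_def using gd
        by (intro exI[of _ xs] exI[of _ S'] exI[of _ a'] exI[of _ b']) simp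
    qed
    show "aval (var ''n'') t = n"
      if "\<forall>x. x \<notin> insert ''g'' (writes (Cond (b_neq (var ''a'') (var ''b'')) step Skip)) \<longrightarrow> t x = s x" for t
      using that w by (simp add: work_def env_def)
    show "''g'' \<notin> writes (Cond (b_neq (var ''a'') (var ''b'')) step Skip)" by simp
    show "runs (Cond (b_neq (var ''a'') (var ''b'')) step Skip) t (time_step n + 1 + 1) (I (Suc j))"
      if "I j t" for j t by (rule body[OF that])
  qed
  moreover have "(time_step n + 1 + 1) + 2 = time_step n + 4" by simp
  ultimately have "runs greedy s (time_greedy n) (I n)" by (simp only: time_greedy_def)
  then show ?thesis
  proof (rule runs_mono[OF _ order_refl])
    fix t assume "I n t"
    then obtain xs S' a' b' where wt: "work n (ms @ xs) S' a' b' t"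
      and gd: "good S a b \<longrightarrow> good S' a' b' \<and> (a' = b' \<or> length xs \<ge> n)"
      unfolding I_def by (elim exE conjE)
    have reach: "reach n (ms @ xs) S' a' b'" using wt by (simp add: work_def)
    \<comment> \<open>Every move removes one vertex, so \<open>n\<close> moves would leave none,
      whereas a red edge has its ends in \<open>S'\<close>.\<close>
    have "a' = b'" if "length xs \<ge> n"
    proof (rule ccontr)
      assume "a' \<noteq> b'"
      then have "a' \<in> S'" using reach_valid[OF reach] by (simp add: valid_pair_def)
      then have "card S' > 0" using reach_card[OF reach] card_gt_0_iff by blast
      then show False using reach_card[OF reach] that by simp
    qed
    then show "\<exists>xs S' a' b'. work n (ms @ xs) S' a' b' t \<and> (good S a b \<longrightarrow> a' = b')"
      using wt gd by (intro exI[of _ xs] exI[of _ S'] exI[of _ a'] exI[of _ b']) blast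
  qed
qed

end

text \<open>The representatives are rebuilt from the first \<open>k\<close> stored moves, which
  undoes a failed trial. These entries are intact, since a trial writes its moves from position
  \<open>k\<close> on.\<close>

definition reset :: com where
  "reset = block [For ''x'' (var ''n'') (Write ''al'' (var ''x'') (Num 1)),
     For ''i'' (var ''k'') (Write ''al'' (Read ''rw'' (var ''i'')) (Num 0)),
     assign ''a'' (Num 0), assign ''b'' (Num 0), assign ''kk'' (var ''k'')]"

definition first_exp :: aexp where
  "first_exp = b_and (b_and (Read ''al'' (var ''p'')) (Read ''al'' (var ''q''))) (b_neq (var ''p'') (var ''q''))"

text \<open>\<open>trial\<close> starts from the first \<open>k\<close> moves, after which there is no red edge, contracts \<open>u\<close>
  and \<open>v\<close>, completes greedily, and keeps the new moves if the red edge disappears.\<close>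

definition trial :: com where
  "trial = block [reset, assign ''p'' (var ''u''), assign ''q'' (var ''v''),
     Cond first_exp try_move Skip, greedy,
     Cond (b_eq (var ''a'') (var ''b'')) (assign ''k'' (var ''kk'')) Skip]"

definition search :: com where
  "search = For ''h'' (var ''n'') (For ''u'' (var ''n'') (For ''v'' (var ''n'') trial))"

definition fill_rows :: com where
  "fill_rows = For ''x'' (var ''n'')
     (Write ''row'' (Plus (var ''x'') (Num 1)) (Plus (Read ''row'' (var ''x'')) (var ''n'')))"

text \<open>Both names are read before the survivor receives its new one, since the contraction has
  to mention the old names.\<close>

definition rename_body :: com where
  "rename_body = block [Write ''fst'' (var ''i'') (Read ''nm'' (Read ''ru'' (var ''i''))),
     Write ''snd'' (var ''i'') (Read ''nm'' (Read ''rw'' (var ''i''))),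
     Write ''nm'' (Read ''ru'' (var ''i'')) (Plus (var ''n'') (var ''i''))]"

definition rename :: com where
  "rename = block [For ''x'' (var ''n'') (Write ''nm'' (var ''x'') (var ''x'')),
     For ''i'' (var ''k'') rename_body]"

definition main_program :: com where
  "main_program = block [fill_rows, search, rename,
     Cond (b_eq (Plus (var ''k'') (Num 1)) (var ''n'')) (assign ''out'' (Num 1)) (assign ''out'' (Num 0))]"

lemma writes_trial [simp]:
  "writes reset = {''al'', ''x'', ''i'', ''a'', ''b'', ''kk''}"
  "writes trial = {''c'', ''e'', ''f'', ''x'', ''i'', ''a'', ''b'', ''ru'', ''rw'', ''al'', ''kk'', ''d'', ''p'', ''q'', ''g'', ''k''}"
  "writes rename_body = {''fst'', ''snd'', ''nm''}"
  "writes rename = {''fst'', ''snd'', ''nm'', ''x'', ''i''}"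
  by (auto simp: reset_def trial_def rename_body_def rename_def simp del: block.simps)

definition time_trial :: "nat \<Rightarrow> nat" where
  "time_trial n = 6 * n + time_try n + time_greedy n + 40"

definition time_search :: "nat \<Rightarrow> nat" where
  "time_search n = n * ((n * ((n * (time_trial n + 2) + 2) + 2) + 2) + 2) + 2"

definition time_main :: "nat \<Rightarrow> nat" where
  "time_main n = 20 * n + time_search n + 40"

section \<open>Correctness of the search and of the output\<close>

context adjacency
begin

definition committed :: "nat \<Rightarrow> (nat \<times> nat) list \<Rightarrow> state \<Rightarrow> bool" where
  "committed n ms s \<longleftrightarrow> env n s \<and> s ''k'' 0 = length ms \<and> stores s ms \<and> (\<exists>S. reach n ms S 0 0)"

definition promising :: "nat \<Rightarrow> (nat \<times> nat) list \<Rightarrow> nat \<Rightarrow> nat \<Rightarrow> bool" where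
  "promising n ms u v \<longleftrightarrow>
     (\<exists>S a b. reach n ms S 0 0 \<and> move S 0 0 u v a b \<and> good (S - {v}) a b)"

lemma committed_cong:
  assumes "committed n ms s"
    and "t ''n'' = s ''n''" "t ''row'' = s ''row''" "t ''adj'' = s ''adj''" "t ''k'' = s ''k''"
    and "t ''ru'' = s ''ru''" "t ''rw'' = s ''rw''"
  shows "committed n ms t"
  using assms env_cong[of n s t] by (simp add: committed_def stores_def)

lemma stores_append: "stores s (ms @ xs) \<Longrightarrow> stores s ms"
  unfolding stores_def
proof (intro allI impI)
  fix i assume *: "\<forall>i<length (ms @ xs). s ''ru'' i = fst ((ms @ xs) ! i) \<and> s ''rw'' i = snd ((ms @ xs) ! i)"
    and "i < length ms"
  then show "s ''ru'' i = fst (ms ! i) \<and> s ''rw'' i = snd (ms ! i)"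
    using *[rule_format, of i] by (simp add: nth_append)
qed

lemma runs_reset:
  assumes com: "committed n ms s" and reach: "reach n ms S 0 0"
  shows "runs reset s (6 * n + 20) (work n ms S 0 0)"
proof -
  have env: "env n s" and k: "s ''k'' 0 = length ms" and st: "stores s ms"
    using com by (simp_all add: committed_def)
  have n: "s ''n'' 0 = n" using env by (simp add: env_def)
  have le: "length ms \<le> n" using reach_card[OF reach] by simp
  let ?w1 = "Write ''al'' (var ''x'') (Num 1)" and ?w2 = "Write ''al'' (Read ''rw'' (var ''i'')) (Num 0)"
  have loop1: "runs (For ''x'' (var ''n'') ?w1) s (n * (1 + 2) + 2) (\<lambda>t. \<forall>x<n. t ''al'' x \<noteq> 0)"
  proof (rule runs_for[where I = "\<lambda>j t. \<forall>x<j. t ''al'' x \<noteq> 0"])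
    show "aval (var ''n'') t = n" if "\<forall>x. x \<notin> insert ''x'' (writes ?w1) \<longrightarrow> t x = s x" for t
      using that n by simp
    show "runs ?w1 t 1 (\<lambda>t. \<forall>x<Suc j. t ''al'' x \<noteq> 0)"
      if "\<forall>x<j. t ''al'' x \<noteq> 0" "t ''x'' 0 = j" for j t
      by (rule runs_write) (use that in \<open>simp add: less_Suc_eq\<close>)
  qed simp_all
  have loop2: "runs (For ''i'' (var ''k'') ?w2) s1 (length ms * (1 + 2) + 2)
      (\<lambda>t. \<forall>x<n. t ''al'' x \<noteq> 0 \<longleftrightarrow> x \<notin> snd ` set (take (length ms) ms))"
    if al: "\<forall>x<n. s1 ''al'' x \<noteq> 0" and fr: "\<forall>x. x \<notin> insert ''x'' (writes ?w1) \<longrightarrow> s1 x = s x" for s1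
  proof (rule runs_for[where I = "\<lambda>j t. \<forall>x<n. t ''al'' x \<noteq> 0 \<longleftrightarrow> x \<notin> snd ` set (take j ms)"])
    show "\<forall>x<n. s1 ''al'' x \<noteq> 0 \<longleftrightarrow> x \<notin> snd ` set (take 0 ms)" using al by simp
    show "aval (var ''k'') t = length ms" if "\<forall>x. x \<notin> insert ''i'' (writes ?w2) \<longrightarrow> t x = s1 x" for t
      using that fr k by simp
    fix j t assume j: "j < length ms" and t: "\<forall>x<n. t ''al'' x \<noteq> 0 \<longleftrightarrow> x \<notin> snd ` set (take j ms)"
      "t ''i'' 0 = j" and fr': "\<forall>x. x \<notin> insert ''i'' (writes ?w2) \<longrightarrow> t x = s1 x"
    have "t ''rw'' j = snd (ms ! j)" using fr' fr st j by (simp add: stores_def)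
    then show "runs ?w2 t 1 (\<lambda>t. \<forall>x<n. t ''al'' x \<noteq> 0 \<longleftrightarrow> x \<notin> snd ` set (take (Suc j) ms))"
      by (intro runs_write) (use t j in \<open>simp add: take_Suc_conv_app_nth\<close>)
  qed simp_all
  have "runs reset s ((n * (1 + 2) + 2) + ((length ms * (1 + 2) + 2) + (1 + (1 + (1 + 1))))) (work n ms S 0 0)"
    unfolding reset_def
  proof (rule runs_block(2), rule runs_use[OF loop1], rule runs_block(2), rule runs_use[OF loop2])
    fix s1 s2 :: state
    assume al: "\<forall>x<n. s2 ''al'' x \<noteq> 0 \<longleftrightarrow> x \<notin> snd ` set (take (length ms) ms)"
      and fr1: "\<forall>x. x \<notin> writes (For ''x'' (var ''n'') ?w1) \<longrightarrow> s1 x = s x"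
      and fr2: "\<forall>x. x \<notin> writes (For ''i'' (var ''k'') ?w2) \<longrightarrow> s2 x = s1 x"
    let ?t = "s2(''a'' := (s2 ''a'')(0 := 0), ''b'' := (s2 ''b'')(0 := 0), ''kk'' := (s2 ''kk'')(0 := length ms))"
    have "x \<in> S \<longleftrightarrow> x \<notin> snd ` set ms" if "x < n" for x
      using reach_verts[OF reach] that by blast
    then have "work n ms S 0 0 ?t"
      unfolding work_def using env st al reach fr1 fr2 by (simp add: env_def stores_def)
    moreover have "s2 ''k'' 0 = length ms" using k fr1 fr2 by simp
    ultimately show "runs (block [assign ''a'' (Num 0), assign ''b'' (Num 0), assign ''kk'' (var ''k'')]) s2
        (1 + (1 + (1 + 1))) (work n ms S 0 0)"
      by (intro runs_block runs_assign) simp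
  qed simp_all
  then show ?thesis by (rule runs_time) (use le in simp)
qed

text \<open>A promising pair leads to a good state, from which the greedy completion surely removes
  the red edge. For other pairs the completion may fail, but then the committed moves stay as they
  were.\<close>

lemma runs_trial:
  assumes com: "committed n ms s" and uv: "s ''u'' 0 = u" "s ''v'' 0 = v" "u < n" "v < n"
  shows "runs trial s (time_trial n) (\<lambda>t. \<exists>ms'. committed n ms' t \<and>
    (ms' = ms \<or> length ms < length ms') \<and> (promising n ms u v \<longrightarrow> length ms < length ms'))"
    (is "runs _ _ _ ?Q")
proof -
  obtain S where reach: "reach n ms S 0 0" using com by (auto simp: committed_def)
  have n: "n \<ge> 1" using uv(3) by simp
  \<comment> \<open>The representatives are determined by the moves through
    \<open>reach_verts\<close>.\<close>
  have prom: "promising n ms u v \<longleftrightarrow> (\<exists>a b. move S 0 0 u v a b \<and> good (S - {v}) a b)"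
    using reach reach_verts[OF reach] reach_verts[of n ms _ 0 0] unfolding promising_def by metis
  let ?R = "\<lambda>t. \<exists>xs S' a' b'. work n (ms @ xs) S' a' b' t \<and>
    (promising n ms u v \<longrightarrow> xs \<noteq> [] \<and> good S' a' b')"
  have first: "runs (Cond first_exp try_move Skip) t (time_try n + 1 + 1) ?R"
    if w: "work n ms S 0 0 t" and pq: "t ''p'' 0 = u" "t ''q'' 0 = v" for t
  proof (rule runs_cond)
    assume "aval first_exp t \<noteq> 0"
    then have uvS: "u \<in> S" "v \<in> S" "u \<noteq> v"
      using w pq uv(3,4) by (auto simp: first_exp_def work_def)
    show "runs try_move t (time_try n) ?R"
    proof (rule runs_use[OF runs_try_move[OF w pq uvS]])
      fix t' assume "(\<exists>a' b'. move S 0 0 u v a' b' \<and> work n (ms @ [(u, v)]) (S - {v}) a' b' t' \<and> t' ''d'' 0 = 1) \<or>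
        (\<forall>a' b'. \<not> move S 0 0 u v a' b') \<and> work n ms S 0 0 t' \<and> t' ''d'' = t ''d''"
      then show "?R t'"
      proof
        assume "\<exists>a' b'. move S 0 0 u v a' b' \<and> work n (ms @ [(u, v)]) (S - {v}) a' b' t' \<and> t' ''d'' 0 = 1"
        then obtain a' b' where *: "move S 0 0 u v a' b'" "work n (ms @ [(u, v)]) (S - {v}) a' b' t'"
          by (elim exE conjE)
        have "good (S - {v}) a' b'" if "promising n ms u v"
          using that good_move_unique[OF _ *(1)] unfolding prom by blast
        then show ?thesis using *(2)
          by (intro exI[of _ "[(u, v)]"] exI[of _ "S - {v}"] exI[of _ a'] exI[of _ b']) simp
      next
        assume *: "(\<forall>a' b'. \<not> move S 0 0 u v a' b') \<and> work n ms S 0 0 t' \<and> t' ''d'' = t ''d''"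
        then have "\<not> promising n ms u v" unfolding prom by blast
        then show ?thesis using *
          by (intro exI[of _ "[]"] exI[of _ S] exI[of _ 0]) simp
      qed
    qed
  next
    assume "aval first_exp t = 0"
    then have "\<not> move S 0 0 u v a' b'" for a' b'
      using w pq uv(3,4) by (auto simp: first_exp_def work_def move_def)
    then have "\<not> promising n ms u v" unfolding prom by blast
    then have "?R t" using w by (intro exI[of _ "[]"] exI[of _ S] exI[of _ 0]) simp
    then show "runs Skip t 1 ?R" by (rule runs_skip[where Q = ?R and s = t])
  qed
  let ?G = "\<lambda>t. \<exists>xs S' a' b'. work n (ms @ xs) S' a' b' t \<and>
    (promising n ms u v \<longrightarrow> xs \<noteq> [] \<and> a' = b')"
  have greedy: "runs greedy t (time_greedy n) ?G" if R: "?R t" for t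
  proof -
    obtain xs S' a' b' where w: "work n (ms @ xs) S' a' b' t"
      and good: "promising n ms u v \<longrightarrow> xs \<noteq> [] \<and> good S' a' b'" using R by (elim exE conjE)
    show ?thesis
    proof (rule runs_mono[OF runs_greedy[OF w n] order_refl])
      fix t' assume "\<exists>ys S'' a'' b''. work n ((ms @ xs) @ ys) S'' a'' b'' t' \<and> (good S' a' b' \<longrightarrow> a'' = b'')"
      then obtain ys S'' a'' b'' where *: "work n ((ms @ xs) @ ys) S'' a'' b'' t'" "good S' a' b' \<longrightarrow> a'' = b''"
        by (elim exE conjE)
      then show "?G t'" using good
        by (intro exI[of _ "xs @ ys"] exI[of _ S''] exI[of _ a''] exI[of _ b'']) simp
    qed
  qed
  have last: "runs (Cond (b_eq (var ''a'') (var ''b'')) (assign ''k'' (var ''kk'')) Skip) t (1 + 1 + 1) ?Q"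
    if G: "?G t" and k: "t ''k'' 0 = length ms" for t
  proof -
    obtain xs S' a' b' where w: "work n (ms @ xs) S' a' b' t"
      and prom': "promising n ms u v \<longrightarrow> xs \<noteq> [] \<and> a' = b'" using G by (elim exE conjE)
    have env: "env n t" and ab: "t ''a'' 0 = a'" "t ''b'' 0 = b'" and kk: "t ''kk'' 0 = length (ms @ xs)"
      and st: "stores t (ms @ xs)" and reach': "reach n (ms @ xs) S' a' b'"
      using w by (simp_all add: work_def)
    show ?thesis
    proof (rule runs_cond)
      assume "aval (b_eq (var ''a'') (var ''b'')) t \<noteq> 0"
      then have "a' = b'" using ab by simp
      then have r0: "reach n (ms @ xs) S' 0 0" using reach' reach_reset by blast
      let ?t = "t(''k'' := (t ''k'')(0 := length (ms @ xs)))"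
      have "committed n (ms @ xs) ?t"
        unfolding committed_def using env st r0 by (auto simp: env_def stores_def)
      moreover have "ms @ xs = ms \<or> length ms < length (ms @ xs)" by (cases xs) simp_all
      moreover have "promising n ms u v \<longrightarrow> length ms < length (ms @ xs)" using prom' by simp
      ultimately have "?Q ?t" by blast
      then show "runs (assign ''k'' (var ''kk'')) t 1 ?Q" using kk by (intro runs_assign) simp
    next
      assume "aval (b_eq (var ''a'') (var ''b'')) t = 0"
      then have "\<not> promising n ms u v" using prom' ab by simp
      \<comment> \<open>The abandoned moves lie beyond position \<open>k\<close> in
        \<open>ru\<close> and \<open>rw\<close>.\<close>
      moreover have "committed n ms t"
        unfolding committed_def using env k stores_append[OF st] reach by blast
      ultimately have "?Q t" by blast
      then show "runs Skip t 1 ?Q" by (rule runs_skip[where Q = ?Q and s = t])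
    qed
  qed
  have "runs trial s ((6 * n + 20) + (1 + (1 + ((time_try n + 1 + 1) + (time_greedy n + ((1 + 1 + 1) + 1)))))) ?Q"
    unfolding trial_def
  proof (rule runs_block(2), rule runs_use[OF runs_reset[OF com reach]],
      rule runs_block(2), rule runs_assign, rule runs_block(2), rule runs_assign)
    fix s1 assume w1: "work n ms S 0 0 s1" and fr1: "\<forall>x. x \<notin> writes reset \<longrightarrow> s1 x = s x"
    let ?s2 = "s1(''p'' := (s1 ''p'')(0 := u), ''q'' := (s1 ''q'')(0 := v))"
    have s2: "(s1(''p'' := (s1 ''p'')(0 := aval (var ''u'') s1)))
      (''q'' := ((s1(''p'' := (s1 ''p'')(0 := aval (var ''u'') s1))) ''q'')
        (0 := aval (var ''v'') (s1(''p'' := (s1 ''p'')(0 := aval (var ''u'') s1))))) = ?s2"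
      using uv fr1 by simp
    have w2: "work n ms S 0 0 ?s2" by (rule work_cong[OF w1]) simp_all
    have pq: "?s2 ''p'' 0 = u" "?s2 ''q'' 0 = v" by simp_all
    have k2: "?s2 ''k'' 0 = length ms" using fr1 com by (simp add: committed_def)
    have "runs (block [Cond first_exp try_move Skip, greedy,
        Cond (b_eq (var ''a'') (var ''b'')) (assign ''k'' (var ''kk'')) Skip]) ?s2
        ((time_try n + 1 + 1) + (time_greedy n + ((1 + 1 + 1) + 1))) ?Q"
    proof (rule runs_block(2), rule runs_use[OF first[OF w2 pq]])
      fix s3 assume R: "?R s3"
        and fr3: "\<forall>x. x \<notin> writes (Cond first_exp try_move Skip) \<longrightarrow> s3 x = ?s2 x"
      have k3: "s3 ''k'' 0 = length ms" using fr3 k2 by simp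
      show "runs (block [greedy, Cond (b_eq (var ''a'') (var ''b'')) (assign ''k'' (var ''kk'')) Skip]) s3
        (time_greedy n + ((1 + 1 + 1) + 1)) ?Q"
      proof (rule runs_block(2), rule runs_use[OF greedy[OF R]])
        fix s4 assume G: "?G s4" and fr4: "\<forall>x. x \<notin> writes greedy \<longrightarrow> s4 x = s3 x"
        have k4: "s4 ''k'' 0 = length ms" using fr4 k3 by simp
        show "runs (block [Cond (b_eq (var ''a'') (var ''b'')) (assign ''k'' (var ''kk'')) Skip]) s4
          ((1 + 1 + 1) + 1) ?Q"
          by (rule runs_block(2), rule runs_mono[OF last[OF G k4] order_refl], rule runs_block(1))
      qed
    qed
    then show "runs (block [Cond first_exp try_move Skip, greedy,
        Cond (b_eq (var ''a'') (var ''b'')) (assign ''k'' (var ''kk'')) Skip])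
        ((s1(''p'' := (s1 ''p'')(0 := aval (var ''u'') s1)))
      (''q'' := ((s1(''p'' := (s1 ''p'')(0 := aval (var ''u'') s1))) ''q'')
        (0 := aval (var ''v'') (s1(''p'' := (s1 ''p'')(0 := aval (var ''u'') s1))))))
        ((time_try n + 1 + 1) + (time_greedy n + ((1 + 1 + 1) + 1))) ?Q"
      unfolding s2 .
  qed
  then show ?thesis by (rule runs_time) (simp add: time_trial_def)
qed

text \<open>Once some trial extends the moves, later trials of the round work on the longer list.
  The round has made progress by then, so nothing more is claimed about \<open>ms\<close>.\<close>

definition tried :: "nat \<Rightarrow> (nat \<times> nat) list \<Rightarrow> (nat \<times> nat) set \<Rightarrow> state \<Rightarrow> bool" where
  "tried n ms A t \<longleftrightarrow> (\<exists>ms'. committed n ms' t \<and>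
     (ms' = ms \<and> (\<forall>x y. (x, y) \<in> A \<longrightarrow> \<not> promising n ms x y) \<or> length ms < length ms'))"

lemma tried_cong:
  assumes "tried n ms A s"
    and "t ''n'' = s ''n''" "t ''row'' = s ''row''" "t ''adj'' = s ''adj''" "t ''k'' = s ''k''"
    and "t ''ru'' = s ''ru''" "t ''rw'' = s ''rw''"
  shows "tried n ms A t"
proof -
  have "committed n ms' t" if "committed n ms' s" for ms'
    by (rule committed_cong[OF that assms(2-7)])
  then show ?thesis using assms(1) unfolding tried_def by blast
qed

lemma runs_tried_trial:
  assumes tr: "tried n ms A s" and uv: "s ''u'' 0 = u" "s ''v'' 0 = v" "u < n" "v < n"
  shows "runs trial s (time_trial n) (tried n ms (insert (u, v) A))"
proof -
  obtain ms' where com: "committed n ms' s"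
    and ms': "ms' = ms \<and> (\<forall>x y. (x, y) \<in> A \<longrightarrow> \<not> promising n ms x y) \<or> length ms < length ms'"
    using tr unfolding tried_def by blast
  show ?thesis
  proof (rule runs_mono[OF runs_trial[OF com uv] order_refl])
    fix t assume "\<exists>ms''. committed n ms'' t \<and> (ms'' = ms' \<or> length ms' < length ms'') \<and>
      (promising n ms' u v \<longrightarrow> length ms' < length ms'')"
    then obtain ms'' where "committed n ms'' t" "ms'' = ms' \<or> length ms' < length ms''"
      "promising n ms' u v \<longrightarrow> length ms' < length ms''" by (elim exE conjE)
    then show "tried n ms (insert (u, v) A) t"
      unfolding tried_def using ms' by (intro exI[of _ ms'']) auto
  qed
qed

lemma runs_round:
  assumes com: "committed n ms s"
  shows "runs (For ''u'' (var ''n'') (For ''v'' (var ''n'') trial)) s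
    (n * ((n * (time_trial n + 2) + 2) + 2) + 2) (tried n ms ({..<n} \<times> {..<n}))"
proof (rule runs_for[where I = "\<lambda>j. tried n ms ({..<j} \<times> {..<n})"])
  have n: "s ''n'' 0 = n" using com by (simp add: committed_def env_def)
  show "tried n ms ({..<0} \<times> {..<n}) s" using com by (simp add: tried_def) blast
  show "tried n ms ({..<j} \<times> {..<n}) (t(''u'' := w))"
    if "tried n ms ({..<j} \<times> {..<n}) t" for j t w
    by (rule tried_cong[OF that]) simp_all
  show "aval (var ''n'') t = n"
    if "\<forall>x. x \<notin> insert ''u'' (writes (For ''v'' (var ''n'') trial)) \<longrightarrow> t x = s x" for t
    using that n by simp
  show "''u'' \<notin> writes (For ''v'' (var ''n'') trial)" by simp
  fix j t assume j: "j < n" and t: "tried n ms ({..<j} \<times> {..<n}) t" "t ''u'' 0 = j"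
    and fr: "\<forall>x. x \<notin> insert ''u'' (writes (For ''v'' (var ''n'') trial)) \<longrightarrow> t x = s x"
  let ?A = "\<lambda>i. {..<j} \<times> {..<n} \<union> {j} \<times> {..<i}"
  have "runs (For ''v'' (var ''n'') trial) t (n * (time_trial n + 2) + 2) (tried n ms (?A n))"
  proof (rule runs_for[where I = "\<lambda>i. tried n ms (?A i)"])
    show "tried n ms (?A 0) t" using t by simp
    show "tried n ms (?A i) (w(''v'' := x))" if "tried n ms (?A i) w" for i w x
      by (rule tried_cong[OF that]) simp_all
    show "aval (var ''n'') w = n" if "\<forall>x. x \<notin> insert ''v'' (writes trial) \<longrightarrow> w x = t x" for w
      using that fr n by simp
    show "''v'' \<notin> writes trial" by simp
    fix i w assume i: "i < n" and w: "tried n ms (?A i) w" "w ''v'' 0 = i"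
      and fr': "\<forall>x. x \<notin> insert ''v'' (writes trial) \<longrightarrow> w x = t x"
    have wu: "w ''u'' 0 = j" using fr' t(2) by simp
    have eq: "insert (j, i) (?A i) = ?A (Suc i)" by auto
    show "runs trial w (time_trial n) (tried n ms (?A (Suc i)))"
      using runs_tried_trial[OF w(1) wu w(2) j i] unfolding eq .
  qed
  moreover have "?A n = {..<Suc j} \<times> {..<n}" by auto
  ultimately show "runs (For ''v'' (var ''n'') trial) t (n * (time_trial n + 2) + 2)
    (tried n ms ({..<Suc j} \<times> {..<n}))" by simp
qed

text \<open>Whatever has been committed, a state without red edge is an induced subgraph of the
  input and hence good, so it has a first move to a good state.\<close>

lemma good_imp_promising:
  assumes good: "good {..<n} 0 0" and reach: "reach n ms S 0 0" and len: "length ms < n - 1"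
  shows "\<exists>u v. u < n \<and> v < n \<and> promising n ms u v"
proof -
  have Sn: "S \<subseteq> {..<n}" using reach_verts[OF reach] by blast
  have "good S 0 0" by (rule good_subset[OF good Sn]) simp
  have fin: "finite S" and "\<not> card S \<le> Suc 0" using reach_card[OF reach] len by auto
  then obtain x y where xy: "x \<in> S" "y \<in> S" "x \<noteq> y" using card_le_Suc0_iff_eq[OF fin] by blast
  obtain p q where pq: "\<exists>a' b'. move S 0 0 p q a' b'" "\<And>a' b'. move S 0 0 p q a' b' \<Longrightarrow> good (S - {q}) a' b'"
    by (rule good_has_move[OF \<open>good S 0 0\<close> reach_valid[OF reach] xy]) iprover
  then obtain a b where mv: "move S 0 0 p q a b" by blast
  then have "p < n" "q < n" using Sn by (auto simp: move_def)
  then show ?thesis unfolding promising_def using reach mv pq(2)[OF mv] by blast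
qed

lemma runs_search:
  assumes com: "committed n [] s"
  shows "runs search s (time_search n) (\<lambda>t. \<exists>ms. committed n ms t \<and>
    (good {..<n} 0 0 \<longrightarrow> n - 1 \<le> length ms))"
proof -
  \<comment> \<open>Each round adds at least one move until one vertex is left after
    \<open>n - 1\<close> moves, hence the minimum.\<close>
  let ?I = "\<lambda>j t. \<exists>ms. committed n ms t \<and> (good {..<n} 0 0 \<longrightarrow> min j (n - 1) \<le> length ms)"
  let ?round = "For ''u'' (var ''n'') (For ''v'' (var ''n'') trial)"
  have n: "s ''n'' 0 = n" using com by (simp add: committed_def env_def)
  have "runs search s (n * ((n * ((n * (time_trial n + 2) + 2) + 2) + 2) + 2) + 2) (?I n)"
    unfolding search_def
  proof (rule runs_for[where I = ?I])
    show "?I 0 s" using com by auto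
    show "?I j (t(''h'' := v))" if inv: "?I j t" for j t v
    proof -
      obtain ms where c: "committed n ms t" "good {..<n} 0 0 \<longrightarrow> min j (n - 1) \<le> length ms"
        using inv by blast
      have "committed n ms (t(''h'' := v))" by (rule committed_cong[OF c(1)]) simp_all
      then show ?thesis using c(2) by blast
    qed
    show "aval (var ''n'') t = n" if "\<forall>x. x \<notin> insert ''h'' (writes ?round) \<longrightarrow> t x = s x" for t
      using that n by simp
    show "''h'' \<notin> writes ?round" by simp
    fix j t assume "?I j t"
    then obtain ms where c: "committed n ms t" "good {..<n} 0 0 \<longrightarrow> min j (n - 1) \<le> length ms"
      by blast
    obtain S where reach: "reach n ms S 0 0" using c(1) by (auto simp: committed_def)
    show "runs ?round t (n * ((n * (time_trial n + 2) + 2) + 2) + 2) (?I (Suc j))"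
    proof (rule runs_mono[OF runs_round[OF c(1)] order_refl])
      fix t' assume "tried n ms ({..<n} \<times> {..<n}) t'"
      then obtain ms' where c': "committed n ms' t'"
        and ms': "ms' = ms \<and> (\<forall>x y. (x, y) \<in> {..<n} \<times> {..<n} \<longrightarrow> \<not> promising n ms x y) \<or> length ms < length ms'"
        unfolding tried_def by blast
      have "min (Suc j) (n - 1) \<le> length ms'" if gd: "good {..<n} 0 0"
        using ms'
      proof
        assume "length ms < length ms'"
        then show ?thesis using c(2) gd by auto
      next
        assume *: "ms' = ms \<and> (\<forall>x y. (x, y) \<in> {..<n} \<times> {..<n} \<longrightarrow> \<not> promising n ms x y)"
        then have "\<not> length ms < n - 1" using good_imp_promising[OF gd reach] by blast
        then show ?thesis using * by simp
      qed
      then show "?I (Suc j) t'" using c' by blast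
    qed
  qed
  then show ?thesis
  proof (rule runs_mono)
    show "n * ((n * ((n * (time_trial n + 2) + 2) + 2) + 2) + 2) + 2 \<le> time_search n"
      unfolding time_search_def by (rule order_refl)
    show "\<exists>ms. committed n ms t \<and> (good {..<n} 0 0 \<longrightarrow> n - 1 \<le> length ms)" if "?I n t" for t
      using that by auto
  qed
qed

lemma runs_rename:
  assumes com: "committed n ms s"
  shows "runs rename s (9 * n + 20) (\<lambda>t. \<forall>i<length ms.
    t ''fst'' i = names n (\<lambda>i. fst (ms ! i)) i (fst (ms ! i)) \<and>
    t ''snd'' i = names n (\<lambda>i. fst (ms ! i)) i (snd (ms ! i)))"
proof -
  let ?nm = "names n (\<lambda>i. fst (ms ! i))"
  obtain S where reach: "reach n ms S 0 0" using com by (auto simp: committed_def)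
  have le: "length ms \<le> n" using reach_card[OF reach] by simp
  have n: "s ''n'' 0 = n" and k: "s ''k'' 0 = length ms" and st: "stores s ms"
    using com by (simp_all add: committed_def env_def)
  let ?w = "Write ''nm'' (var ''x'') (var ''x'')"
  have loop1: "runs (For ''x'' (var ''n'') ?w) s (n * (1 + 2) + 2) (\<lambda>t. \<forall>x<n. t ''nm'' x = x)"
  proof (rule runs_for[where I = "\<lambda>j t. \<forall>x<j. t ''nm'' x = x"])
    show "aval (var ''n'') t = n" if "\<forall>x. x \<notin> insert ''x'' (writes ?w) \<longrightarrow> t x = s x" for t
      using that n by simp
    show "runs ?w t 1 (\<lambda>t. \<forall>x<Suc j. t ''nm'' x = x)"
      if "\<forall>x<j. t ''nm'' x = x" "t ''x'' 0 = j" for j t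
      by (rule runs_write) (use that in \<open>simp add: less_Suc_eq\<close>)
  qed simp_all
  let ?I = "\<lambda>j t. (\<forall>x<n. t ''nm'' x = ?nm j x) \<and>
    (\<forall>i<j. t ''fst'' i = ?nm i (fst (ms ! i)) \<and> t ''snd'' i = ?nm i (snd (ms ! i)))"
  have loop2: "runs (For ''i'' (var ''k'') rename_body) s1 (length ms * (4 + 2) + 2) (?I (length ms))"
    if nm: "\<forall>x<n. s1 ''nm'' x = x" and fr: "\<forall>x. x \<notin> insert ''x'' (writes ?w) \<longrightarrow> s1 x = s x" for s1
  proof (rule runs_for[where I = ?I])
    show "?I 0 s1" using nm by simp
    show "?I j (t(''i'' := v))" if "?I j t" for j t v using that by simp
    show "aval (var ''k'') t = length ms"
      if "\<forall>x. x \<notin> insert ''i'' (writes rename_body) \<longrightarrow> t x = s1 x" for t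
      using that fr k by simp
    show "''i'' \<notin> writes rename_body" by simp
    fix j t assume j: "j < length ms" and t: "?I j t" "t ''i'' 0 = j"
      and fr': "\<forall>x. x \<notin> insert ''i'' (writes rename_body) \<longrightarrow> t x = s1 x"
    have ru: "t ''ru'' j = fst (ms ! j)" "t ''rw'' j = snd (ms ! j)" "t ''n'' 0 = n"
      using fr' fr st j n by (simp_all add: stores_def)
    have lt: "fst (ms ! j) < n" "snd (ms ! j) < n" using reach_moves_less[OF reach j] by simp_all
    have "runs rename_body t (1 + (1 + (1 + 1))) (?I (Suc j))"
      unfolding rename_body_def
      by (intro runs_block runs_write) (use t ru lt in \<open>auto simp: less_Suc_eq\<close>)
    then show "runs rename_body t 4 (?I (Suc j))" by (rule runs_time) simp
  qed
  have "runs rename s ((n * (1 + 2) + 2) + ((length ms * (4 + 2) + 2) + 1)) (?I (length ms))"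
    unfolding rename_def
  proof (rule runs_block(2), rule runs_use[OF loop1], rule runs_block(2), rule runs_use[OF loop2])
    show "runs (block []) s2 1 (?I (length ms))" if "?I (length ms) s2" for s2
      using that by (rule runs_block(1)[where Q = "?I (length ms)" and s = s2])
  qed simp_all
  then show ?thesis by (rule runs_mono) (use le in simp_all)
qed

lemma runs_fill_rows:
  assumes n: "s ''n'' 0 = n" and "s ''row'' 0 = 0"
  shows "runs fill_rows s (n * (1 + 2) + 2) (\<lambda>t. \<forall>u\<le>n. t ''row'' u = u * n)"
  unfolding fill_rows_def
proof (rule runs_for[where I = "\<lambda>j t. \<forall>u\<le>j. t ''row'' u = u * n"])
  let ?w = "Write ''row'' (Plus (var ''x'') (Num 1)) (Plus (Read ''row'' (var ''x'')) (var ''n''))"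
  show "aval (var ''n'') t = n" if "\<forall>x. x \<notin> insert ''x'' (writes ?w) \<longrightarrow> t x = s x" for t
    using that n by simp
  show "runs ?w t 1 (\<lambda>t. \<forall>u\<le>Suc j. t ''row'' u = u * n)"
    if "\<forall>u\<le>j. t ''row'' u = u * n" "t ''x'' 0 = j"
      "\<forall>x. x \<notin> insert ''x'' (writes ?w) \<longrightarrow> t x = s x" for j t
  proof (rule runs_write)
    have "t ''n'' 0 = n" using that(3) n by simp
    then show "\<forall>u\<le>Suc j. (t(''row'' := (t ''row'')(aval (Plus (var ''x'') (Num 1)) t :=
        aval (Plus (Read ''row'' (var ''x'')) (var ''n'')) t))) ''row'' u = u * n"
      using that(1,2) by (simp add: le_Suc_eq)
  qed
qed (use assms in simp_all)

end

text \<open>Any \<open>n - 1\<close> committed moves translate into a valid sequence, so acceptance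
  is sound; for twin-width at most 1 the search is bound to commit that many.\<close>

lemma runs_main_program:
  assumes G: "is_graph G" "verts G = {..<n}" and n: "n \<ge> 1"
  shows "runs main_program (encode G) (time_main n) (\<lambda>t.
    t ''out'' 0 = (if twin_width G \<le> 1 then 1 else 0) \<and>
    (twin_width G \<le> 1 \<longrightarrow> (\<exists>Ts. d_sequence 1 G Ts \<and> (\<forall>T\<in>set Ts. card (red T) \<le> 1) \<and> outputs_sequence t Ts)))"
    (is "runs _ _ _ ?Q")
proof -
  interpret adjacency "\<lambda>x y. {x, y} \<in> black G"
    by unfold_locales (simp add: insert_commute)
  have T: "is_trigraph G" using G(1) by (simp add: is_graph_def)
  have ne: "verts G \<noteq> {}" using G(2) n lessThan_empty_iff[of n] by simp
  have card: "card (verts G) = n" using G(2) by simp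
  have enc: "encode G ''n'' 0 = n" "encode G ''row'' 0 = 0" "encode G ''k'' 0 = 0"
    by (simp_all add: encode_def card Let_def)
  have adj: "encode G ''adj'' (u * n + v) = (if {u, v} \<in> black G then 1 else 0)" if "u < n" "v < n" for u v
  proof -
    have "u * n + v < Suc u * n" using that by simp
    also have "\<dots> \<le> n * n" using that by (intro mult_le_mono1) simp
    finally have "u * n + v < n * n" .
    moreover have "(u * n + v) div n = u" "(u * n + v) mod n = v" using that by simp_all
    ultimately show ?thesis by (simp add: encode_def card Let_def)
  qed
  have good: "good {..<n} 0 0" if "twin_width G \<le> 1"
    using twin_width_le1_imp_chain[OF G(1) ne that] inj_on_id unfolding good_def G(2) by blast
  have final: "?Q (t2(''out'' := (t2 ''out'')(0 := (if Suc (length ms) = n then 1 else 0))))"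
    if com: "committed n ms t1" and gd: "good {..<n} 0 0 \<longrightarrow> n - 1 \<le> length ms"
      and nm: "\<forall>i<length ms. t2 ''fst'' i = names n (\<lambda>i. fst (ms ! i)) i (fst (ms ! i)) \<and>
        t2 ''snd'' i = names n (\<lambda>i. fst (ms ! i)) i (snd (ms ! i))" for ms t1 t2
  proof -
    obtain S where reach: "reach n ms S 0 0" using com by (auto simp: committed_def)
    \<comment> \<open>The survivor of the last move is still present, so at most
      \<open>n - 1\<close> moves can have been made.\<close>
    have "S \<noteq> {}" using reach
    proof cases
      case reach_start
      then show ?thesis using n lessThan_empty_iff[of n] by simp
    next
      case (reach_move ms' S' a b p q)
      then show ?thesis by (auto simp: move_def)
    qed
    then have "length ms < n" using reach_card[OF reach] card_gt_0_iff[of S] by auto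
    then have len: "Suc (length ms) = n" if "twin_width G \<le> 1" using gd good[OF that] by simp
    have seq: "\<exists>Ts. d_sequence 1 G Ts \<and> length Ts = n \<and> (\<forall>T\<in>set Ts. card (red T) \<le> 1) \<and>
        (\<forall>i<length ms. contracts_to (Ts ! i) (names n (\<lambda>i. fst (ms ! i)) i (fst (ms ! i)))
        (names n (\<lambda>i. fst (ms ! i)) i (snd (ms ! i))) (n + i) (Ts ! Suc i))" if "Suc (length ms) = n"
      by (rule reach_imp_d_sequence[OF G n reach that])
    then have iff: "Suc (length ms) = n \<longleftrightarrow> twin_width G \<le> 1"
      using len twin_width_le1_iff[OF T ne] by blast
    let ?t = "t2(''out'' := (t2 ''out'')(0 := (if Suc (length ms) = n then 1 else 0)))"
    have "\<exists>Ts. d_sequence 1 G Ts \<and> (\<forall>T\<in>set Ts. card (red T) \<le> 1) \<and> outputs_sequence ?t Ts"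
      if tw: "twin_width G \<le> 1"
    proof -
      obtain Ts where Ts: "d_sequence 1 G Ts" "length Ts = n" "\<forall>T\<in>set Ts. card (red T) \<le> 1"
        "\<And>i. i < length ms \<Longrightarrow> contracts_to (Ts ! i) (names n (\<lambda>i. fst (ms ! i)) i (fst (ms ! i)))
        (names n (\<lambda>i. fst (ms ! i)) i (snd (ms ! i))) (n + i) (Ts ! Suc i)"
        using seq[OF len[OF tw]] by blast
      have "outputs_sequence ?t Ts"
        unfolding outputs_sequence_def
      proof (intro allI impI)
        fix i assume "Suc i < length Ts"
        then have "i < length ms" using Ts(2) len[OF tw] by simp
        then show "contracts_to (Ts ! i) (?t ''fst'' i) (?t ''snd'' i) (length Ts + i) (Ts ! Suc i)"
          using Ts(4) nm Ts(2) by simp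
      qed
      then show ?thesis using Ts(1,3) by blast
    qed
    then show ?thesis using iff by simp
  qed
  have "runs main_program (encode G)
    ((n * (1 + 2) + 2) + (time_search n + ((9 * n + 20) + ((1 + 1 + 1) + 1)))) ?Q"
    unfolding main_program_def
  proof (rule runs_block(2), rule runs_use[OF runs_fill_rows[where s = "encode G", OF enc(1,2)]])
    fix s1 assume rows: "\<forall>u\<le>n. s1 ''row'' u = u * n"
      and fr1: "\<forall>x. x \<notin> writes fill_rows \<longrightarrow> s1 x = encode G x"
    have eqs: "s1 ''n'' = encode G ''n''" "s1 ''adj'' = encode G ''adj''" "s1 ''k'' = encode G ''k''"
      using fr1 by (simp_all add: fill_rows_def)
    have "env n s1" unfolding env_def eqs using rows enc(1) adj by simp
    moreover have "reach n [] {..<n} 0 0" by (rule reach_start) simp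
    ultimately have com1: "committed n [] s1"
      unfolding committed_def stores_def eqs using enc(3) by auto
    show "runs (block [search, rename, Cond (b_eq (Plus (var ''k'') (Num 1)) (var ''n''))
        (assign ''out'' (Num 1)) (assign ''out'' (Num 0))]) s1
        (time_search n + ((9 * n + 20) + ((1 + 1 + 1) + 1))) ?Q"
    proof (rule runs_block(2), rule runs_mono[OF runs_search[OF com1] order_refl])
      fix s2 assume "\<exists>ms. committed n ms s2 \<and> (good {..<n} 0 0 \<longrightarrow> n - 1 \<le> length ms)"
      then obtain ms where com: "committed n ms s2" and gd: "good {..<n} 0 0 \<longrightarrow> n - 1 \<le> length ms"
        by blast
      show "runs (block [rename, Cond (b_eq (Plus (var ''k'') (Num 1)) (var ''n''))
        (assign ''out'' (Num 1)) (assign ''out'' (Num 0))]) s2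
        ((9 * n + 20) + ((1 + 1 + 1) + 1)) ?Q"
      proof (rule runs_block(2), rule runs_use[OF runs_rename[OF com]])
        fix s3 assume nm: "\<forall>i<length ms. s3 ''fst'' i = names n (\<lambda>i. fst (ms ! i)) i (fst (ms ! i)) \<and>
            s3 ''snd'' i = names n (\<lambda>i. fst (ms ! i)) i (snd (ms ! i))"
          and fr3: "\<forall>x. x \<notin> writes rename \<longrightarrow> s3 x = s2 x"
        have nk: "s3 ''n'' 0 = n" "s3 ''k'' 0 = length ms"
          using fr3 com by (simp_all add: committed_def env_def)
        let ?t = "\<lambda>c. s3(''out'' := (s3 ''out'')(0 := c))"
        have Q: "?Q (?t (if Suc (length ms) = n then 1 else 0))" by (rule final[OF com gd nm])
        show "runs (block [Cond (b_eq (Plus (var ''k'') (Num 1)) (var ''n''))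
          (assign ''out'' (Num 1)) (assign ''out'' (Num 0))]) s3 ((1 + 1 + 1) + 1) ?Q"
        proof (rule runs_block(2), rule runs_cond)
          assume "aval (b_eq (Plus (var ''k'') (Num 1)) (var ''n'')) s3 \<noteq> 0"
          then have "Suc (length ms) = n" using nk by simp
          then have "?Q (?t 1)" using Q by simp
          then have "runs (block []) (?t 1) 1 ?Q" by (rule runs_block(1)[where Q = ?Q and s = "?t 1"])
          then show "runs (assign ''out'' (Num 1)) s3 1 (\<lambda>t. runs (block []) t 1 ?Q)"
            by (intro runs_assign) simp
        next
          assume "aval (b_eq (Plus (var ''k'') (Num 1)) (var ''n'')) s3 = 0"
          then have "Suc (length ms) \<noteq> n" using nk by simp
          then have "?Q (?t 0)" using Q by simp
          then have "runs (block []) (?t 0) 1 ?Q" by (rule runs_block(1)[where Q = ?Q and s = "?t 0"])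
          then show "runs (assign ''out'' (Num 0)) s3 1 (\<lambda>t. runs (block []) t 1 ?Q)"
            by (intro runs_assign) simp
        qed
      qed
    qed
  qed
  then show ?thesis by (rule runs_time) (simp add: time_main_def)
qed

lemma polynomially_bounded_time_main: "polynomially_bounded time_main"
  unfolding time_main_def[abs_def] time_search_def time_trial_def time_greedy_def time_step_def
    time_try_def
  by (intro polynomially_bounded_intros)

theorem theorem30:
  "poly_time_recognizable (\<lambda>G. twin_width G \<le> 1) \<and>
   poly_time (\<lambda>G. twin_width G \<le> 1)
     (\<lambda>G s. \<exists>Ts. d_sequence 1 G Ts \<and> (\<forall>T \<in> set Ts. card (red T) \<le> 1) \<and> outputs_sequence s Ts)"
proof -
  obtain p :: "nat poly" where p: "\<And>n. time_main n \<le> poly p n"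
    using polynomially_bounded_time_main unfolding polynomially_bounded_def by blast
  \<comment> \<open>One program and one polynomial serve both halves: the answer and the sequence
    are read from the same final memory.\<close>
  have main: "\<exists>t s. exec main_program (encode G) t s \<and> t \<le> poly p (card (verts G)) \<and>
      s ''out'' 0 = (if twin_width G \<le> 1 then 1 else 0) \<and>
      (twin_width G \<le> 1 \<longrightarrow>
        (\<exists>Ts. d_sequence 1 G Ts \<and> (\<forall>T \<in> set Ts. card (red T) \<le> 1) \<and> outputs_sequence s Ts))"
    if "input_graph G" for G
  proof -
    obtain n where G: "is_graph G" "verts G = {..<n}" "n \<ge> 1"
      using \<open>input_graph G\<close> unfolding input_graph_def by blast
    have "time_main n \<le> poly p (card (verts G))" using p[of n] G(2) by simp
    from runs_time[OF runs_main_program[OF G] this] show ?thesis unfolding runs_def .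
  qed
  show ?thesis
    unfolding poly_time_recognizable_def poly_time_def
    by (intro conjI exI[of _ main_program] exI[of _ p] allI impI) (use main in blast)+
qed

end
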